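(* For any $d\in\mathbb N$, there exist choices for the damping parameter $\tau$ and the number of smoothing steps $\nu$, independent of $h$ and $p$, such that the two-grid method in $S^d$ (with coarse space $(S_c)^d$) with the smoother $L=\sum_{\alpha\in\{0,1\}^d}Q_\alpha' L_\alpha Q_\alpha$ induced by the subspace operators $L_\alpha$ converges with a rate $q<1$ which does not depend on the grid size $h$ or the spline degree $p$.
   Context: Spline spaces. For positive integers $p$ (spline degree) and $m$, put $h=1/m$ (grid size) and let $$S=\{u\in C^{p-1}(0,1): u|_{((j-1)h,jh)}\in\mathcal P^p\ \ \forall j=1,\dots,m\},$$ with $\mathcal P^p$ the polynomials of degree at most $p$. $S_c\subset S$ is the analogous coarse spline space of the same degree $p$ with uniform mesh size $2h$ (so $m$ is even). Let $$S_0=\{u\in S: u^{(2l+1)}(0)=u^{(2l+1)}(1)=0\ \ \forall l\in\mathbb N_0 \text{ with } 2l+1<p\},$$ let $S_1$ be the $L_2(0,1)$-orthogonal complement of $S_0$ in $S$, let $Q_0:S\to S_0$ be the $L_2(0,1)$-orthogonal projector and $Q_1=I-Q_0:S\to S_1$. Let $\Omega=(0,1)^d$, $S^d=S\otimes\dots\otimes S$ ($d$ factors), $(S_c)^d$ likewise, and for $\alpha\in\{0,1\}^d$ let $S_\alpha=S_{\alpha_1}\otimes\dots\otimes S_{\alpha_d}$ and $Q_\alpha=Q_{\alpha_1}\otimes\dots\otimes Q_{\alpha_d}:S^d\to S_\alpha$. Primes on spaces denote duals, primes on operators denote adjoints. Operators. $A:S^d\to (S^d)'$ is given by $\langle Au,v\rangle=\int_\Omega(\nabla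 u\cdot\nabla v+uv)\,dx$. The univariate mass and stiffness operators $M,K:S\to S'$ are $\langle Mu,v\rangle=\int_0^1 uv\,dx$ and $\langle Ku,v\rangle=\int_0^1u'v'\,dx$. For $\beta\in\{0,1\}$, $M_\beta=Q_\beta'MQ_\beta$ and $K_\beta=Q_\beta'KQ_\beta$, regarded as operators $S_\beta\to S_\beta'$. Local smoothers. Let $\sigma=12h^{-2}$. The restriction of $A$ to $S_\alpha$ is $$A_\alpha=Q_\alpha'AQ_\alpha=M_{\alpha_1}\otimes\dots\otimes M_{\alpha_d}+\sum_{j=1}^d M_{\alpha_1}\otimes\dots\otimes M_{\alpha_{j-1}}\otimes K_{\alpha_j}\otimes M_{\alpha_{j+1}}\otimes\dots\otimes M_{\alpha_d},$$ and $L_\alpha:S_\alpha\to S_\alpha'$ is obtained from this expression by replacing every occurrence of $K_0$ by $\sigma M_0$ (leaving $K_1$ unchanged). The overall smoother is $L=\sum_\alpha Q_\alpha'L_\alpha Q_\alpha:S^d\to(S^d)'$, which is self-adjoint and positive definite. Two-grid method for $Au=f$. Let $V=S^d$, $V_c=(S_c)^d$, $P:V_c\to V$ the canonical embedding, and $A_c=P'AP$. Given $f\in V'$ and an iterate $u^{(k)}\in V$, set $u^{(k,0)}=u^{(k)}$, perform $\nu\in\mathbb N$ smoothing steps $u^{(k,j)}=u^{(k,j-1)}+\tau L^{-1}(f-Au^{(k,j-1)})$, $j=1,\dots,\nu$, with damping parameter $\tau>0$, and then the coarse-grid correction $u^{(k+1)}=u^{(k,\nu)}+PA_c^{-1}P'(f-Au^{(k,\nu)})$.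 *)

theory Defs
  imports "HOL-Analysis.Analysis"
begin

section \<open>Univariate spline spaces\<close>

text \<open>
  A function on the open interval \<open>(0,1)\<close> is represented by the total function that vanishes
  outside \<open>(0,1)\<close>; equality of representatives is then equality on \<open>(0,1)\<close>.  Derivatives are
  only ever inspected inside the (open) interval, so the zero extension plays no role for them.
\<close>

definition Ck_on :: "nat \<Rightarrow> real set \<Rightarrow> (real \<Rightarrow> real) \<Rightarrow> bool" where
  "Ck_on k X u \<longleftrightarrow>
     (\<forall>i<k. \<forall>x\<in>X. (deriv ^^ i) u differentiable (at x)) \<and> continuous_on X ((deriv ^^ k) u)"

definition spline_space :: "nat \<Rightarrow> nat \<Rightarrow> (real \<Rightarrow> real) set" where
  "spline_space p m =
     {u. (\<forall>x. x \<notin> {0<..<1} \<longrightarrow> u x = 0) \<and>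
         Ck_on (p - 1) {0<..<1} u \<and>
         (\<forall>j\<in>{1..m}. \<exists>g :: real poly. degree g \<le> p \<and>
            (\<forall>x\<in>{(real j - 1) / real m <..< real j / real m}. u x = poly g x))}"

definition l2_inner :: "(real \<Rightarrow> real) \<Rightarrow> (real \<Rightarrow> real) \<Rightarrow> real" where
  "l2_inner u v = (LINT x:{0<..<1}|lborel. u x * v x)"

text \<open>Boundary values of derivatives are one-sided limits from inside the interval.\<close>

definition spline_space0 :: "nat \<Rightarrow> nat \<Rightarrow> (real \<Rightarrow> real) set" where
  "spline_space0 p m =
     {u \<in> spline_space p m. \<forall>l. 2 * l + 1 < p \<longrightarrow>
        ((deriv ^^ (2 * l + 1)) u \<longlongrightarrow> 0) (at_right 0) \<and>
        ((deriv ^^ (2 * l + 1)) u \<longlongrightarrow> 0) (at_left 1)}"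

definition spline_space1 :: "nat \<Rightarrow> nat \<Rightarrow> (real \<Rightarrow> real) set" where
  "spline_space1 p m = {u \<in> spline_space p m. \<forall>v\<in>spline_space0 p m. l2_inner u v = 0}"

definition l2_proj :: "(real \<Rightarrow> real) set \<Rightarrow> (real \<Rightarrow> real) \<Rightarrow> real \<Rightarrow> real" where
  "l2_proj W u = (THE w. w \<in> W \<and> (\<forall>v\<in>W. l2_inner (\<lambda>x. u x - w x) v = 0))"

text \<open>
  The index set \<open>{0,1}\<close> is rendered as \<^typ>\<open>bool\<close>, with \<^term>\<open>False\<close> for \<open>0\<close> and \<^term>\<open>True\<close>
  for \<open>1\<close>.
\<close>

definition split_space :: "nat \<Rightarrow> nat \<Rightarrow> bool \<Rightarrow> (real \<Rightarrow> real) set" where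
  "split_space p m b = (if b then spline_space1 p m else spline_space0 p m)"

definition split_proj :: "nat \<Rightarrow> nat \<Rightarrow> bool \<Rightarrow> (real \<Rightarrow> real) \<Rightarrow> real \<Rightarrow> real" where
  "split_proj p m b u =
     (if b then (\<lambda>x. u x - l2_proj (spline_space0 p m) u x)
      else l2_proj (spline_space0 p m) u)"

section \<open>Univariate operators\<close>

text \<open>
  An operator \<open>T : X \<rightarrow> X'\<close> is rendered as a curried function of two arguments, \<open>T u v\<close> being the
  duality pairing of \<open>T u \<in> X'\<close> with \<open>v\<close>.  In particular \<open>Q' T Q\<close> becomes
  \<open>\<lambda>u v. T (Q u) (Q v)\<close>.
\<close>

definition mass_op :: "(real \<Rightarrow> real) \<Rightarrow> (real \<Rightarrow> real) \<Rightarrow> real" where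
  "mass_op u v = l2_inner u v"

text \<open>
  For \<open>p = 1\<close> the classical derivative fails to exist only at the finitely many grid points, a
  null set, so that the integral is that of the weak derivatives.
\<close>

definition stiff_op :: "(real \<Rightarrow> real) \<Rightarrow> (real \<Rightarrow> real) \<Rightarrow> real" where
  "stiff_op u v = (LINT x:{0<..<1}|lborel. deriv u x * deriv v x)"

definition mass_part :: "nat \<Rightarrow> nat \<Rightarrow> bool \<Rightarrow> (real \<Rightarrow> real) \<Rightarrow> (real \<Rightarrow> real) \<Rightarrow> real" where
  "mass_part p m b u v = mass_op (split_proj p m b u) (split_proj p m b v)"

definition stiff_part :: "nat \<Rightarrow> nat \<Rightarrow> bool \<Rightarrow> (real \<Rightarrow> real) \<Rightarrow> (real \<Rightarrow> real) \<Rightarrow> real" where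
  "stiff_part p m b u v = stiff_op (split_proj p m b u) (split_proj p m b v)"

section \<open>Tensor products of function spaces and operators\<close>

definition pure_tensor :: "('n::finite \<Rightarrow> real \<Rightarrow> real) \<Rightarrow> real ^ 'n \<Rightarrow> real" where
  "pure_tensor u x = (\<Prod>i\<in>UNIV. u i (x $ i))"

definition tensor_rep ::
  "('n::finite \<Rightarrow> (real \<Rightarrow> real) set) \<Rightarrow> ('n \<Rightarrow> real \<Rightarrow> real) list \<Rightarrow> (real ^ 'n \<Rightarrow> real) \<Rightarrow> bool" where
  "tensor_rep W us w \<longleftrightarrow>
     (\<forall>u\<in>set us. \<forall>i. u i \<in> W i) \<and> w = (\<lambda>x. \<Sum>u\<leftarrow>us. pure_tensor u x)"

definition tensor_space :: "('n::finite \<Rightarrow> (real \<Rightarrow> real) set) \<Rightarrow> (real ^ 'n \<Rightarrow> real) set" where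
  "tensor_space W = {w. \<exists>us. tensor_rep W us w}"

text \<open>
  The tensor product of linear maps (of operators into the dual, respectively) is determined by its
  action on pure tensors.  For linear \<open>T i\<close> (bilinear \<open>B i\<close>) on subspaces \<open>W i\<close> the value does not
  depend on the representation that is selected.
\<close>

definition tensor_map ::
  "('n::finite \<Rightarrow> (real \<Rightarrow> real) set) \<Rightarrow> ('n \<Rightarrow> (real \<Rightarrow> real) \<Rightarrow> real \<Rightarrow> real)
     \<Rightarrow> (real ^ 'n \<Rightarrow> real) \<Rightarrow> real ^ 'n \<Rightarrow> real" where
  "tensor_map W T w =
     (let us = (SOME us. tensor_rep W us w)
      in (\<lambda>x. \<Sum>u\<leftarrow>us. pure_tensor (\<lambda>i. T i (u i)) x))"

definition tensor_op ::
  "('n::finite \<Rightarrow> (real \<Rightarrow> real) set) \<Rightarrow> ('n \<Rightarrow> (real \<Rightarrow> real) \<Rightarrow> (real \<Rightarrow> real) \<Rightarrow> real)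
     \<Rightarrow> (real ^ 'n \<Rightarrow> real) \<Rightarrow> (real ^ 'n \<Rightarrow> real) \<Rightarrow> real" where
  "tensor_op W B w z =
     (let us = (SOME us. tensor_rep W us w); vs = (SOME vs. tensor_rep W vs z)
      in (\<Sum>u\<leftarrow>us. \<Sum>v\<leftarrow>vs. \<Prod>i\<in>UNIV. B i (u i) (v i)))"

section \<open>The multivariate problem and the smoother\<close>

definition tensor_splines :: "nat \<Rightarrow> nat \<Rightarrow> (real ^ 'n::finite \<Rightarrow> real) set" where
  "tensor_splines p m = tensor_space (\<lambda>_. spline_space p m)"

definition tensor_split_space ::
  "nat \<Rightarrow> nat \<Rightarrow> ('n::finite \<Rightarrow> bool) \<Rightarrow> (real ^ 'n \<Rightarrow> real) set" where
  "tensor_split_space p m \<alpha> = tensor_space (\<lambda>i. split_space p m (\<alpha> i))"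

definition tensor_split_proj ::
  "nat \<Rightarrow> nat \<Rightarrow> ('n::finite \<Rightarrow> bool) \<Rightarrow> (real ^ 'n \<Rightarrow> real) \<Rightarrow> real ^ 'n \<Rightarrow> real" where
  "tensor_split_proj p m \<alpha> = tensor_map (\<lambda>_. spline_space p m) (\<lambda>i. split_proj p m (\<alpha> i))"

definition grad :: "(real ^ 'n::finite \<Rightarrow> real) \<Rightarrow> real ^ 'n \<Rightarrow> real ^ 'n" where
  "grad u x = (\<chi> j. deriv (\<lambda>t. u (x + t *\<^sub>R axis j 1)) 0)"

definition system_op :: "(real ^ 'n::finite \<Rightarrow> real) \<Rightarrow> (real ^ 'n \<Rightarrow> real) \<Rightarrow> real" where
  "system_op u v = (LINT x:box 0 1|lborel. grad u x \<bullet> grad v x + u x * v x)"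

definition smoother_sigma :: "nat \<Rightarrow> real" where
  "smoother_sigma m = (let h = 1 / real m in 12 / h\<^sup>2)"

text \<open>
  With \<open>\<kappa> = stiff_part p m\<close> this is the tensor-product expression for the restriction
  \<open>Q\<^sub>\<alpha>' A Q\<^sub>\<alpha>\<close> of the system operator to \<open>S\<^sub>\<alpha>\<close>.
\<close>

definition subspace_expr ::
  "nat \<Rightarrow> nat \<Rightarrow> (bool \<Rightarrow> (real \<Rightarrow> real) \<Rightarrow> (real \<Rightarrow> real) \<Rightarrow> real) \<Rightarrow> ('n::finite \<Rightarrow> bool)
     \<Rightarrow> (real ^ 'n \<Rightarrow> real) \<Rightarrow> (real ^ 'n \<Rightarrow> real) \<Rightarrow> real" where
  "subspace_expr p m \<kappa> \<alpha> u v =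
     tensor_op (\<lambda>i. split_space p m (\<alpha> i)) (\<lambda>i. mass_part p m (\<alpha> i)) u v +
     (\<Sum>j\<in>UNIV. tensor_op (\<lambda>i. split_space p m (\<alpha> i))
        (\<lambda>i. if i = j then \<kappa> (\<alpha> i) else mass_part p m (\<alpha> i)) u v)"

definition local_smoother ::
  "nat \<Rightarrow> nat \<Rightarrow> ('n::finite \<Rightarrow> bool) \<Rightarrow> (real ^ 'n \<Rightarrow> real) \<Rightarrow> (real ^ 'n \<Rightarrow> real) \<Rightarrow> real" where
  "local_smoother p m =
     subspace_expr p m
       ((stiff_part p m)(False := \<lambda>u v. smoother_sigma m * mass_part p m False u v))"

definition smoother ::
  "nat \<Rightarrow> nat \<Rightarrow> (real ^ 'n::finite \<Rightarrow> real) \<Rightarrow> (real ^ 'n \<Rightarrow> real) \<Rightarrow> real" where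
  "smoother p m u v =
     (\<Sum>\<alpha>\<in>UNIV. local_smoother p m \<alpha> (tensor_split_proj p m \<alpha> u) (tensor_split_proj p m \<alpha> v))"

section \<open>The two-grid method\<close>

definition dual_space :: "('a \<Rightarrow> real) set \<Rightarrow> (('a \<Rightarrow> real) \<Rightarrow> real) set" where
  "dual_space V =
     {f. (\<forall>u\<in>V. \<forall>v\<in>V. f (\<lambda>x. u x + v x) = f u + f v) \<and>
         (\<forall>c. \<forall>u\<in>V. f (\<lambda>x. c * u x) = c * f u)}"

definition inv_op ::
  "('a \<Rightarrow> real) set \<Rightarrow> (('a \<Rightarrow> real) \<Rightarrow> ('a \<Rightarrow> real) \<Rightarrow> real) \<Rightarrow> (('a \<Rightarrow> real) \<Rightarrow> real)
     \<Rightarrow> 'a \<Rightarrow> real" where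
  "inv_op V T f = (THE w. w \<in> V \<and> (\<forall>v\<in>V. T w v = f v))"

definition smoothing_step ::
  "nat \<Rightarrow> nat \<Rightarrow> real \<Rightarrow> ((real ^ 'n::finite \<Rightarrow> real) \<Rightarrow> real) \<Rightarrow> (real ^ 'n \<Rightarrow> real)
     \<Rightarrow> real ^ 'n \<Rightarrow> real" where
  "smoothing_step p m \<tau> f u =
     (\<lambda>x. u x + \<tau> * inv_op (tensor_splines p m) (smoother p m) (\<lambda>v. f v - system_op u v) x)"

text \<open>
  The coarse space, of mesh size \<open>2 * (1 / m) = 1 / (m div 2)\<close> for even \<open>m\<close>, is literally a subset
  of the fine one, so the canonical embedding \<open>P\<close> is the identity, \<open>P'\<close> restricts functionals to the
  coarse space, and \<open>P' A P\<close> is \<^term>\<open>system_op\<close> on the coarse space.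
\<close>

definition coarse_correction ::
  "nat \<Rightarrow> nat \<Rightarrow> ((real ^ 'n::finite \<Rightarrow> real) \<Rightarrow> real) \<Rightarrow> (real ^ 'n \<Rightarrow> real)
     \<Rightarrow> real ^ 'n \<Rightarrow> real" where
  "coarse_correction p m f u =
     (\<lambda>x. u x + inv_op (tensor_splines p (m div 2)) system_op (\<lambda>v. f v - system_op u v) x)"

definition two_grid_step ::
  "nat \<Rightarrow> nat \<Rightarrow> real \<Rightarrow> nat \<Rightarrow> ((real ^ 'n::finite \<Rightarrow> real) \<Rightarrow> real) \<Rightarrow> (real ^ 'n \<Rightarrow> real)
     \<Rightarrow> real ^ 'n \<Rightarrow> real" where
  "two_grid_step p m \<tau> \<nu> f u = coarse_correction p m f ((smoothing_step p m \<tau> f ^^ \<nu>) u)"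

definition op_norm ::
  "(('a \<Rightarrow> real) \<Rightarrow> ('a \<Rightarrow> real) \<Rightarrow> real) \<Rightarrow> ('a \<Rightarrow> real) \<Rightarrow> real" where
  "op_norm T u = sqrt (T u u)"

definition converges_with_rate ::
  "('a \<Rightarrow> real) set \<Rightarrow> (('a \<Rightarrow> real) \<Rightarrow> real) \<Rightarrow> (('a \<Rightarrow> real) \<Rightarrow> 'a \<Rightarrow> real) \<Rightarrow> ('a \<Rightarrow> real)
     \<Rightarrow> real \<Rightarrow> bool" where
  "converges_with_rate V N \<Phi> u q \<longleftrightarrow>
     (\<forall>u0\<in>V. \<forall>k. N (\<lambda>x. (\<Phi> ^^ Suc k) u0 x - u x) \<le> q * N (\<lambda>x. (\<Phi> ^^ k) u0 x - u x))"

end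

theory Submission
  imports Defs "HOL-Library.Function_Algebras"
begin

text \<open>
  Two-grid convergence in both norms follows from \<open>A \<le> 2 L\<close> and the approximation property
  \<open>|(I - T)u|\<^sub>L\<^sup>2 \<le> C |u|\<^sub>A\<^sup>2\<close>, with \<open>T\<close> the \<open>A\<close>-orthogonal projection onto the coarse space:
  one has \<open>\<tau> \<nu> |(I - \<tau> L\<^bsup>-1\<^esup> A)\<^sup>\<nu> u|\<^sub>A\<^sup>2 \<le> |u|\<^sub>L\<^sup>2\<close>, and the estimate in the \<open>A\<close>-norm is the
  \<open>A\<close>-adjoint one.

  In one variable everything rests on two inequalities with constants independent of \<open>p\<close>.  In \<open>S\<^sub>0\<close> one
  has \<open>|u'|\<^sup>2 = - <u, u''>\<close>, which reduces the inverse inequality \<open>|u'| \<le> sqrt 12 / h |u|\<close> to the next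
  lower degree with the complementary boundary conditions.  Dually, a function orthogonal to such a
  spline space has an antiderivative orthogonal to the space of the next lower degree, which reduces the
  approximation estimate to Poincare's inequality on the mesh elements.

  In several variables \<open>A\<close> and \<open>L\<close> are sums of Kronecker products, and Kronecker products of positive
  semidefinite forms are monotone in each factor.  The approximation property is an Aubin-Nitsche
  argument whose elliptic regularity is discrete: the discrete Laplacian \<open>I + (\<Sum>j. D\<^sub>j)\<close> has commuting
  positive semidefinite summands, so its graph norm controls all \<open>D\<^sub>j D\<^sub>k\<close>.  The approximant is the tensor
  product of the \<open>L\<^sub>2\<close>-projections onto the coarse \<open>S\<^sub>0\<close>, which are \<open>L\<^sub>2\<close>- and \<open>H\<^sup>1\<close>-stable and map into
  the coarse space.
\<close>

section \<open>Forms on subspaces\<close>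

text \<open>The obstacle is that an inverse inequality with a constant independent of
  \<open>p\<close> fails on the full spline space, as polynomials of degree \<open>p\<close> show.
  The conditions defining \<open>S\<^sub>0\<close> annihilate the boundary terms in the partial
  integrations. This makes the replacement of stiffness by sigma times mass admissible there, and it
  is why the approximant is built from coarse \<open>S\<^sub>0\<close> projections and not from
  projections onto the whole coarse space. Constants: affine functions on one element give 12;
  comparison of the mass projection with the Ritz projection turns 12 into 26 = 2 + 2 * 12. The
  approximation constant in dimension \<open>d\<close> is 26 + 48 * 39 * d^3, where 48 is sigma
  times the squared coarse mesh size. The damping 1/2 is the reciprocal of the 2 in
  \<open>A \<le> 2 L\<close>. A second obstacle is formal: \<open>tensor_map\<close> and
  \<open>tensor_op\<close> choose a representation, and \<open>grad\<close> uses a pointwise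
  \<open>deriv\<close> that takes default values on grid planes for \<open>p = 1\<close>. All
  multivariate objects are therefore rewritten in coordinates over an orthonormal product basis,
  where they become \<open>kron\<close> forms.\<close>

instantiation "fun" :: (type, real_vector) real_vector
begin

definition scaleR_fun_def: "c *\<^sub>R f = (\<lambda>x. c *\<^sub>R f x)"

instance
  by standard (auto simp: scaleR_fun_def fun_eq_iff algebra_simps)

end

text \<open>Linearity is required on a carrier only: \<open>l2_inner\<close>,
  \<open>stiff_op\<close> and \<open>oproj\<close> are additive only where the integrands are
  integrable or the projection exists.\<close>

definition lin_on :: "'v::real_vector set \<Rightarrow> ('v \<Rightarrow> 'w::real_vector) \<Rightarrow> bool" where
  "lin_on V f \<longleftrightarrow> (\<forall>u\<in>V. \<forall>v\<in>V. f (u + v) = f u + f v) \<and> (\<forall>c. \<forall>u\<in>V. f (c *\<^sub>R u) = c *\<^sub>R f u)"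

lemma lin_on_add: "lin_on V f \<Longrightarrow> u \<in> V \<Longrightarrow> v \<in> V \<Longrightarrow> f (u + v) = f u + f v"
  by (auto simp: lin_on_def)

lemma lin_on_scale: "lin_on V f \<Longrightarrow> u \<in> V \<Longrightarrow> f (c *\<^sub>R u) = c *\<^sub>R f u"
  by (auto simp: lin_on_def)

lemma lin_on_subset: "lin_on V f \<Longrightarrow> W \<subseteq> V \<Longrightarrow> lin_on W f"
  unfolding lin_on_def by blast

lemma lin_on_zero: "lin_on V f \<Longrightarrow> subspace V \<Longrightarrow> f 0 = 0"
  using lin_on_scale[of V f 0 0] by (simp add: subspace_0)

lemma lin_on_sum:
  assumes "lin_on V f" "subspace V" "\<And>i. i \<in> A \<Longrightarrow> u i \<in> V"
  shows "f (\<Sum>i\<in>A. u i) = (\<Sum>i\<in>A. f (u i))"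
  using assms(3)
proof (induction A rule: infinite_finite_induct)
  case (insert x F)
  then have "(\<Sum>i\<in>F. u i) \<in> V" by (intro subspace_sum[OF assms(2)]) auto
  with insert show ?case using lin_on_add[OF assms(1), of "u x" "sum u F"] by auto
qed (auto simp: lin_on_zero[OF assms(1,2)])

lemma lin_on_diff:
  assumes "lin_on V f" "subspace V" "u \<in> V" "v \<in> V"
  shows "f (u - v) = f u - f v"
  using lin_on_add[OF assms(1), of u "- 1 *\<^sub>R v"] lin_on_scale[OF assms(1), of v "- 1"] assms
  by (simp add: subspace_neg)

lemma lin_onI:
  "(\<And>u v. u \<in> V \<Longrightarrow> v \<in> V \<Longrightarrow> f (u + v) = f u + f v) \<Longrightarrow>
   (\<And>c u. u \<in> V \<Longrightarrow> f (c *\<^sub>R u) = c *\<^sub>R f u) \<Longrightarrow> lin_on V f"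
  by (auto simp: lin_on_def)

lemma dual_space_lin_on: "f \<in> dual_space V \<longleftrightarrow> lin_on V f"
  by (simp add: dual_space_def lin_on_def plus_fun_def scaleR_fun_def)

locale sform =
  fixes V :: "'v::real_vector set" and B :: "'v \<Rightarrow> 'v \<Rightarrow> real"
  assumes sub: "subspace V"
    and add_left: "u \<in> V \<Longrightarrow> v \<in> V \<Longrightarrow> w \<in> V \<Longrightarrow> B (u + v) w = B u w + B v w"
    and scale_left: "u \<in> V \<Longrightarrow> w \<in> V \<Longrightarrow> B (c *\<^sub>R u) w = c * B u w"
    and sym: "u \<in> V \<Longrightarrow> v \<in> V \<Longrightarrow> B u v = B v u"
begin

lemma closed [simp]:
  "u \<in> V \<Longrightarrow> v \<in> V \<Longrightarrow> u + v \<in> V" "u \<in> V \<Longrightarrow> v \<in> V \<Longrightarrow> u - v \<in> V"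
  "u \<in> V \<Longrightarrow> c *\<^sub>R u \<in> V" "0 \<in> V" "u \<in> V \<Longrightarrow> - u \<in> V"
  using sub by (auto intro: subspace_add subspace_diff subspace_scale subspace_0 subspace_neg)

lemma lin_left: "w \<in> V \<Longrightarrow> lin_on V (\<lambda>u. B u w)"
  by (rule lin_onI) (auto simp: add_left scale_left)

lemma lin_right: "w \<in> V \<Longrightarrow> lin_on V (B w)"
  by (rule lin_onI) (metis add_left closed(1) sym, metis scale_left closed(3) sym real_scaleR_def)

lemma add_right: "u \<in> V \<Longrightarrow> v \<in> V \<Longrightarrow> w \<in> V \<Longrightarrow> B w (u + v) = B w u + B w v"
  using lin_on_add[OF lin_right] .

lemma scale_right: "u \<in> V \<Longrightarrow> w \<in> V \<Longrightarrow> B w (c *\<^sub>R u) = c * B w u"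
  using lin_on_scale[OF lin_right] by simp

lemma diff_left: "u \<in> V \<Longrightarrow> v \<in> V \<Longrightarrow> w \<in> V \<Longrightarrow> B (u - v) w = B u w - B v w"
  using lin_on_diff[OF lin_left sub] .

lemma diff_right: "u \<in> V \<Longrightarrow> v \<in> V \<Longrightarrow> w \<in> V \<Longrightarrow> B w (u - v) = B w u - B w v"
  using lin_on_diff[OF lin_right sub] .

lemma zero_left [simp]: "w \<in> V \<Longrightarrow> B 0 w = 0"
  using lin_on_zero[OF lin_left sub] .

lemma zero_right [simp]: "w \<in> V \<Longrightarrow> B w 0 = 0"
  using lin_on_zero[OF lin_right sub] .

lemma sum_left: "(\<And>i. i \<in> A \<Longrightarrow> u i \<in> V) \<Longrightarrow> w \<in> V \<Longrightarrow> B (\<Sum>i\<in>A. u i) w = (\<Sum>i\<in>A. B (u i) w)"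
  using lin_on_sum[OF lin_left sub] .

lemma sum_right: "(\<And>i. i \<in> A \<Longrightarrow> u i \<in> V) \<Longrightarrow> w \<in> V \<Longrightarrow> B w (\<Sum>i\<in>A. u i) = (\<Sum>i\<in>A. B w (u i))"
  using lin_on_sum[OF lin_right sub] .

lemma square_add: "u \<in> V \<Longrightarrow> v \<in> V \<Longrightarrow> B (u + v) (u + v) = B u u + 2 * B u v + B v v"
  by (simp add: add_left add_right sym[of v u])

lemma square_diff: "u \<in> V \<Longrightarrow> v \<in> V \<Longrightarrow> B (u - v) (u - v) = B u u - 2 * B u v + B v v"
  by (simp add: diff_left diff_right sym[of v u])

lemma restrict: "subspace W \<Longrightarrow> W \<subseteq> V \<Longrightarrow> sform W B"
  by unfold_locales (auto simp: add_left scale_left subset_iff intro: sym)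

end

locale psform = sform +
  assumes nonneg: "u \<in> V \<Longrightarrow> 0 \<le> B u u"
begin

lemma cauchy_schwarz:
  assumes u: "u \<in> V" and v: "v \<in> V"
  shows "(B u v)\<^sup>2 \<le> B u u * B v v"
proof -
  have q: "0 \<le> B u u - 2 * t * B u v + t\<^sup>2 * B v v" for t
    using nonneg[of "u - t *\<^sub>R v"] u v
    by (simp add: square_diff scale_left scale_right power2_eq_square algebra_simps)
  show ?thesis
  proof (cases "B v v = 0")
    case True
    have "B u v = 0"
    proof (rule ccontr)
      assume "B u v \<noteq> 0"
      \<comment> \<open>Without a quadratic term the polynomial in \<open>t\<close> is affine, and
        this \<open>t\<close> gives it the value -1.\<close>
      with q[of "(B u u + 1) / (2 * B u v)"] True show False by simp
    qed
    then show ?thesis using True by simp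
  next
    case False
    then have pos: "B v v > 0" using nonneg[OF v] by simp
    have "0 \<le> B u u - (B u v)\<^sup>2 / B v v"
      using q[of "B u v / B v v"] pos by (simp add: power2_eq_square field_simps)
    then show ?thesis using pos by (simp add: field_simps)
  qed
qed

lemma cauchy_schwarz_sqrt:
  assumes "u \<in> V" "v \<in> V"
  shows "\<bar>B u v\<bar> \<le> sqrt (B u u) * sqrt (B v v)"
  using real_sqrt_le_mono[OF cauchy_schwarz[OF assms]] by (simp add: real_sqrt_mult)

lemma triangle:
  assumes "u \<in> V" "v \<in> V"
  shows "sqrt (B (u + v) (u + v)) \<le> sqrt (B u u) + sqrt (B v v)"
proof (rule real_le_lsqrt)
  have "B (u + v) (u + v) \<le> B u u + 2 * (sqrt (B u u) * sqrt (B v v)) + B v v"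
    using cauchy_schwarz_sqrt[OF assms] by (simp add: square_add assms)
  also have "\<dots> = (sqrt (B u u) + sqrt (B v v))\<^sup>2"
    using nonneg assms by (simp add: power2_sum algebra_simps)
  finally show "B (u + v) (u + v) \<le> (sqrt (B u u) + sqrt (B v v))\<^sup>2" .
qed (simp add: nonneg assms)

lemma square_add_le:
  assumes "u \<in> V" "v \<in> V"
  shows "B (u + v) (u + v) \<le> 2 * B u u + 2 * B v v"
  using nonneg[of "u - v"] assms by (simp add: square_add square_diff)

lemma restrict_psd: "subspace W \<Longrightarrow> W \<subseteq> V \<Longrightarrow> psform W B"
  by (intro psform.intro restrict) (auto simp: psform_axioms_def nonneg subset_iff)

end

locale pdform = psform +
  assumes definite: "u \<in> V \<Longrightarrow> B u u = 0 \<Longrightarrow> u = 0"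
begin

lemma eqI:
  assumes "u \<in> V" "w \<in> V" "\<And>v. v \<in> V \<Longrightarrow> B u v = B w v"
  shows "u = w"
  using definite[of "u - w"] assms by (simp add: diff_left)

lemma restrict_pd: "subspace W \<Longrightarrow> W \<subseteq> V \<Longrightarrow> pdform W B"
  by (intro pdform.intro restrict_psd) (auto simp: pdform_axioms_def definite subset_iff)

end

section \<open>Closure properties of semidefinite and definite forms\<close>

lemma psform_add:
  assumes "psform V A" "psform V B"
  shows "psform V (\<lambda>u v. A u v + B u v)"
proof -
  interpret A: psform V A by fact
  interpret B: psform V B by fact
  show ?thesis
  proof unfold_locales
    fix u v assume "u \<in> V" "v \<in> V"
    then show "A u v + B u v = A v u + B v u" using A.sym[of u v] B.sym[of u v] by simp
  qed (simp_all add: A.sub A.add_left B.add_left A.scale_left B.scale_left A.nonneg B.nonneg distrib_left)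
qed

lemma psform_scale:
  assumes "psform V A" "0 \<le> c"
  shows "psform V (\<lambda>u v. c * A u v)"
proof -
  interpret A: psform V A by fact
  show ?thesis
  proof unfold_locales
    fix u v assume "u \<in> V" "v \<in> V"
    then show "c * A u v = c * A v u" using A.sym[of u v] by simp
  qed (use assms in \<open>simp_all add: A.sub A.add_left A.scale_left A.nonneg distrib_left\<close>)
qed

lemma psform_zero: "subspace V \<Longrightarrow> psform V (\<lambda>u v. 0)"
  by unfold_locales auto

lemma psform_sum:
  assumes "subspace V" "\<And>j. j \<in> J \<Longrightarrow> psform V (A j)"
  shows "psform V (\<lambda>u v. \<Sum>j\<in>J. A j u v)"
  using assms(2)
proof (induction J rule: infinite_finite_induct)
  case (insert x F)
  then show ?case using psform_add[of V "A x" "\<lambda>u v. \<Sum>j\<in>F. A j u v"] by simp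
qed (auto intro: psform_zero assms)

lemma psform_comp:
  assumes "psform V B" "lin_on V T" "\<And>u. u \<in> V \<Longrightarrow> T u \<in> V"
  shows "psform V (\<lambda>u v. B (T u) (T v))"
proof -
  interpret B: psform V B by fact
  show ?thesis
  proof unfold_locales
    fix u v assume "u \<in> V" "v \<in> V"
    then show "B (T u) (T v) = B (T v) (T u)" using B.sym assms(3) by blast
  qed (use assms in \<open>simp_all add: B.sub lin_on_add lin_on_scale B.add_left B.scale_left B.nonneg\<close>)
qed

lemma pdform_add:
  assumes "pdform V A" "psform V B"
  shows "pdform V (\<lambda>u v. A u v + B u v)"
proof (intro pdform.intro psform_add assms(2))
  interpret A: pdform V A by fact
  interpret B: psform V B by fact
  show "psform V A" by (rule A.psform_axioms)
  show "pdform_axioms V (\<lambda>u v. A u v + B u v)"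
  proof
    fix u assume "u \<in> V" "A u u + B u u = 0"
    then show "u = 0" using A.nonneg[of u] B.nonneg[of u] A.definite[of u] by linarith
  qed
qed

lemma pdform_cong:
  assumes A: "pdform V A" and eq: "\<And>u v. u \<in> V \<Longrightarrow> v \<in> V \<Longrightarrow> B u v = A u v"
  shows "pdform V B"
proof -
  interpret A: pdform V A by fact
  show ?thesis
  proof unfold_locales
    fix u v assume "u \<in> V" "v \<in> V"
    then show "B u v = B v u" using A.sym[of u v] eq by simp
  qed (simp_all add: A.sub eq A.add_left A.scale_left A.nonneg A.definite)
qed

section \<open>Finite dimension, orthonormal bases and the Riesz representation\<close>

definition fin_det :: "'v::real_vector set \<Rightarrow> bool" where
  "fin_det V \<longleftrightarrow> (\<exists>\<Lambda>::('v \<Rightarrow> real) set. finite \<Lambda> \<and> (\<forall>l\<in>\<Lambda>. lin_on V l) \<and>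
     (\<forall>u\<in>V. (\<forall>l\<in>\<Lambda>. l u = 0) \<longrightarrow> u = 0))"

text \<open>Separation by finitely many functionals passes to subspaces without a choice of basis,
  which is why finite dimension is encoded in this form.\<close>

lemma fin_det_subset: "fin_det V \<Longrightarrow> W \<subseteq> V \<Longrightarrow> fin_det W"
  unfolding fin_det_def by (meson lin_on_subset subsetD)

definition onb :: "'v::real_vector set \<Rightarrow> ('v \<Rightarrow> 'v \<Rightarrow> real) \<Rightarrow> 'v set \<Rightarrow> bool" where
  "onb V B E \<longleftrightarrow> finite E \<and> E \<subseteq> V \<and> (\<forall>a\<in>E. \<forall>b\<in>E. B a b = (if a = b then 1 else 0)) \<and>
     (\<forall>u\<in>V. u = (\<Sum>b\<in>E. B u b *\<^sub>R b))"

text \<open>Gram-Schmidt, one separating functional at a time: the basis of the kernel of a functional is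
  extended by the normalised residual of any vector on which the functional does not vanish.\<close>

lemma onb_exists_aux:
  assumes "finite (\<Lambda>::('v::real_vector \<Rightarrow> real) set)"
  shows "pdform V B \<Longrightarrow> (\<forall>l\<in>\<Lambda>. lin_on V l) \<Longrightarrow> (\<forall>u\<in>V. (\<forall>l\<in>\<Lambda>. l u = 0) \<longrightarrow> u = 0) \<Longrightarrow>
    \<exists>E. onb V B E"
  using assms
proof (induction \<Lambda> arbitrary: V)
  case empty
  then interpret pdform V B by simp
  from empty have "\<forall>u\<in>V. u = 0" by auto
  then show ?case by (intro exI[of _ "{}"]) (auto simp: onb_def)
next
  case (insert l \<Lambda> V)
  interpret pdform V B by fact
  have l: "lin_on V l" using insert.prems by simp
  define W where "W = {u\<in>V. l u = 0}"
  have W: "subspace W"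
    unfolding subspace_def W_def
    using lin_on_zero[OF l sub] lin_on_add[OF l] lin_on_scale[OF l] by auto
  have WV: "W \<subseteq> V" by (auto simp: W_def)
  interpret W: pdform W B by (rule restrict_pd[OF W WV])
  have "\<exists>E. onb W B E"
  proof (rule insert.IH[OF W.pdform_axioms])
    show "\<forall>l\<in>\<Lambda>. lin_on W l" using insert.prems WV by (auto intro: lin_on_subset)
    show "\<forall>u\<in>W. (\<forall>l\<in>\<Lambda>. l u = 0) \<longrightarrow> u = 0" using insert.prems by (auto simp: W_def)
  qed
  then obtain E where E: "onb W B E" ..
  have EW: "finite E" "E \<subseteq> W" "\<And>a b. a \<in> E \<Longrightarrow> b \<in> E \<Longrightarrow> B a b = (if a = b then 1 else 0)"
    and exp: "\<And>u. u \<in> W \<Longrightarrow> u = (\<Sum>b\<in>E. B u b *\<^sub>R b)"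
    using E by (auto simp: onb_def)
  have EV: "E \<subseteq> V" using EW WV by auto
  show ?case
  proof (cases "V = W")
    case True
    then show ?thesis using E by auto
  next
    case False
    then obtain u0 where u0: "u0 \<in> V" "l u0 \<noteq> 0" by (auto simp: W_def)
    have inV: "(\<Sum>b\<in>E. c b *\<^sub>R b) \<in> V" for c
      by (intro subspace_sum[OF sub]) (use EV in auto)
    have inW: "(\<Sum>b\<in>E. c b *\<^sub>R b) \<in> W" for c
      by (intro subspace_sum[OF W]) (use EW in auto)
    define g0 where "g0 = u0 - (\<Sum>b\<in>E. B u0 b *\<^sub>R b)"
    have g0V: "g0 \<in> V" using u0 inV by (simp add: g0_def)
    have lg0: "l g0 \<noteq> 0"
      using lin_on_diff[OF l sub u0(1) inV] inW[of "B u0"] u0(2) by (simp add: g0_def W_def)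
    have g0E: "B g0 a = 0" if a: "a \<in> E" for a
    proof -
      have "B (\<Sum>b\<in>E. B u0 b *\<^sub>R b) a = (\<Sum>b\<in>E. B u0 b * B b a)"
        using EV a by (subst sum_left) (auto simp: scale_left subset_iff)
      also have "\<dots> = (\<Sum>b\<in>E. if b = a then B u0 a else 0)"
        by (intro sum.cong) (use EW a in auto)
      also have "\<dots> = B u0 a" using EW(1) a by simp
      finally show ?thesis using a EV u0 inV by (simp add: g0_def diff_left subset_iff)
    qed
    have "g0 \<noteq> 0" using lg0 lin_on_zero[OF l sub] by auto
    then have pos: "B g0 g0 > 0" using definite[OF g0V] nonneg[OF g0V] by fastforce
    define g where "g = (1 / sqrt (B g0 g0)) *\<^sub>R g0"
    have gV: "g \<in> V" using g0V by (simp add: g_def)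
    have gg: "B g g = 1"
      using pos g0V by (simp add: g_def scale_left scale_right)
    have gE: "B g a = 0" if "a \<in> E" for a
      using g0E[OF that] g0V that EV by (auto simp: g_def scale_left subset_iff)
    have gE': "B a g = 0" if "a \<in> E" for a
      using gE[OF that] sym[of a g] gV EV that by auto
    have lg: "l g \<noteq> 0" using lg0 pos lin_on_scale[OF l g0V] by (simp add: g_def)
    have gnE: "g \<notin> E" using lg EW(2) by (auto simp: W_def)
    have "u = (\<Sum>b\<in>insert g E. B u b *\<^sub>R b)" if u: "u \<in> V" for u
    proof -
      define w where "w = u - (l u / l g) *\<^sub>R g"
      have wW: "w \<in> W"
        using lin_on_diff[OF l sub u closed(3)[OF gV]] lin_on_scale[OF l gV] lg gV u
        by (simp add: w_def W_def)
      have wV: "w \<in> V" using wW WV by auto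
      have u_eq: "u = w + (l u / l g) *\<^sub>R g" by (simp add: w_def)
      have "B w g = (\<Sum>b\<in>E. B w b * B b g)"
        using wV gV EV by (subst exp[OF wW], subst sum_left) (auto simp: scale_left subset_iff)
      also have "\<dots> = 0" by (intro sum.neutral ballI) (simp add: gE')
      finally have wg: "B w g = 0" .
      have ug: "B u g = l u / l g"
        by (subst u_eq) (use wV gV wg gg in \<open>simp add: add_left scale_left\<close>)
      have "B u b = B w b" if "b \<in> E" for b
        by (subst u_eq) (use that EV wV gV gE in \<open>simp add: add_left scale_left subset_iff\<close>)
      then have "(\<Sum>b\<in>insert g E. B u b *\<^sub>R b) = (l u / l g) *\<^sub>R g + (\<Sum>b\<in>E. B w b *\<^sub>R b)"
        using EW(1) gnE ug by simp
      also have "\<dots> = u" using exp[OF wW] by (simp add: w_def)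
      finally show ?thesis by simp
    qed
    then have "onb V B (insert g E)"
      unfolding onb_def using EW gV gg gE gE' EV gnE by auto
    then show ?thesis ..
  qed
qed

lemma onb_exists: "pdform V B \<Longrightarrow> fin_det V \<Longrightarrow> \<exists>E. onb V B E"
  unfolding fin_det_def using onb_exists_aux by blast

text \<open>The representer has the values \<open>f b\<close> as coordinates in an orthonormal
  basis. This lemma supplies the inverses of the system and smoother forms, the orthogonal
  projections and the discrete Laplacian.\<close>

lemma riesz:
  assumes "pdform V B" "fin_det V" "lin_on V f"
  shows "\<exists>!w. w \<in> V \<and> (\<forall>v\<in>V. B w v = f v)"
proof -
  interpret pdform V B by fact
  obtain E where E: "onb V B E" using onb_exists assms by blast
  then have EV: "E \<subseteq> V" by (simp add: onb_def)
  define w where "w = (\<Sum>b\<in>E. f b *\<^sub>R b)"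
  have wV: "w \<in> V" unfolding w_def by (intro subspace_sum[OF sub]) (use EV in auto)
  have "B w v = f v" if v: "v \<in> V" for v
  proof -
    have "B w v = (\<Sum>b\<in>E. f b * B b v)"
      unfolding w_def using EV v by (subst sum_left) (auto simp: scale_left subset_iff)
    also have "\<dots> = (\<Sum>b\<in>E. f (B v b *\<^sub>R b))"
      using EV v by (intro sum.cong) (auto simp: lin_on_scale[OF assms(3)] sym subset_iff)
    also have "\<dots> = f (\<Sum>b\<in>E. B v b *\<^sub>R b)"
      by (rule lin_on_sum[OF assms(3) sub, symmetric]) (use EV in auto)
    also have "(\<Sum>b\<in>E. B v b *\<^sub>R b) = v" using E v unfolding onb_def by auto
    finally show ?thesis .
  qed
  with wV show ?thesis by (intro ex1I[of _ w]) (auto intro: eqI)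
qed

section \<open>Orthogonal projections\<close>

definition oproj :: "('v::real_vector \<Rightarrow> 'v \<Rightarrow> real) \<Rightarrow> 'v set \<Rightarrow> 'v \<Rightarrow> 'v" where
  "oproj B W u = (THE w. w \<in> W \<and> (\<forall>v\<in>W. B (u - w) v = 0))"

text \<open>Instantiated with \<open>l2_inner\<close> for the projections onto boundary-adapted
  splines, with a mean-corrected stiffness form for the Ritz projection, and with
  \<open>system_op\<close> for the coarse-grid correction.\<close>

locale oprojection = pdform +
  fixes W
  assumes W: "subspace W" and WV: "W \<subseteq> V" and fd: "fin_det V"
begin

lemma oproj_ex1:
  assumes u: "u \<in> V"
  shows "\<exists>!w. w \<in> W \<and> (\<forall>v\<in>W. B (u - w) v = 0)"
proof -
  have "\<exists>!w. w \<in> W \<and> (\<forall>v\<in>W. B w v = B u v)"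
    by (rule riesz[OF restrict_pd[OF W WV] fin_det_subset[OF fd WV]])
      (use lin_right[OF u] WV in \<open>auto intro: lin_on_subset\<close>)
  moreover have "(w \<in> W \<and> (\<forall>v\<in>W. B w v = B u v)) = (w \<in> W \<and> (\<forall>v\<in>W. B (u - w) v = 0))" for w
    using u WV by (auto simp: diff_left subset_iff)
  ultimately show ?thesis by simp
qed

lemma oproj_in: "u \<in> V \<Longrightarrow> oproj B W u \<in> W"
  and oproj_orth: "u \<in> V \<Longrightarrow> v \<in> W \<Longrightarrow> B (u - oproj B W u) v = 0"
  using theI'[OF oproj_ex1] unfolding oproj_def by blast+

lemma oproj_eqI: "u \<in> V \<Longrightarrow> w \<in> W \<Longrightarrow> (\<And>v. v \<in> W \<Longrightarrow> B (u - w) v = 0) \<Longrightarrow> oproj B W u = w"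
  using oproj_ex1 oproj_in oproj_orth by blast

lemma oproj_inV [simp]: "u \<in> V \<Longrightarrow> oproj B W u \<in> V"
  using oproj_in WV by auto

lemma oproj_lin: "lin_on V (oproj B W)"
proof (rule lin_onI)
  fix u v assume uv: "u \<in> V" "v \<in> V"
  show "oproj B W (u + v) = oproj B W u + oproj B W v"
  proof (rule oproj_eqI)
    show "oproj B W u + oproj B W v \<in> W" using oproj_in uv W by (auto intro: subspace_add)
    fix z assume z: "z \<in> W"
    have e: "u + v - (oproj B W u + oproj B W v) = (u - oproj B W u) + (v - oproj B W v)" by simp
    show "B (u + v - (oproj B W u + oproj B W v)) z = 0"
      unfolding e using z uv WV oproj_orth by (subst add_left) auto
  qed (use uv in simp)
next
  fix u c assume u: "u \<in> V"
  show "oproj B W (c *\<^sub>R u) = c *\<^sub>R oproj B W u"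
  proof (rule oproj_eqI)
    show "c *\<^sub>R oproj B W u \<in> W" using oproj_in u W by (auto intro: subspace_scale)
    fix z assume z: "z \<in> W"
    have e: "c *\<^sub>R u - c *\<^sub>R oproj B W u = c *\<^sub>R (u - oproj B W u)" by (simp add: scaleR_right_diff_distrib)
    show "B (c *\<^sub>R u - c *\<^sub>R oproj B W u) z = 0"
      unfolding e using z u WV oproj_orth by (subst scale_left) auto
  qed (use u in simp)
qed

lemma oproj_id: "u \<in> W \<Longrightarrow> oproj B W u = u"
  using WV by (intro oproj_eqI) auto

lemma oproj_self: "u \<in> V \<Longrightarrow> v \<in> V \<Longrightarrow> B (oproj B W u) (oproj B W v) = B (oproj B W u) v"
  using oproj_orth[of v "oproj B W u"] oproj_in[of u]
  by (simp add: diff_left sym[of "oproj B W u"])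

lemma oproj_split: "u \<in> V \<Longrightarrow> v \<in> V \<Longrightarrow>
    B (oproj B W u) (oproj B W v) + B (u - oproj B W u) (v - oproj B W v) = B u v"
  using oproj_self[of u v] oproj_self[of v u]
  by (simp add: diff_left diff_right sym[of u "oproj B W v"] sym[of "oproj B W v" "oproj B W u"])

lemma oproj_le: "u \<in> V \<Longrightarrow> B (oproj B W u) (oproj B W u) \<le> B u u"
  and oproj_compl_le: "u \<in> V \<Longrightarrow> B (u - oproj B W u) (u - oproj B W u) \<le> B u u"
  using oproj_split[of u u] nonneg[of "u - oproj B W u"] nonneg[of "oproj B W u"] by auto

lemma oproj_best:
  assumes u: "u \<in> V" and z: "z \<in> W"
  shows "B (u - oproj B W u) (u - oproj B W u) \<le> B (u - z) (u - z)"
proof -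
  have zV: "z \<in> V" using z WV by auto
  have e: "u - z - oproj B W (u - z) = u - oproj B W u"
    using lin_on_diff[OF oproj_lin sub u zV] oproj_id[OF z] by simp
  have "B (u - z - oproj B W (u - z)) (u - z - oproj B W (u - z)) \<le> B (u - z) (u - z)"
    using u zV by (intro oproj_compl_le) simp
  then show ?thesis unfolding e .
qed

end

section \<open>The abstract two-grid estimate\<close>

text \<open>\<open>X\<close> is \<open>\<tau>\<close> times the inverse of \<open>L\<close> applied
  to \<open>A\<close>, and \<open>S\<close> is the error propagation of one smoothing step;
  \<open>AL\<close> keeps the spectrum of \<open>X\<close> in [0,1]. The coarse-grid correction
  turns an error \<open>u\<close> into \<open>u - oproj A Vc u\<close>.\<close>

locale two_grid = A: oprojection V A Vc + L: pdform V L
  for V :: "'v::real_vector set" and A L Vc +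
  fixes \<tau> C :: real and X S :: "'v \<Rightarrow> 'v"
  assumes \<tau>: "0 < \<tau>"
    and AL: "u \<in> V \<Longrightarrow> \<tau> * A u u \<le> L u u"
    and approx: "u \<in> V \<Longrightarrow> L (u - oproj A Vc u) (u - oproj A Vc u) \<le> C * A u u"
    and XV: "u \<in> V \<Longrightarrow> X u \<in> V"
    and X: "u \<in> V \<Longrightarrow> v \<in> V \<Longrightarrow> L (X u) v = \<tau> * A u v"
    and S: "u \<in> V \<Longrightarrow> S u = u - X u"
begin

lemma SV [simp]: "u \<in> V \<Longrightarrow> S u \<in> V"
  by (simp add: S XV)

text \<open>Cauchy-Schwarz in the \<open>A\<close>-form followed by \<open>AL\<close> for
  \<open>X u\<close> reproduces the \<open>L\<close>-norm of \<open>X u\<close> on the right, so one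
  factor cancels.\<close>

lemma XX_le: 
  assumes u: "u \<in> V"
  shows "L (X u) (X u) \<le> \<tau> * A u u"
proof -
  let ?a = "sqrt (A u u)" and ?x = "sqrt (L (X u) (X u))"
  have "L (X u) (X u) = \<tau> * A u (X u)" using X XV u by simp
  also have "\<dots> \<le> \<tau> * (?a * sqrt (A (X u) (X u)))"
    using A.cauchy_schwarz_sqrt[OF u XV[OF u]] \<tau> by (intro mult_left_mono) auto
  also have "\<dots> = sqrt \<tau> * ?a * sqrt (\<tau> * A (X u) (X u))"
    using \<tau> by (simp add: real_sqrt_mult)
  also have "\<dots> \<le> sqrt \<tau> * ?a * ?x"
    using AL[OF XV[OF u]] \<tau> A.nonneg[OF u] by (intro mult_left_mono) auto
  finally have "?x * ?x \<le> sqrt \<tau> * ?a * ?x" using L.nonneg[OF XV[OF u]] by simp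
  moreover have "?x = 0 \<or> ?x > 0" using L.nonneg[OF XV[OF u]] by auto
  ultimately have "?x \<le> sqrt \<tau> * ?a" using \<tau> A.nonneg[OF u]
    by (elim disjE) (simp, simp only: mult_le_cancel_right_pos)
  then have "?x \<le> sqrt (\<tau> * A u u)" by (simp add: real_sqrt_mult)
  then show ?thesis by simp
qed

lemma S_A_le:
  assumes u: "u \<in> V"
  shows "A (S u) (S u) \<le> A u u"
proof -
  have "\<tau> * A (X u) (X u) \<le> \<tau> * A u (X u)" using AL[OF XV[OF u]] X[OF u XV[OF u]] by simp
  then have "A (X u) (X u) \<le> A u (X u)" using \<tau> by simp
  moreover have "0 \<le> A (X u) (X u)" using A.nonneg XV u by simp
  ultimately show ?thesis using u XV by (simp add: S A.square_diff)
qed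

text \<open>The cross term \<open>2 * L u (X u)\<close> equals \<open>2 * \<tau> * A u u\<close>, of
  which the quadratic term gives back at most half. The loss of \<open>L\<close>-energy in a step is
  thus measured by the \<open>A\<close>-energy before the step.\<close>

lemma S_L_le:
  assumes u: "u \<in> V"
  shows "L (S u) (S u) \<le> L u u - \<tau> * A u u"
  using XX_le[OF u] X[OF u u] u XV[OF u] by (simp add: S L.square_diff L.sym[of u "X u"])

lemma S_sym:
  assumes "u \<in> V" "v \<in> V"
  shows "A (S u) v = A u (S v)"
proof -
  have "\<tau> * A v (X u) = \<tau> * A u (X v)"
    using X[of v "X u"] X[of u "X v"] L.sym[of "X u" "X v"] assms XV by simp
  then have "A (X u) v = A u (X v)" using \<tau> assms XV A.sym[of "X u" v] by simp
  then show ?thesis using assms XV by (simp add: S A.diff_left A.diff_right)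
qed

lemma SpowV [simp]: "u \<in> V \<Longrightarrow> (S ^^ k) u \<in> V"
  by (induction k) auto

lemma Spow_sym: "u \<in> V \<Longrightarrow> v \<in> V \<Longrightarrow> A ((S ^^ k) u) v = A u ((S ^^ k) v)"
proof (induction k arbitrary: v)
  case (Suc k)
  then show ?case by (simp add: S_sym funpow_swap1[of S k v])
qed simp

lemma smoothing:
  assumes u: "u \<in> V"
  shows "\<tau> * real k * A ((S ^^ k) u) ((S ^^ k) u) \<le> L u u"
proof -
  let ?a = "\<lambda>k. A ((S ^^ k) u) ((S ^^ k) u)"
  \<comment> \<open>The remaining \<open>L\<close>-energy is carried along so that the losses
    telescope; since the \<open>A\<close>-energy decreases, its last value can stand for all of
    them.\<close>
  have "\<tau> * real k * ?a k + L ((S ^^ k) u) ((S ^^ k) u) \<le> L u u"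
  proof (induction k)
    case (Suc k)
    have "\<tau> * real (Suc k) * ?a (Suc k) \<le> \<tau> * real (Suc k) * ?a k"
      using S_A_le[OF SpowV[OF u], of k] \<tau> by (intro mult_left_mono) auto
    then show ?case using S_L_le[OF SpowV[OF u], of k] Suc by (simp add: algebra_simps)
  qed simp
  then show ?thesis using L.nonneg[OF SpowV[OF u], of k] by linarith
qed

context
  fixes \<nu> :: nat
  assumes \<nu>: "4 * C \<le> \<tau> * real \<nu>" "0 < \<nu>"
begin

lemma approx_smooth:
  assumes u: "u \<in> V"
  shows "4 * C * A ((S ^^ \<nu>) u) ((S ^^ \<nu>) u) \<le> L u u"
  using smoothing[OF u, of \<nu>] mult_right_mono[OF \<nu>(1) A.nonneg[OF SpowV[OF u]], of \<nu>] by linarith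

lemma rate_L:
  assumes u: "u \<in> V"
  defines "e \<equiv> (S ^^ \<nu>) u - oproj A Vc ((S ^^ \<nu>) u)"
  shows "sqrt (L e e) \<le> 1 / 2 * sqrt (L u u)"
proof -
  have "4 * L e e \<le> L u u"
    using approx[OF SpowV[OF u], of \<nu>] approx_smooth[OF u] by (simp add: e_def)
  then have "sqrt (4 * L e e) \<le> sqrt (L u u)" by simp
  then show ?thesis by (simp add: real_sqrt_mult)
qed

text \<open>The corrected error \<open>e\<close> is \<open>A\<close>-orthogonal to
  \<open>Vc\<close>, hence equal to its own projection error, so the approximation property applies
  to \<open>e\<close> itself. The smoother is \<open>A\<close>-symmetric and can be moved onto
  \<open>e\<close>, where the smoothing estimate is available.\<close>

lemma rate_A:
  assumes u: "u \<in> V"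
  defines "e \<equiv> (S ^^ \<nu>) u - oproj A Vc ((S ^^ \<nu>) u)"
  shows "sqrt (A e e) \<le> 1 / 2 * sqrt (A u u)"
proof -
  define w where "w = (S ^^ \<nu>) u"
  have wV: "w \<in> V" using u by (simp add: w_def)
  have e: "e = w - oproj A Vc w" by (simp add: e_def w_def)
  have eV: "e \<in> V" using wV by (simp add: e)
  have "oproj A Vc e = oproj A Vc w - oproj A Vc (oproj A Vc w)"
    unfolding e by (rule lin_on_diff[OF A.oproj_lin A.sub wV]) (use wV in simp)
  then have "oproj A Vc e = 0" using A.oproj_id A.oproj_in wV by simp
  then have Le: "L e e \<le> C * A e e" using approx[OF eV] by simp
  have "A (oproj A Vc w) e = 0"
    using A.oproj_orth[OF wV A.oproj_in[OF wV]] A.sym wV eV by (simp add: e)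
  then have "A e e = A w e"
    using eV wV by (subst (1) e) (simp add: A.diff_left)
  also have "\<dots> = A u ((S ^^ \<nu>) e)" using u eV by (simp add: w_def Spow_sym)
  finally have Aee: "A e e = A u ((S ^^ \<nu>) e)" .
  let ?s = "A ((S ^^ \<nu>) e) ((S ^^ \<nu>) e)"
  have "\<tau> * real \<nu> * ?s \<le> L e e" by (rule smoothing[OF eV])
  also have "4 * (C * A e e) \<le> \<tau> * real \<nu> * A e e"
    using mult_right_mono[OF \<nu>(1) A.nonneg[OF eV]] by simp
  then have "L e e \<le> \<tau> * real \<nu> * (A e e / 4)" using Le by (simp add: algebra_simps)
  finally have "\<tau> * real \<nu> * ?s \<le> \<tau> * real \<nu> * (A e e / 4)" .
  then have s: "4 * ?s \<le> A e e" using \<tau> \<nu>(2) by (simp add: zero_less_mult_iff)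
  have s': "2 * sqrt ?s \<le> sqrt (A e e)" using real_sqrt_le_mono[OF s] by (simp add: real_sqrt_mult)
  have "A e e \<le> sqrt (A u u) * sqrt ?s"
    using A.cauchy_schwarz_sqrt[OF u SpowV[OF eV], of \<nu>] Aee by simp
  also have "\<dots> \<le> sqrt (A u u) * (sqrt (A e e) / 2)"
    using s' A.nonneg[OF u] by (intro mult_left_mono) auto
  finally have "sqrt (A e e) * sqrt (A e e) \<le> (1 / 2 * sqrt (A u u)) * sqrt (A e e)"
    using A.nonneg[OF eV] by simp
  moreover have "sqrt (A e e) = 0 \<or> sqrt (A e e) > 0" using A.nonneg[OF eV] by auto
  ultimately show ?thesis using A.nonneg[OF u]
    by (elim disjE) (simp, simp only: mult_le_cancel_right_pos)
qed

end

end

section \<open>Kronecker products of positive semidefinite matrices\<close>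

definition psd_on :: "'a set \<Rightarrow> ('a \<Rightarrow> 'a \<Rightarrow> real) \<Rightarrow> bool" where
  "psd_on E X \<longleftrightarrow> (\<forall>a\<in>E. \<forall>b\<in>E. X a b = X b a) \<and>
     (\<forall>c. 0 \<le> (\<Sum>a\<in>E. \<Sum>b\<in>E. c a * c b * X a b))"

text \<open>A Cholesky factorisation, one pivot at a time.\<close>

lemma psd_on_sum_of_squares:
  assumes "finite E" "psd_on E X"
  shows "\<exists>(N::nat) f. \<forall>a\<in>E. \<forall>b\<in>E. X a b = (\<Sum>k<N. f k a * f k b)"
  using assms
proof (induction E arbitrary: X)
  case (insert x E)
  have symX: "X a b = X b a" if "a \<in> insert x E" "b \<in> insert x E" for a b
    using insert.prems that unfolding psd_on_def by blast
  have q: "0 \<le> t * t * X x x + 2 * t * (\<Sum>a\<in>E. c a * X a x) + (\<Sum>a\<in>E. \<Sum>b\<in>E. c a * c b * X a b)"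
    for t c
  proof -
    define c' where "c' = c(x := t)"
    have c': "c' a = c a" if "a \<in> E" for a using that insert.hyps by (auto simp: c'_def)
    have "0 \<le> (\<Sum>a\<in>insert x E. \<Sum>b\<in>insert x E. c' a * c' b * X a b)"
      using insert.prems unfolding psd_on_def by blast
    also have "\<dots> = t * t * X x x + (\<Sum>b\<in>E. t * c b * X x b) +
        ((\<Sum>a\<in>E. c a * t * X a x) + (\<Sum>a\<in>E. \<Sum>b\<in>E. c a * c b * X a b))"
      using insert.hyps by (simp add: sum.distrib c' c'_def[THEN fun_cong, of x])
    also have "(\<Sum>b\<in>E. t * c b * X x b) = t * (\<Sum>a\<in>E. c a * X a x)"
      by (simp add: sum_distrib_left symX[of x] mult.assoc)
    also have "(\<Sum>a\<in>E. c a * t * X a x) = t * (\<Sum>a\<in>E. c a * X a x)"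
      by (simp add: sum_distrib_left mult.left_commute mult.assoc)
    finally show ?thesis by simp
  qed
  \<comment> \<open>The Schur complement of the pivot \<open>X x x\<close>. A zero pivot has a zero
    column, so nothing is subtracted then.\<close>
  define Y where "Y = (\<lambda>a b. if X x x = 0 then X a b else X a b - X a x * X b x / X x x)"
  have Xxx: "0 \<le> X x x" using q[of 1 "\<lambda>_. 0"] by simp
  have zero: "X a x = 0" if "X x x = 0" "a \<in> E" for a
  proof (rule ccontr)
    assume n: "X a x \<noteq> 0"
    define c where "c = (\<lambda>b. if b = a then 1 else (0::real))"
    have s: "(\<Sum>b\<in>E. c b * X b x) = X a x"
      using insert.hyps that by (simp add: c_def if_distrib[where f="\<lambda>z. z * _"] cong: if_cong)
    have "0 \<le> 2 * t * X a x + (\<Sum>a\<in>E. \<Sum>b\<in>E. c a * c b * X a b)" for t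
      using q[of t c] that s by simp
    \<comment> \<open>The expression is affine in \<open>t\<close> with nonzero slope; this
      \<open>t\<close> makes it -1.\<close>
    from this[of "- ((\<Sum>a\<in>E. \<Sum>b\<in>E. c a * c b * X a b) + 1) / (2 * X a x)"] n show False
      by (simp add: field_simps)
  qed
  have "psd_on E Y"
    unfolding psd_on_def
  proof (intro conjI ballI allI)
    fix a b assume "a \<in> E" "b \<in> E"
    then show "Y a b = Y b a" using symX by (simp add: Y_def)
  next
    fix c
    show "0 \<le> (\<Sum>a\<in>E. \<Sum>b\<in>E. c a * c b * Y a b)"
    proof (cases "X x x = 0")
      case True
      then show ?thesis using q[of 0 c] by (simp add: Y_def)
    next
      case False
      define s where "s = (\<Sum>a\<in>E. c a * X a x)"
      have ss: "(\<Sum>a\<in>E. \<Sum>b\<in>E. c a * c b * (X a x * X b x / X x x)) = s * s / X x x"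
        by (simp add: s_def sum_product sum_divide_distrib mult_ac)
      \<comment> \<open>This value of \<open>t\<close> minimises the quadratic polynomial.\<close>
      have "0 \<le> (- s / X x x) * (- s / X x x) * X x x + 2 * (- s / X x x) * s +
          (\<Sum>a\<in>E. \<Sum>b\<in>E. c a * c b * X a b)"
        using q[of "- s / X x x" c] by (simp add: s_def)
      also have "\<dots> = (\<Sum>a\<in>E. \<Sum>b\<in>E. c a * c b * X a b) - s * s / X x x"
        using False by (simp add: field_simps)
      also have "\<dots> = (\<Sum>a\<in>E. \<Sum>b\<in>E. c a * c b * Y a b)"
        using False unfolding ss[symmetric] by (simp add: Y_def sum_subtractf right_diff_distrib)
      finally show ?thesis .
    qed
  qed
  then obtain N :: nat and f where f: "\<forall>a\<in>E. \<forall>b\<in>E. Y a b = (\<Sum>k<N. f k a * f k b)"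
    using insert.IH by blast
  define r where "r = (\<lambda>a. X a x / sqrt (X x x))"
  \<comment> \<open>Index \<open>N\<close> holds the normalised pivot column; the earlier factors
    are extended by zero at \<open>x\<close>.\<close>
  define g where "g = (\<lambda>k a. if k = N then r a else if a = x then 0 else f k a)"
  have rr: "r a * r b = X a x * X b x / X x x" for a b
    using Xxx by (simp add: r_def)
  have "X a b = (\<Sum>k<Suc N. g k a * g k b)" if a: "a \<in> insert x E" and b: "b \<in> insert x E" for a b
  proof -
    have "(\<Sum>k<Suc N. g k a * g k b) =
        (if a = x \<or> b = x then 0 else \<Sum>k<N. f k a * f k b) + X a x * X b x / X x x"
      by (auto simp: g_def rr intro!: sum.cong)
    also have "\<dots> = X a b"
    proof (cases "a = x \<or> b = x")
      case True
      then show ?thesis using a b zero symX[OF a b] by (cases "X x x = 0") auto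
    next
      case False
      then have "Y a b = (\<Sum>k<N. f k a * f k b)" using a b f by auto
      then show ?thesis using False a b zero by (cases "X x x = 0") (auto simp: Y_def)
    qed
    finally show ?thesis by simp
  qed
  then show ?case by blast
qed simp

definition kron :: "'a set \<Rightarrow> ('n::finite \<Rightarrow> 'a \<Rightarrow> 'a \<Rightarrow> real) \<Rightarrow> (('n \<Rightarrow> 'a) \<Rightarrow> real) \<Rightarrow>
    (('n \<Rightarrow> 'a) \<Rightarrow> real) \<Rightarrow> real" where
  "kron E X c d = (\<Sum>I\<in>UNIV \<rightarrow> E. \<Sum>J\<in>UNIV \<rightarrow> E. c I * d J * (\<Prod>i\<in>UNIV. X i (I i) (J i)))"

lemma PiE_UNIV: "PiE UNIV F = Pi UNIV F"
  by (auto simp: PiE_def)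

lemma finite_index: "finite E \<Longrightarrow> finite (UNIV \<rightarrow> E :: ('n::finite \<Rightarrow> 'a) set)"
  using finite_PiE[of "UNIV :: 'n set" "\<lambda>_. E"] by (simp add: PiE_UNIV)

lemma prod_sum_index:
  fixes f :: "'n::finite \<Rightarrow> 'a \<Rightarrow> 'b::comm_semiring_1"
  shows "finite E \<Longrightarrow> (\<Prod>i\<in>UNIV. \<Sum>b\<in>E. f i b) = (\<Sum>I\<in>UNIV \<rightarrow> E. \<Prod>i\<in>UNIV. f i (I i))"
  using prod_sum_PiE[of "UNIV :: 'n set" "\<lambda>_. E" f] by (simp add: PiE_UNIV)

text \<open>With each factor written as a sum of squares, the product over the coordinates expands
  into squares indexed by a choice \<open>k\<close> of one summand per coordinate.\<close>

lemma kron_nonneg: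
  fixes X :: "'n::finite \<Rightarrow> 'a \<Rightarrow> 'a \<Rightarrow> real"
  assumes E: "finite E" and X: "\<And>i. psd_on E (X i)"
  shows "0 \<le> kron E X c c"
proof -
  have "\<forall>i. \<exists>N f. \<forall>a\<in>E. \<forall>b\<in>E. X i a b = (\<Sum>k<(N::nat). f k a * f k b)"
    using psd_on_sum_of_squares[OF E X] by blast
  then obtain N f where f: "\<And>i a b. a \<in> E \<Longrightarrow> b \<in> E \<Longrightarrow> X i a b = (\<Sum>k<(N i::nat). f i k a * f i k b)"
    by metis
  let ?P = "PiE UNIV (\<lambda>i. {..<N i})"
  have "kron E X c c = (\<Sum>I\<in>UNIV \<rightarrow> E. \<Sum>J\<in>UNIV \<rightarrow> E. c I * c J *
      (\<Sum>k\<in>?P. \<Prod>i\<in>UNIV. f i (k i) (I i) * f i (k i) (J i)))"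
    unfolding kron_def
    by (intro sum.cong refl arg_cong2[where f="(*)"], subst prod_sum_PiE[symmetric])
      (auto simp: f Pi_iff intro!: prod.cong)
  also have "\<dots> = (\<Sum>I\<in>UNIV \<rightarrow> E. \<Sum>J\<in>UNIV \<rightarrow> E. \<Sum>k\<in>?P.
      (c I * (\<Prod>i\<in>UNIV. f i (k i) (I i))) * (c J * (\<Prod>i\<in>UNIV. f i (k i) (J i))))"
    by (simp add: sum_distrib_left prod.distrib mult_ac)
  also have "\<dots> = (\<Sum>I\<in>UNIV \<rightarrow> E. \<Sum>k\<in>?P. \<Sum>J\<in>UNIV \<rightarrow> E.
      (c I * (\<Prod>i\<in>UNIV. f i (k i) (I i))) * (c J * (\<Prod>i\<in>UNIV. f i (k i) (J i))))"
    by (intro sum.cong refl sum.swap)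
  also have "\<dots> = (\<Sum>k\<in>?P. \<Sum>I\<in>UNIV \<rightarrow> E. \<Sum>J\<in>UNIV \<rightarrow> E.
      (c I * (\<Prod>i\<in>UNIV. f i (k i) (I i))) * (c J * (\<Prod>i\<in>UNIV. f i (k i) (J i))))"
    by (rule sum.swap)
  also have "\<dots> = (\<Sum>k\<in>?P. (\<Sum>I\<in>UNIV \<rightarrow> E. c I * (\<Prod>i\<in>UNIV. f i (k i) (I i)))\<^sup>2)"
    by (simp add: power2_eq_square sum_product)
  finally show ?thesis by (simp add: sum_nonneg)
qed

lemma kron_cong:
  assumes "\<And>i a b. a \<in> E \<Longrightarrow> b \<in> E \<Longrightarrow> X i a b = Y i a b"
  shows "kron E X = kron E Y"
  unfolding kron_def by (intro ext sum.cong refl arg_cong2[where f="(*)"] prod.cong)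
    (auto simp: Pi_iff intro: assms)

lemma kron_slot_add:
  "kron E (X(j := \<lambda>a b. Y a b + Z a b)) c d = kron E (X(j := Y)) c d + kron E (X(j := Z)) c d"
proof -
  have "(\<Prod>i\<in>UNIV. (X(j := W)) i (I i) (J i)) = W (I j) (J j) * (\<Prod>i\<in>UNIV-{j}. X i (I i) (J i))" for W I J
    by (subst prod.remove[of _ j]) auto
  then show ?thesis by (simp add: kron_def sum.distrib[symmetric] algebra_simps)
qed

lemma kron_slot_scale:
  "kron E (X(j := \<lambda>a b. r * Y a b)) c d = r * kron E (X(j := Y)) c d"
proof -
  have "(\<Prod>i\<in>UNIV. (X(j := W)) i (I i) (J i)) = W (I j) (J j) * (\<Prod>i\<in>UNIV-{j}. X i (I i) (J i))" for W I J
    by (subst prod.remove[of _ j]) auto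
  then show ?thesis by (simp add: kron_def sum_distrib_left mult_ac)
qed

text \<open>Distributivity over two summands in every slot. It collapses the sum of the local
  smoothers over all \<open>\<alpha>\<close>.\<close>

lemma kron_bool_sum:
  fixes X :: "'n::finite \<Rightarrow> bool \<Rightarrow> 'a \<Rightarrow> 'a \<Rightarrow> real"
  shows "(\<Sum>\<alpha>\<in>UNIV. kron E (\<lambda>i. X i (\<alpha> i)) c d) = kron E (\<lambda>i a b. X i False a b + X i True a b) c d"
proof -
  have e: "(\<Prod>i\<in>UNIV. X i False (I i) (J i) + X i True (I i) (J i)) = (\<Sum>\<alpha>\<in>UNIV. \<Prod>i\<in>UNIV. X i (\<alpha> i) (I i) (J i))"
    for I J :: "'n \<Rightarrow> 'a"
  proof -
    have "(\<Sum>b\<in>UNIV. X i b (I i) (J i)) = X i False (I i) (J i) + X i True (I i) (J i)" for i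
      by (simp add: UNIV_bool)
    moreover have "(UNIV \<rightarrow> UNIV) = (UNIV :: ('n \<Rightarrow> bool) set)" by auto
    ultimately show ?thesis
      using prod_sum_index[of "UNIV :: bool set" "\<lambda>i b. X i b (I i) (J i)"] by simp
  qed
  have "(\<Sum>\<alpha>\<in>UNIV. kron E (\<lambda>i. X i (\<alpha> i)) c d) =
      (\<Sum>I\<in>UNIV \<rightarrow> E. \<Sum>\<alpha>\<in>UNIV. \<Sum>J\<in>UNIV \<rightarrow> E. c I * d J * (\<Prod>i\<in>UNIV. X i (\<alpha> i) (I i) (J i)))"
    unfolding kron_def by (rule sum.swap)
  also have "\<dots> = (\<Sum>I\<in>UNIV \<rightarrow> E. \<Sum>J\<in>UNIV \<rightarrow> E. \<Sum>\<alpha>\<in>UNIV. c I * d J * (\<Prod>i\<in>UNIV. X i (\<alpha> i) (I i) (J i)))"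
    by (intro sum.cong refl sum.swap)
  finally show ?thesis by (simp add: kron_def e sum_distrib_left)
qed

definition psd_le :: "'a set \<Rightarrow> ('a \<Rightarrow> 'a \<Rightarrow> real) \<Rightarrow> ('a \<Rightarrow> 'a \<Rightarrow> real) \<Rightarrow> bool" where
  "psd_le E X Y \<longleftrightarrow> psd_on E X \<and> psd_on E Y \<and> psd_on E (\<lambda>a b. Y a b - X a b)"

lemma kron_mono_slot:
  assumes E: "finite E" and X: "\<And>i. i \<noteq> j \<Longrightarrow> psd_on E (X i)" and le: "psd_le E Y Z"
  shows "kron E (X(j := Y)) c c \<le> kron E (X(j := Z)) c c"
proof -
  have "0 \<le> kron E (X(j := \<lambda>a b. Z a b - Y a b)) c c"
    by (rule kron_nonneg[OF E]) (use X le in \<open>auto simp: psd_le_def\<close>)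
  moreover have "kron E (X(j := \<lambda>a b. Y a b + (Z a b - Y a b))) c c =
      kron E (X(j := Y)) c c + kron E (X(j := \<lambda>a b. Z a b - Y a b)) c c"
    by (rule kron_slot_add)
  ultimately show ?thesis by simp
qed

lemma kron_mono:
  fixes X Y :: "'n::finite \<Rightarrow> 'a \<Rightarrow> 'a \<Rightarrow> real"
  assumes E: "finite E" and le: "\<And>i. psd_le E (X i) (Y i)"
  shows "kron E X c c \<le> kron E Y c c"
proof -
  \<comment> \<open>The factors are exchanged one at a time; \<open>F\<close> holds the slots
    already replaced.\<close>
  have "kron E X c c \<le> kron E (\<lambda>i. if i \<in> F then Y i else X i) c c" if "finite F" for F
    using that
  proof (induction F)
    case (insert j F)
    let ?Z = "\<lambda>i. if i \<in> F then Y i else X i"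
    have "kron E ?Z c c = kron E (?Z(j := X j)) c c"
      using insert.hyps by (intro arg_cong[where f="\<lambda>Z. kron E Z c c"]) auto
    also have "\<dots> \<le> kron E (?Z(j := Y j)) c c"
      using le by (intro kron_mono_slot[OF E]) (auto simp: psd_le_def)
    also have "?Z(j := Y j) = (\<lambda>i. if i \<in> insert j F then Y i else X i)" by auto
    finally show ?case using insert.IH by simp
  qed simp
  from this[of UNIV] show ?thesis by simp
qed

section \<open>Piecewise continuous functions on the unit interval\<close>

lemma scaleR_fun_app [simp]: "(c *\<^sub>R f) x = c *\<^sub>R f x"
  by (simp add: scaleR_fun_def)

text \<open>Wide enough for a spline of degree one and its derivative, whatever value
  \<open>deriv\<close> takes at a grid point, and narrow enough to be closed under products and to
  ensure integrability.\<close>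

definition pwc :: "(real \<Rightarrow> real) \<Rightarrow> bool" where
  "pwc f \<longleftrightarrow> (\<exists>E. finite E \<and> continuous_on ({0<..<1} - E) f) \<and> bounded (f ` {0<..<1})"

lemma pwc_continuous: "continuous_on {0..1} f \<Longrightarrow> pwc f"
  unfolding pwc_def
proof (intro conjI exI[of _ "{}"])
  assume f: "continuous_on {0..1} f"
  then have "bounded (f ` {0..1})" by (intro compact_imp_bounded compact_continuous_image) auto
  then show "bounded (f ` {0<..<1})" by (rule bounded_subset) auto
  show "continuous_on ({0<..<1} - {}) f" using f by (rule continuous_on_subset) auto
qed simp

lemma pwc_comb:
  assumes "pwc f" "pwc g" and h: "continuous_on UNIV (\<lambda>z. h (fst z) (snd z) :: real)"
  shows "pwc (\<lambda>x. h (f x) (g x))"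
proof -
  from assms obtain E F where E: "finite E" "continuous_on ({0<..<1} - E) f"
    and F: "finite F" "continuous_on ({0<..<1} - F) g" by (auto simp: pwc_def)
  have "continuous_on ({0<..<1} - (E \<union> F)) (\<lambda>x. (f x, g x))"
    using E F by (intro continuous_on_Pair) (auto intro: continuous_on_subset)
  from continuous_on_compose2[OF h this]
  have c: "continuous_on ({0<..<1} - (E \<union> F)) (\<lambda>x. h (f x) (g x))" by simp
  have "bounded (f ` {0<..<1} \<times> g ` {0<..<1})"
    using assms by (intro bounded_Times) (auto simp: pwc_def)
  \<comment> \<open>The closure of the bounded set of value pairs is compact, so \<open>h\<close> is
    bounded on it.\<close>
  then have "compact (closure (f ` {0<..<1} \<times> g ` {0<..<1}))" by (simp add: compact_closure)
  then have "bounded ((\<lambda>z. h (fst z) (snd z)) ` closure (f ` {0<..<1} \<times> g ` {0<..<1}))"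
    by (intro compact_imp_bounded compact_continuous_image continuous_on_subset[OF h]) auto
  then have "bounded ((\<lambda>x. h (f x) (g x)) ` {0<..<1})"
  proof (rule bounded_subset, intro image_subsetI)
    fix x :: real assume "x \<in> {0<..<1}"
    then have "(f x, g x) \<in> closure (f ` {0<..<1} \<times> g ` {0<..<1})"
      by (intro subsetD[OF closure_subset]) auto
    then show "h (f x) (g x) \<in> (\<lambda>z. h (fst z) (snd z)) ` closure (f ` {0<..<1} \<times> g ` {0<..<1})"
      by (rule rev_image_eqI) simp
  qed
  with c E F show ?thesis unfolding pwc_def by (intro conjI exI[of _ "E \<union> F"]) auto
qed

lemma pwc_add: "pwc f \<Longrightarrow> pwc g \<Longrightarrow> pwc (\<lambda>x. f x + g x)"
  by (rule pwc_comb[of f g "\<lambda>a b. a + b"]) (assumption, assumption, intro continuous_intros)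

lemma pwc_mult: "pwc f \<Longrightarrow> pwc g \<Longrightarrow> pwc (\<lambda>x. f x * g x)"
  by (rule pwc_comb[of f g "\<lambda>a b. a * b"]) (assumption, assumption, intro continuous_intros)

lemma pwc_const [simp]: "pwc (\<lambda>x. c)"
  by (rule pwc_continuous) simp

lemma pwc_scale: "pwc f \<Longrightarrow> pwc (\<lambda>x. c * f x)"
  by (intro pwc_mult) auto

lemma pwc_integrable:
  assumes f: "pwc f"
  shows "set_integrable lborel {0<..<1} f"
proof -
  from f obtain E where E: "finite E" "continuous_on ({0<..<1} - E) f" by (auto simp: pwc_def)
  obtain B where B: "\<And>x. x \<in> {0<..<1} \<Longrightarrow> \<bar>f x\<bar> \<le> B"
    using f unfolding pwc_def bounded_iff real_norm_def by (meson imageI)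
  define F where "F = E \<union> {0, 1::real}"
  let ?h = "\<lambda>x. if x \<in> {0<..<1} then f x else 0"
  have "continuous_on (({0<..<1} - E) \<union> ({..<0} \<union> {1<..})) ?h"
  proof (rule continuous_on_open_Un)
    show "continuous_on ({0<..<1} - E) ?h" using E(2) by (rule continuous_on_eq) auto
    show "continuous_on ({..<0} \<union> {1<..}) ?h"
      by (rule continuous_on_eq[of _ "\<lambda>_. 0"]) auto
    show "open ({0<..<1} - E)" using E by (intro open_Diff finite_imp_closed) auto
  qed auto
  then have "continuous_on (- F) ?h" by (rule continuous_on_subset) (auto simp: F_def)
  moreover have "countable F" using E by (simp add: F_def countable_finite)
  ultimately have "?h \<in> borel_measurable lborel"
    by (simp add: borel_measurable_continuous_countable_exceptions)
  then have "integrable lborel ?h"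
    by (intro integrableI_bounded_set[of "{0<..<1}" _ _ B]) (use B in auto)
  moreover have "?h = (\<lambda>x. indicator {0<..<1} x *\<^sub>R f x)" by auto
  ultimately show ?thesis by (simp add: set_integrable_def)
qed

lemma pwc_integrable_on:
  assumes "pwc f"
  shows "f integrable_on {0..1}" "(LINT x:{0<..<1}|lborel. f x) = integral {0..1} f"
  using set_borel_integral_eq_integral[OF pwc_integrable[OF assms]]
    integrable_on_open_interval[of f 0 1] integral_open_interval_real[of 0 1 f] by auto

lemma l2_eq: "pwc u \<Longrightarrow> pwc v \<Longrightarrow> l2_inner u v = integral {0..1} (\<lambda>x. u x * v x)"
  unfolding l2_inner_def by (intro pwc_integrable_on pwc_mult)

lemma l2_cong:
  assumes "\<And>x. x \<in> {0<..<1} \<Longrightarrow> u x = u' x" "\<And>x. x \<in> {0<..<1} \<Longrightarrow> v x = v' x"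
  shows "l2_inner u v = l2_inner u' v'"
  unfolding l2_inner_def using assms by (intro set_lebesgue_integral_cong) auto

lemma pwc_subspace: "subspace {f. pwc f}"
  unfolding subspace_def
  by (auto simp: plus_fun_def scaleR_fun_def zero_fun_def intro: pwc_add pwc_scale)

lemma l2_psform: "psform {f. pwc f} l2_inner"
proof unfold_locales
  fix u v w :: "real \<Rightarrow> real" and c
  show "subspace {f. pwc f}" by (rule pwc_subspace)
  show "l2_inner u v = l2_inner v u" by (simp add: l2_inner_def mult.commute)
  { assume "u \<in> {f. pwc f}" "v \<in> {f. pwc f}" "w \<in> {f. pwc f}"
    then show "l2_inner (u + v) w = l2_inner u w + l2_inner v w"
      unfolding l2_inner_def plus_fun_def
      by (subst set_integral_add(2)[symmetric]) (auto intro!: pwc_integrable pwc_mult simp: algebra_simps) }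
  show "l2_inner (c *\<^sub>R u) w = c * l2_inner u w"
    unfolding l2_inner_def by (simp add: mult.assoc)
  show "0 \<le> l2_inner u u"
    unfolding l2_inner_def set_lebesgue_integral_def by (rule integral_nonneg_AE) auto
qed

interpretation l2: psform "{f. pwc f}" l2_inner
  by (rule l2_psform)

section \<open>Weak derivatives and integration by parts\<close>

definition prim :: "(real \<Rightarrow> real) \<Rightarrow> real \<Rightarrow> real" where
  "prim v x = integral {0..x} v"

text \<open>Continuity is demanded on the closed interval so that \<open>u 0\<close> and
  \<open>u 1\<close> are the boundary values in integration by parts. The finite exceptional set
  accommodates the kinks of degree-one splines.\<close>

definition weak_deriv :: "(real \<Rightarrow> real) \<Rightarrow> (real \<Rightarrow> real) \<Rightarrow> bool" where
  "weak_deriv u g \<longleftrightarrow> continuous_on {0..1} u \<and> pwc g \<and>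
     (\<exists>E. finite E \<and> (\<forall>x\<in>{0<..<1} - E. (u has_real_derivative g x) (at x)))"

lemma weak_deriv_pwc: "weak_deriv u g \<Longrightarrow> pwc u" "weak_deriv u g \<Longrightarrow> pwc g"
  by (auto simp: weak_deriv_def pwc_continuous)

lemma weak_deriv_ftc:
  assumes "weak_deriv u g" "0 \<le> a" "a \<le> b" "b \<le> 1"
  shows "(g has_integral (u b - u a)) {a..b}"
proof -
  obtain E where E: "finite E" "\<And>x. x \<in> {0<..<1} - E \<Longrightarrow> (u has_real_derivative g x) (at x)"
    using assms by (auto simp: weak_deriv_def)
  show ?thesis
  proof (rule fundamental_theorem_of_calculus_interior_strong[OF E(1) \<open>a \<le> b\<close>])
    show "continuous_on {a..b} u"
      using assms unfolding weak_deriv_def by (auto intro: continuous_on_subset)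
    fix x assume "x \<in> {a<..<b} - E"
    then show "(u has_vector_derivative g x) (at x)"
      using assms E(2)[of x] by (simp add: has_real_derivative_iff_has_vector_derivative)
  qed
qed

lemma weak_deriv_prim:
  assumes v: "pwc v"
  shows "weak_deriv (prim v) v"
proof -
  from v obtain E where E: "finite E" "continuous_on ({0<..<1} - E) v" by (auto simp: pwc_def)
  have o: "open ({0<..<1} - E)" using E by (intro open_Diff finite_imp_closed) auto
  have "(prim v has_real_derivative v x) (at x)" if x: "x \<in> {0<..<1} - E" for x
  proof -
    have "continuous (at x) v" using E(2) o x by (simp add: continuous_on_eq_continuous_at)
    then have "continuous (at x within {0..1} - {}) v" by (rule continuous_at_imp_continuous_within)
    then have "((\<lambda>u. integral {0..u} v) has_vector_derivative v x) (at x within ({0..1} - {}))"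
      using x by (intro integral_has_vector_derivative_continuous_at pwc_integrable_on v) auto
    moreover have "at x within {0..1} = at x" using x by (intro at_within_interior) auto
    ultimately show ?thesis
      by (simp add: prim_def[abs_def] has_real_derivative_iff_has_vector_derivative)
  qed
  then show ?thesis
    using indefinite_integral_continuous_1[OF pwc_integrable_on(1)[OF v]] v E(1)
    unfolding weak_deriv_def prim_def[abs_def] by auto
qed

lemma prim_0 [simp]: "prim v 0 = 0"
  by (simp add: prim_def)

lemma weak_deriv_eq: "weak_deriv u g \<Longrightarrow> x \<in> {0..1} \<Longrightarrow> u x = u 0 + prim g x"
  using weak_deriv_ftc[of u g 0 x] by (simp add: prim_def integral_unique)

lemma weak_deriv_const: "weak_deriv (\<lambda>x. c) (\<lambda>x. 0)"
  unfolding weak_deriv_def by auto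

lemma weak_deriv_add:
  assumes "weak_deriv u g" "weak_deriv v k"
  shows "weak_deriv (\<lambda>x. u x + v x) (\<lambda>x. g x + k x)"
proof -
  obtain E F where "finite E" "\<And>x. x \<in> {0<..<1} - E \<Longrightarrow> (u has_real_derivative g x) (at x)"
    "finite F" "\<And>x. x \<in> {0<..<1} - F \<Longrightarrow> (v has_real_derivative k x) (at x)"
    using assms by (auto simp: weak_deriv_def)
  then have "finite (E \<union> F) \<and> (\<forall>x\<in>{0<..<1} - (E \<union> F).
      ((\<lambda>x. u x + v x) has_real_derivative g x + k x) (at x))"
    by (auto intro!: derivative_intros)
  then show ?thesis using assms unfolding weak_deriv_def
    by (intro conjI continuous_on_add pwc_add exI[of _ "E \<union> F"]) auto
qed

lemma weak_deriv_mult: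
  assumes "weak_deriv u g" "weak_deriv v k"
  shows "weak_deriv (\<lambda>x. u x * v x) (\<lambda>x. g x * v x + u x * k x)"
proof -
  obtain E F where "finite E" "\<And>x. x \<in> {0<..<1} - E \<Longrightarrow> (u has_real_derivative g x) (at x)"
    "finite F" "\<And>x. x \<in> {0<..<1} - F \<Longrightarrow> (v has_real_derivative k x) (at x)"
    using assms by (auto simp: weak_deriv_def)
  then have "finite (E \<union> F) \<and> (\<forall>x\<in>{0<..<1} - (E \<union> F).
      ((\<lambda>x. u x * v x) has_real_derivative g x * v x + u x * k x) (at x))"
    by (intro conjI ballI finite_UnI, simp, simp, subst mult.commute[of "u _" "k _"], intro DERIV_mult) auto
  moreover have "pwc (\<lambda>x. g x * v x + u x * k x)"
    using assms by (intro pwc_add pwc_mult weak_deriv_pwc) (auto dest: weak_deriv_pwc)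
  ultimately show ?thesis using assms unfolding weak_deriv_def
    by (intro conjI continuous_on_mult exI[of _ "E \<union> F"]) auto
qed

lemma weak_deriv_scale: "weak_deriv u g \<Longrightarrow> weak_deriv (\<lambda>x. c * u x) (\<lambda>x. c * g x)"
  using weak_deriv_mult[OF weak_deriv_const[of c], of u g] by simp

lemma weak_deriv_diff:
  "weak_deriv u g \<Longrightarrow> weak_deriv v k \<Longrightarrow> weak_deriv (\<lambda>x. u x - v x) (\<lambda>x. g x - k x)"
  using weak_deriv_add[of u g "\<lambda>x. - 1 * v x" "\<lambda>x. -1 * k x"] weak_deriv_scale[of v k "-1"] by simp

lemma integration_by_parts:
  assumes "weak_deriv u g" "weak_deriv v k"
  shows "l2_inner g v + l2_inner u k = u 1 * v 1 - u 0 * v 0"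
proof -
  note p = weak_deriv_pwc[OF assms(1)] weak_deriv_pwc[OF assms(2)]
  have "((\<lambda>x. g x * v x + u x * k x) has_integral (u 1 * v 1 - u 0 * v 0)) {0..1}"
    using weak_deriv_ftc[OF weak_deriv_mult[OF assms], of 0 1] by simp
  then have "integral {0..1} (\<lambda>x. g x * v x) + integral {0..1} (\<lambda>x. u x * k x) = u 1 * v 1 - u 0 * v 0"
    by (subst integral_add[symmetric]) (auto intro!: pwc_integrable_on pwc_mult p integral_unique)
  then show ?thesis using p by (simp add: l2_eq)
qed

lemma l2_one: "pwc u \<Longrightarrow> l2_inner u (\<lambda>_. 1) = integral {0..1} u"
  by (simp add: l2_eq)

section \<open>Elementwise estimates\<close>

lemma interval_cauchy_schwarz:
  fixes g :: "real \<Rightarrow> real"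
  assumes "s \<le> t" "g integrable_on {s..t}" "(\<lambda>x. g x * g x) integrable_on {s..t}"
  shows "(integral {s..t} g)\<^sup>2 \<le> (t - s) * integral {s..t} (\<lambda>x. g x * g x)"
proof (cases "s = t")
  case False
  then have st: "t - s > 0" using assms by simp
  define c where "c = integral {s..t} g / (t - s)"
  have "((\<lambda>x. g x * g x - 2 * c * g x + c\<^sup>2) has_integral
      (integral {s..t} (\<lambda>x. g x * g x) - 2 * c * integral {s..t} g + c\<^sup>2 * (t - s))) {s..t}"
    using has_integral_const_real[of "c\<^sup>2" s t] assms
    by (intro has_integral_add has_integral_diff has_integral_mult_right integrable_integral)
      (auto simp: mult.commute)
  then have "0 \<le> integral {s..t} (\<lambda>x. g x * g x) - 2 * c * integral {s..t} g + c\<^sup>2 * (t - s)"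
  proof (rule has_integral_nonneg)
    fix x
    have "g x * g x - 2 * c * g x + c\<^sup>2 = (g x - c)\<^sup>2" by (simp add: power2_eq_square algebra_simps)
    then show "0 \<le> g x * g x - 2 * c * g x + c\<^sup>2" by simp
  qed
  also have "\<dots> = integral {s..t} (\<lambda>x. g x * g x) - (integral {s..t} g)\<^sup>2 / (t - s)"
  proof -
    have "integral {s..t} g = c * (t - s)" using st by (simp add: c_def)
    then show ?thesis using st by (simp add: power2_eq_square)
  qed
  finally show ?thesis using st by (simp add: field_simps)
qed simp

lemma pwc_sub_integrable: "pwc f \<Longrightarrow> 0 \<le> a \<Longrightarrow> b \<le> 1 \<Longrightarrow> f integrable_on {a..b}"
  by (rule integrable_subinterval_real[OF pwc_integrable_on(1)]) auto

text \<open>Starting from the zero \<open>z\<close>, every value of \<open>e\<close> is, up to sign,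
  an integral of \<open>g\<close> over part of the interval, and Cauchy-Schwarz bounds it.\<close>

lemma element_poincare:
  assumes ab: "0 \<le> a" "a \<le> b" "b \<le> 1" and e: "weak_deriv e g" and z: "z \<in> {a..b}" "e z = 0"
  shows "integral {a..b} (\<lambda>x. e x * e x) \<le> (b - a)\<^sup>2 * integral {a..b} (\<lambda>x. g x * g x)"
proof -
  let ?G = "integral {a..b} (\<lambda>x. g x * g x)"
  note p = weak_deriv_pwc[OF e]
  have gg: "pwc (\<lambda>x. g x * g x)" using p by (intro pwc_mult)
  have bound: "(e t - e s)\<^sup>2 \<le> (b - a) * ?G" if "a \<le> s" "s \<le> t" "t \<le> b" for s t
  proof -
    have "e t - e s = integral {s..t} g"
      using weak_deriv_ftc[OF e, of s t] that ab by (simp add: integral_unique)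
    then have "(e t - e s)\<^sup>2 \<le> (t - s) * integral {s..t} (\<lambda>x. g x * g x)"
      using that ab p gg by (auto intro!: interval_cauchy_schwarz pwc_sub_integrable)
    also have "\<dots> \<le> (b - a) * ?G"
      using that ab p gg
      by (intro mult_mono integral_subset_le integral_nonneg pwc_sub_integrable) auto
    finally show ?thesis .
  qed
  have "e x * e x \<le> (b - a) * ?G" if x: "x \<in> {a..b}" for x
    using bound[of z x] bound[of x z] x z by (cases "z \<le> x") (auto simp: power2_eq_square)
  then have "integral {a..b} (\<lambda>x. e x * e x) \<le> integral {a..b} (\<lambda>x. (b - a) * ?G)"
    using p ab by (intro integral_le pwc_sub_integrable pwc_mult) auto
  also have "\<dots> = (b - a)\<^sup>2 * ?G" using ab by (simp add: power2_eq_square)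
  finally show ?thesis .
qed

abbreviation elem :: "nat \<Rightarrow> nat \<Rightarrow> real set" where
  "elem n j \<equiv> {real j / real n<..<real (Suc j) / real n}"

abbreviation closed_elem :: "nat \<Rightarrow> nat \<Rightarrow> real set" where
  "closed_elem n j \<equiv> {real j / real n..real (Suc j) / real n}"

lemma grid_bounds:
  assumes "j < n"
  shows "0 \<le> real j / real n" "real j / real n < real (Suc j) / real n" "real (Suc j) / real n \<le> 1"
    "real (Suc j) / real n - real j / real n = 1 / real n"
  using assms by (auto simp: field_simps)

lemma integral_le_elements:
  fixes f g :: "real \<Rightarrow> real"
  assumes n: "0 < n" and f: "f integrable_on {0..1}" and g: "g integrable_on {0..1}"
    and le: "\<And>j. j < n \<Longrightarrow> integral (closed_elem n j) f
        \<le> integral (closed_elem n j) g"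
  shows "integral {0..1} f \<le> integral {0..1} g"
proof -
  have "k \<le> n \<Longrightarrow> integral {0..real k / real n} f \<le> integral {0..real k / real n} g" for k
  proof (induction k)
    case (Suc k)
    then have k: "k < n" by simp
    note b = grid_bounds[OF k]
    have *: "integral {0..real k / real n} h + integral (closed_elem n k) h =
        integral {0..real (Suc k) / real n} h" if "h integrable_on {0..1}" for h :: "real \<Rightarrow> real"
      using b by (intro Henstock_Kurzweil_Integration.integral_combine integrable_subinterval_real[OF that]) auto
    show ?case using Suc.IH k le[OF k] *[OF f] *[OF g] by linarith
  qed simp
  from this[of n] show ?thesis using n by simp
qed

lemma poincare:
  assumes n: "0 < n" and e: "weak_deriv e g"
    and z: "\<And>j. j < n \<Longrightarrow> \<exists>z\<in>closed_elem n j. e z = 0"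
  shows "l2_inner e e \<le> (1 / real n)\<^sup>2 * l2_inner g g"
proof -
  note p = weak_deriv_pwc[OF e]
  have ee: "pwc (\<lambda>x. e x * e x)" and gg: "pwc (\<lambda>x. g x * g x)" using p by (auto intro: pwc_mult)
  have "integral {0..1} (\<lambda>x. e x * e x) \<le> integral {0..1} (\<lambda>x. (1 / real n)\<^sup>2 * (g x * g x))"
  proof (rule integral_le_elements[OF n])
    fix j assume j: "j < n"
    note b = grid_bounds[OF j]
    obtain z where z: "z \<in> closed_elem n j" "e z = 0"
      using assms(3)[OF j] by auto
    show "integral (closed_elem n j) (\<lambda>x. e x * e x) \<le>
        integral (closed_elem n j) (\<lambda>x. (1 / real n)\<^sup>2 * (g x * g x))"
      using element_poincare[OF b(1) less_imp_le[OF b(2)] b(3) e z] b(4) by simp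
  qed (auto intro!: pwc_integrable_on pwc_scale ee gg)
  then show ?thesis using p by (simp add: l2_eq)
qed

lemma zero_of_mean_zero:
  fixes w :: "real \<Rightarrow> real"
  assumes w: "continuous_on {0..1} w" and ab: "0 \<le> a" "a < b" "b \<le> 1" and 0: "integral {a..b} w = 0"
  shows "\<exists>z\<in>{a..b}. w z = 0"
proof -
  have c: "continuous_on {a..b} w" using ab by (intro continuous_on_subset[OF w]) auto
  have "\<exists>z\<in>{a<..<b}. integral {a..b} w - integral {a..a} w = (b - a) * w z"
  proof (rule mvt_simple[OF ab(2)])
    fix x assume "a \<le> x" "x \<le> b"
    then have "((\<lambda>u. integral {a..u} w) has_vector_derivative w x) (at x within {a..b})"
      by (intro integral_has_vector_derivative[OF c]) auto
    then show "((\<lambda>u. integral {a..u} w) has_derivative (\<lambda>h. h * w x)) (at x within {a..b})"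
      by (simp add: has_vector_derivative_def)
  qed
  then show ?thesis using 0 ab by fastforce
qed

lemma poincare_mean_zero:
  assumes "0 < n" and e: "weak_deriv e g"
    and "\<And>j. j < n \<Longrightarrow> integral (closed_elem n j) e = 0"
  shows "l2_inner e e \<le> (1 / real n)\<^sup>2 * l2_inner g g"
  using assms grid_bounds by (intro poincare zero_of_mean_zero) (auto simp: weak_deriv_def)

text \<open>About the midpoint the affine function is \<open>y + c * (x - (s + t) / 2)\<close>,
  whose square integrates to \<open>y\<^sup>2 * (t - s) + c\<^sup>2 * (t - s) ^ 3 / 12\<close>.
  Dropping the first term leaves the factor 12, the origin of the constant in
  \<open>smoother_sigma\<close>.\<close>

lemma integral_affine_square:
  fixes s t c d :: real
  assumes "s < t"
  shows "12 / (t - s)\<^sup>2 * integral {s..t} (\<lambda>x. (d + c * x) * (d + c * x)) \<ge> integral {s..t} (\<lambda>x. c * c)"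
proof -
  define y where "y = d + c * ((s + t) / 2)"
  let ?F = "\<lambda>x. (y + c * (x - (s + t) / 2)) ^ 2"
  let ?P = "\<lambda>x. y\<^sup>2 * x + y * c * (x - (s + t) / 2)\<^sup>2 + c\<^sup>2 / 3 * (x - (s + t) / 2) ^ 3"
  have "((\<lambda>x. (d + c * x) * (d + c * x)) has_integral (?P t - ?P s)) {s..t}"
  proof (rule fundamental_theorem_of_calculus)
    fix x
    have "(?P has_real_derivative (d + c * x) * (d + c * x)) (at x within {s..t})"
      by (auto intro!: derivative_eq_intros simp: y_def power2_eq_square field_simps)
    then show "(?P has_vector_derivative (d + c * x) * (d + c * x)) (at x within {s..t})"
      by (simp add: has_real_derivative_iff_has_vector_derivative)
  qed (use assms in simp)
  moreover have "?P t - ?P s = y\<^sup>2 * (t - s) + c\<^sup>2 * (t - s) ^ 3 / 12"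
    by (simp add: power2_eq_square power3_eq_cube field_simps)
  ultimately have i: "integral {s..t} (\<lambda>x. (d + c * x) * (d + c * x)) = y\<^sup>2 * (t - s) + c\<^sup>2 * (t - s) ^ 3 / 12"
    by (simp add: integral_unique)
  have "c * c * (t - s) = 12 / (t - s)\<^sup>2 * (c\<^sup>2 * (t - s) ^ 3 / 12)"
    using assms by (simp add: power2_eq_square power3_eq_cube)
  also have "\<dots> \<le> 12 / (t - s)\<^sup>2 * (y\<^sup>2 * (t - s) + c\<^sup>2 * (t - s) ^ 3 / 12)"
    using assms by (intro mult_left_mono) auto
  finally have "c * c * (t - s) \<le> 12 / (t - s)\<^sup>2 * integral {s..t} (\<lambda>x. (d + c * x) * (d + c * x))"
    unfolding i .
  then show ?thesis using assms by (simp add: mult.commute mult.left_commute)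
qed

section \<open>Splines with alternating boundary conditions\<close>

text \<open>Boundary-adapted splines generated by repeated integration: for \<open>b\<close> the derivatives of odd
  order below the degree vanish at both ends, for \<open>\<not> b\<close> those of even order.\<close>

fun bspl :: "nat \<Rightarrow> nat \<Rightarrow> bool \<Rightarrow> (real \<Rightarrow> real) set" where
  "bspl n 0 b = {v. \<forall>j<n. \<exists>c. \<forall>x\<in>elem n j. v x = c}"
| "bspl n (Suc p) b = {u. \<exists>v\<in>bspl n p (\<not> b). weak_deriv u v \<and> (\<not> b \<longrightarrow> u 0 = 0 \<and> u 1 = 0)}"

definition grid :: "nat \<Rightarrow> real set" where
  "grid n = (\<lambda>j. real j / real n) ` {..n}"

lemma finite_grid [simp]: "finite (grid n)"
  by (simp add: grid_def)

lemma element_cover: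
  assumes n: "0 < n" and x: "x \<in> {0<..<1} - grid n"
  shows "\<exists>j<n. x \<in> elem n j"
proof -
  define j where "j = nat \<lfloor>x * real n\<rfloor>"
  have x': "0 < x" "x < 1" using x by auto
  have j: "real j \<le> x * real n" "x * real n < real j + 1"
    using x' n unfolding j_def by (auto simp: floor_le_iff)
  have "real j < real n" using j(1) x' n by (smt (verit) mult_less_cancel_right2 of_nat_0_less_iff)
  then have jn: "j < n" by simp
  have "x \<noteq> real j / real n" using x jn by (auto simp: grid_def)
  then have "real j < x * real n" using j(1) n by (simp add: nonzero_eq_divide_eq)
  then show ?thesis using j(2) jn n
    by (intro exI[of _ j]) (simp add: pos_divide_less_eq pos_less_divide_eq add.commute)
qed

lemma pwc_piecewise:
  assumes n: "0 < n" and f: "\<And>j. j < n \<Longrightarrow> \<exists>g. continuous_on UNIV g \<and>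
      (\<forall>x\<in>elem n j. f x = (g x :: real))"
  shows "pwc f"
proof -
  obtain g where g: "\<And>j. j < n \<Longrightarrow> continuous_on UNIV (g j)"
    "\<And>j x. j < n \<Longrightarrow> x \<in> elem n j \<Longrightarrow> f x = (g j x :: real)"
    using f by metis
  have cont: "isCont f x" if x: "x \<in> {0<..<1} - grid n" for x
  proof -
    obtain j where j: "j < n" "x \<in> elem n j"
      using element_cover[OF n x] by auto
    have "continuous_on (elem n j) f"
      using g(2)[OF j(1)] by (subst continuous_on_cong[OF refl]) (auto intro: continuous_on_subset[OF g(1)[OF j(1)]])
    then show ?thesis using j(2) by (simp add: continuous_on_eq_continuous_at)
  qed
  have "f ` {0<..<1} \<subseteq> f ` grid n \<union> (\<Union>j<n. g j ` {0..1})"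
  proof (rule image_subsetI)
    fix x :: real assume x: "x \<in> {0<..<1}"
    show "f x \<in> f ` grid n \<union> (\<Union>j<n. g j ` {0..1})"
    proof (cases "x \<in> grid n")
      case False
      then obtain j where j: "j < n" "x \<in> elem n j"
        using element_cover[OF n] x by blast
      then show ?thesis using g(2)[OF j] x by (intro UnI2 UN_I[of j]) auto
    qed simp
  qed
  moreover have "bounded (f ` grid n \<union> (\<Union>j<n. g j ` {0..1}))"
  proof -
    have "bounded (g j ` {0..1})" if "j < n" for j
      by (intro compact_imp_bounded compact_continuous_image continuous_on_subset[OF g(1)[OF that]]) auto
    then show ?thesis by (auto simp: finite_imp_bounded)
  qed
  ultimately have "bounded (f ` {0<..<1})" by (rule bounded_subset[rotated])
  moreover have "continuous_on ({0<..<1} - grid n) f"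
    using cont by (auto intro: continuous_at_imp_continuous_on)
  ultimately show ?thesis unfolding pwc_def by (intro conjI exI[of _ "grid n"]) auto
qed

lemma bspl_pwc: "0 < n \<Longrightarrow> u \<in> bspl n p b \<Longrightarrow> pwc u"
proof (cases p)
  case 0
  assume "0 < n" "u \<in> bspl n p b"
  then show ?thesis using 0 by (intro pwc_piecewise[of n]) (auto, metis continuous_on_const)
qed (auto dest: weak_deriv_pwc)

lemma bspl_zero: "(\<lambda>x. 0) \<in> bspl n p b"
proof (induction p arbitrary: b)
  case (Suc p)
  then show ?case using weak_deriv_const[of 0] by auto
qed auto

lemma bspl_const: "(\<lambda>x. c) \<in> bspl n p True"
  using bspl_zero weak_deriv_const[of c] by (cases p) (auto intro!: bexI[of _ "\<lambda>x. 0"])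

lemma bspl_diff_const:
  assumes "u \<in> bspl n p True"
  shows "(\<lambda>x. u x - c) \<in> bspl n p True"
proof (cases p)
  case 0
  show ?thesis unfolding 0 bspl.simps mem_Collect_eq
  proof (intro allI impI)
    fix j assume "j < n"
    then obtain d where "\<forall>x\<in>elem n j. u x = d"
      using assms 0 by auto
    then show "\<exists>d. \<forall>x\<in>elem n j. u x - c = d"
      by (intro exI[of _ "d - c"]) simp
  qed
next
  case (Suc q)
  then obtain v where "v \<in> bspl n q False" "weak_deriv u v" using assms by auto
  then show ?thesis using weak_deriv_diff[of u v "\<lambda>_. c" "\<lambda>_. 0"] weak_deriv_const[of c] Suc by auto
qed

lemma integral_diff_const:
  fixes f :: "real \<Rightarrow> real"
  assumes "f integrable_on {0..1}"
  shows "integral {0..1} (\<lambda>x. f x - c) = integral {0..1} f - c"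
  using assms by (subst Henstock_Kurzweil_Integration.integral_diff) auto

lemma prim_bspl_True: "0 < n \<Longrightarrow> y \<in> bspl n p False \<Longrightarrow> prim y \<in> bspl n (Suc p) True"
  using weak_deriv_prim[OF bspl_pwc, of n y p False] by auto

lemma prim_bspl_False:
  assumes n: "0 < n" and y: "y \<in> bspl n p True" and \<mu>: "\<mu> = integral {0..1} y"
  shows "prim (\<lambda>x. y x - \<mu>) \<in> bspl n (Suc p) False" "weak_deriv (prim (\<lambda>x. y x - \<mu>)) (\<lambda>x. y x - \<mu>)"
    "prim (\<lambda>x. y x - \<mu>) 1 = 0"
proof -
  have y': "(\<lambda>x. y x - \<mu>) \<in> bspl n p True" by (rule bspl_diff_const[OF y])
  show w: "weak_deriv (prim (\<lambda>x. y x - \<mu>)) (\<lambda>x. y x - \<mu>)" by (rule weak_deriv_prim[OF bspl_pwc[OF n y']])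
  show z: "prim (\<lambda>x. y x - \<mu>) 1 = 0"
    using pwc_integrable_on(1)[OF bspl_pwc[OF n y]] \<mu> by (simp add: prim_def integral_diff_const)
  show "prim (\<lambda>x. y x - \<mu>) \<in> bspl n (Suc p) False" using y' w z by auto
qed

text \<open>Absorption: the estimates obtained from partial integration and Cauchy-Schwarz contain
  the square root of their own left-hand side.\<close>

lemma sqrt_absorb:
  assumes "0 \<le> a" "0 \<le> b" "0 \<le> r" "a \<le> r * sqrt a * sqrt b"
  shows "a \<le> r\<^sup>2 * b"
proof (cases "a = 0")
  case False
  then have a: "sqrt a > 0" using assms by simp
  have "sqrt a * sqrt a \<le> (r * sqrt b) * sqrt a" using assms by (simp add: mult_ac)
  then have "sqrt a \<le> r * sqrt b" using a by (simp only: mult_le_cancel_right_pos)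
  then have "(sqrt a)\<^sup>2 \<le> (r * sqrt b)\<^sup>2" using a by (intro power_mono) auto
  then show ?thesis using assms by (simp add: power_mult_distrib)
qed (use assms in auto)

lemma affine_on_element:
  assumes ab: "0 \<le> a" "a < b" "b \<le> 1" and u: "weak_deriv u v" and v: "\<And>x. x \<in> {a<..<b} \<Longrightarrow> v x = c"
    and x: "x \<in> {a..b}"
  shows "u x = (u a - c * a) + c * x"
proof -
  have "(v has_integral (u x - u a)) {a..x}" using weak_deriv_ftc[OF u, of a x] ab x by auto
  moreover have "((\<lambda>_. c) has_integral (c * (x - a))) {a..x}"
    using has_integral_const_real[of c a x] x by (simp add: mult.commute)
  then have "(v has_integral (c * (x - a))) {a..x}"
    by (rule has_integral_spike_finite[of "{a, x}", rotated 2]) (use v x in auto)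
  ultimately have "u x - u a = c * (x - a)" by (rule has_integral_unique)
  then show ?thesis by (simp add: algebra_simps)
qed

text \<open>For \<open>v = u'\<close> and \<open>k = u''\<close> the boundary conditions give \<open>|v|\<^sup>2 = - <u, k> \<le> |u| |k|\<close>, and
  \<open>|k|\<close> is bounded by \<open>|v|\<close> with the constant of the next lower degree.\<close>

lemma bspl_inverse_inequality:
  assumes n: "0 < n" and u: "u \<in> bspl n (Suc p) b" and v: "v \<in> bspl n p (\<not> b)" and uv: "weak_deriv u v"
  shows "l2_inner v v \<le> 12 * (real n)\<^sup>2 * l2_inner u u"
  using u v uv
proof (induction p arbitrary: b u v)
  case 0
  note p = weak_deriv_pwc[OF 0(3)]
  \<comment> \<open>In the base case \<open>u\<close> has degree one and is affine on every element,
    so the elementwise estimate applies.\<close>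
  have "integral {0..1} (\<lambda>x. v x * v x) \<le> integral {0..1} (\<lambda>x. 12 * (real n)\<^sup>2 * (u x * u x))"
  proof (rule integral_le_elements[OF n])
    fix j assume j: "j < n"
    note b = grid_bounds[OF j]
    let ?a = "real j / real n" and ?b = "real (Suc j) / real n"
    obtain c where c: "\<And>x. x \<in> {?a<..<?b} \<Longrightarrow> v x = c" using 0(2) j by auto
    have "integral {?a..?b} (\<lambda>x. v x * v x) = integral {?a<..<?b} (\<lambda>x. v x * v x)"
      by (simp add: integral_open_interval_real)
    also have "\<dots> = integral {?a<..<?b} (\<lambda>x. c * c)"
      by (rule Henstock_Kurzweil_Integration.integral_cong) (simp add: c)
    also have "\<dots> = integral {?a..?b} (\<lambda>x. c * c)" by (simp only: integral_open_interval_real)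
    also have "\<dots> \<le> 12 / (?b - ?a)\<^sup>2 * integral {?a..?b} (\<lambda>x. ((u ?a - c * ?a) + c * x) * ((u ?a - c * ?a) + c * x))"
      by (rule integral_affine_square[OF b(2)])
    also have "integral {?a..?b} (\<lambda>x. ((u ?a - c * ?a) + c * x) * ((u ?a - c * ?a) + c * x)) =
        integral {?a..?b} (\<lambda>x. u x * u x)"
      by (intro Henstock_Kurzweil_Integration.integral_cong)
        (subst (1 2) affine_on_element[OF b(1-3) 0(3) c], auto)
    also have "12 / (?b - ?a)\<^sup>2 * integral {?a..?b} (\<lambda>x. u x * u x) =
        integral {?a..?b} (\<lambda>x. 12 * (real n)\<^sup>2 * (u x * u x))"
      by (simp only: b(4)) (simp add: power_divide)
    finally show "integral {?a..?b} (\<lambda>x. v x * v x) \<le> integral {?a..?b} (\<lambda>x. 12 * (real n)\<^sup>2 * (u x * u x))" .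
  qed (auto intro!: pwc_integrable_on pwc_scale pwc_mult p)
  then show ?case using p by (simp add: l2_eq)
next
  case (Suc p)
  from Suc.prems(2) obtain k where k: "k \<in> bspl n p b" "weak_deriv v k" "b \<longrightarrow> v 0 = 0 \<and> v 1 = 0"
    by auto
  have u0: "\<not> b \<longrightarrow> u 0 = 0 \<and> u 1 = 0" using Suc.prems(1) by auto
  have IH: "l2_inner k k \<le> 12 * (real n)\<^sup>2 * l2_inner v v"
    using Suc.IH[OF Suc.prems(2)] k by simp
  note p = weak_deriv_pwc[OF Suc.prems(3)] weak_deriv_pwc[OF k(2)]
  have nn: "0 \<le> l2_inner v v" "0 \<le> l2_inner u u" using p l2.nonneg by auto
  \<comment> \<open>The boundary terms are products of values of \<open>u\<close> and
    \<open>v\<close>; the alternating conditions annihilate one of the two factors for either value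
    of \<open>b\<close>.\<close>
  have "l2_inner v v + l2_inner u k = 0"
    using integration_by_parts[OF Suc.prems(3) k(2)] k(3) u0 by (cases b) auto
  then have "l2_inner v v \<le> \<bar>l2_inner u k\<bar>" by simp
  also have "\<dots> \<le> sqrt (l2_inner u u) * sqrt (l2_inner k k)" using p by (intro l2.cauchy_schwarz_sqrt) auto
  also have "\<dots> \<le> sqrt (l2_inner u u) * sqrt (12 * (real n)\<^sup>2 * l2_inner v v)"
    using IH nn by (intro mult_left_mono) auto
  finally have "l2_inner v v \<le> (sqrt 12 * real n) * sqrt (l2_inner v v) * sqrt (l2_inner u u)"
    by (simp add: real_sqrt_mult mult_ac)
  then have "l2_inner v v \<le> (sqrt 12 * real n)\<^sup>2 * l2_inner u u"
    using nn by (intro sqrt_absorb) auto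
  then show ?case by (simp add: power_mult_distrib)
qed

text \<open>These indicators are the test functions of degree zero: orthogonality to them means mean
  value zero on each element.\<close>

lemma element_indicator:
  assumes "j < n"
  defines "y \<equiv> \<lambda>x. if x \<in> closed_elem n j then 1 else (0::real)"
  shows "y \<in> bspl n 0 b"
    "pwc w \<Longrightarrow> l2_inner w y = integral (closed_elem n j) w"
proof -
  note b = grid_bounds[OF assms(1)]
  show y: "y \<in> bspl n 0 b"
  proof (simp, intro allI impI)
    fix i assume i: "i < n"
    show "\<exists>c. \<forall>x\<in>{real i / real n<..<(1 + real i) / real n}. y x = c"
    proof (cases "i = j")
      case True
      then show ?thesis by (intro exI[of _ 1]) (auto simp: y_def)
    next
      case False
      then have "real (Suc i) \<le> real j \<or> real (Suc j) \<le> real i" by linarith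
      then have "real (Suc i) / real n \<le> real j / real n \<or> real (Suc j) / real n \<le> real i / real n"
        using assms(1) by (auto intro: divide_right_mono)
      then have "y x = 0" if "x \<in> {real i / real n<..<(1 + real i) / real n}" for x
        using that by (auto simp: y_def)
      then show ?thesis by blast
    qed
  qed
  assume w: "pwc w"
  have "pwc y" using bspl_pwc[OF _ y] assms(1) by simp
  then have "l2_inner w y = integral {0..1} (\<lambda>x. w x * y x)" using w by (rule l2_eq[rotated])
  also have "\<dots> = integral {0..1} (\<lambda>x. if x \<in> closed_elem n j then w x else 0)"
    by (rule Henstock_Kurzweil_Integration.integral_cong) (simp add: y_def)
  also have "\<dots> = integral (closed_elem n j) w"
    using b w
    by (intro integral_unique, subst has_integral_restrict) (auto intro!: integrable_integral pwc_sub_integrable)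
  finally show "l2_inner w y = integral (closed_elem n j) w" .
qed

lemma l2_diff_const:
  assumes "pwc u" "pwc y"
  shows "l2_inner u (\<lambda>x. y x - c) = l2_inner u y - c * integral {0..1} u"
proof -
  have "(\<lambda>x. y x - c) = y - c *\<^sub>R (\<lambda>_. 1)" by (auto simp: fun_eq_iff)
  then show ?thesis using assms l2.diff_right[of y "c *\<^sub>R (\<lambda>_. 1)" u] l2.scale_right[of "\<lambda>_. 1" u c]
    by (simp add: l2_one scaleR_fun_def)
qed

text \<open>Duality: a spline \<open>w\<close> orthogonal to one of the spaces has an antiderivative orthogonal to the
  space of the next lower degree with the complementary boundary conditions.\<close>

lemma bspl_poincare:
  assumes n: "0 < n" and w: "weak_deriv w g" "\<not> b \<longrightarrow> w 0 = 0 \<and> w 1 = 0"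
    and orth: "\<And>y. y \<in> bspl n p b \<Longrightarrow> l2_inner w y = 0"
  shows "l2_inner w w \<le> (1 / real n)\<^sup>2 * l2_inner g g"
  using w orth
proof (induction p arbitrary: b w g)
  case 0
  then show ?case using element_indicator(1)[where n=n and b=b] element_indicator(2)[where n=n and w=w] weak_deriv_pwc[OF 0(1)]
    by (intro poincare_mean_zero n) auto
next
  case (Suc p)
  note p = weak_deriv_pwc[OF Suc.prems(1)]
  have "\<exists>\<phi>. weak_deriv \<phi> w \<and> (b \<longrightarrow> \<phi> 0 = 0 \<and> \<phi> 1 = 0) \<and> (\<forall>y\<in>bspl n p (\<not> b). l2_inner \<phi> y = 0)"
  proof (cases b)
    case True
    \<comment> \<open>Constants lie in this space, so orthogonality makes the antiderivative vanish
      at 1 as well as at 0.\<close>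
    have "prim w 1 = 0"
      using Suc.prems(3)[of "\<lambda>_. 1"] bspl_const[of 1 n "Suc p"] True p by (simp add: l2_one prim_def)
    moreover have "l2_inner (prim w) y = 0" if y: "y \<in> bspl n p False" for y
      using integration_by_parts[OF weak_deriv_prim[OF p(1)] weak_deriv_prim[OF bspl_pwc[OF n y]]]
        Suc.prems(3)[of "prim y"] prim_bspl_True[OF n y] True \<open>prim w 1 = 0\<close> by simp
    ultimately show ?thesis using True weak_deriv_prim[OF p(1)] by (intro exI[of _ "prim w"]) auto
  next
    case False
    define c where "c = integral {0..1} (prim w)"
    define \<phi> where "\<phi> = (\<lambda>x. prim w x - c)"
    have d: "weak_deriv \<phi> w"
      using weak_deriv_diff[OF weak_deriv_prim[OF p(1)] weak_deriv_const[of c]] by (simp add: \<phi>_def)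
    have i: "integral {0..1} \<phi> = 0"
      using pwc_integrable_on(1)[OF weak_deriv_pwc(1)[OF weak_deriv_prim[OF p(1)]]]
      by (simp add: \<phi>_def c_def integral_diff_const)
    \<comment> \<open>Only after subtraction of its mean does \<open>y\<close> have an
      antiderivative vanishing at both ends. Since \<open>\<phi>\<close> has mean zero, the
      subtracted constant does not change the inner product.\<close>
    have "l2_inner \<phi> y = 0" if y: "y \<in> bspl n p True" for y
    proof -
      define \<mu> where "\<mu> = integral {0..1} y"
      note Y = prim_bspl_False[OF n y \<mu>_def]
      have "l2_inner \<phi> (\<lambda>x. y x - \<mu>) = 0"
        using integration_by_parts[OF d Y(2)] Y(3) Suc.prems(3)[of "prim (\<lambda>x. y x - \<mu>)"] Y(1) False by simp
      then show ?thesis using l2_diff_const[OF weak_deriv_pwc(1)[OF d] bspl_pwc[OF n y]] i by simp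
    qed
    then show ?thesis using d False by auto
  qed
  then obtain \<phi> where \<phi>: "weak_deriv \<phi> w" "b \<longrightarrow> \<phi> 0 = 0 \<and> \<phi> 1 = 0" "\<And>y. y \<in> bspl n p (\<not> b) \<Longrightarrow> l2_inner \<phi> y = 0"
    by blast
  have IH: "l2_inner \<phi> \<phi> \<le> (1 / real n)\<^sup>2 * l2_inner w w"
    using Suc.IH[of \<phi> w "\<not> b"] \<phi> by auto
  note q = weak_deriv_pwc[OF \<phi>(1)]
  have nn: "0 \<le> l2_inner w w" "0 \<le> l2_inner g g" using p l2.nonneg by auto
  have "l2_inner w w + l2_inner \<phi> g = 0"
    using integration_by_parts[OF \<phi>(1) Suc.prems(1)] Suc.prems(2) \<phi>(2) by (cases b) auto
  then have "l2_inner w w \<le> \<bar>l2_inner \<phi> g\<bar>" by simp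
  also have "\<dots> \<le> sqrt (l2_inner \<phi> \<phi>) * sqrt (l2_inner g g)"
    using p q by (intro l2.cauchy_schwarz_sqrt) auto
  also have "\<dots> \<le> sqrt ((1 / real n)\<^sup>2 * l2_inner w w) * sqrt (l2_inner g g)"
    using IH nn by (intro mult_right_mono) auto
  finally have "l2_inner w w \<le> 1 / real n * sqrt (l2_inner w w) * sqrt (l2_inner g g)"
    by (simp add: real_sqrt_mult real_sqrt_divide)
  then show ?case using nn by (intro sqrt_absorb) auto
qed

text \<open>The tested functions are the derivatives of boundary-adapted splines of the next higher
  degree, so the hypothesis is Galerkin orthogonality of the error \<open>e\<close>. For positive
  degree a partial integration moves the orthogonality from \<open>g\<close> to \<open>e\<close>,
  and \<open>bspl_poincare\<close> applies.\<close>

lemma ritz_error: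
  assumes n: "0 < n" and e: "weak_deriv e g" "integral {0..1} e = 0"
    and orth: "\<And>y. y \<in> bspl n p False \<Longrightarrow> l2_inner g y = 0"
  shows "l2_inner e e \<le> (1 / real n)\<^sup>2 * l2_inner g g"
proof (cases p)
  case 0
  note p = weak_deriv_pwc[OF e(1)]
  \<comment> \<open>In degree zero \<open>g\<close> has mean zero on each element, so
    \<open>e\<close> takes one common value at all grid points; subtracting it creates a zero in
    every element.\<close>
  have step: "e (real (Suc j) / real n) = e (real j / real n)" if j: "j < n" for j
    using weak_deriv_ftc[OF e(1) grid_bounds(1)[OF j] less_imp_le[OF grid_bounds(2)[OF j]] grid_bounds(3)[OF j]]
      element_indicator(1)[OF j, of False] element_indicator(2)[OF j, of g] orth 0 p by (simp add: integral_unique)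
  have eq: "j \<le> n \<Longrightarrow> e (real j / real n) = e 0" for j
    by (induction j) (use step in auto)
  define c where "c = e 0"
  have d: "weak_deriv (\<lambda>x. e x - c) g" using weak_deriv_diff[OF e(1) weak_deriv_const[of c]] by simp
  have "l2_inner (\<lambda>x. e x - c) (\<lambda>x. e x - c) \<le> (1 / real n)\<^sup>2 * l2_inner g g"
  proof (rule poincare[OF n d])
    fix j assume "j < n"
    then show "\<exists>z\<in>closed_elem n j. e z - c = 0"
      using eq[of j] grid_bounds[of j n] by (intro bexI[of _ "real j / real n"]) (auto simp: c_def)
  qed
  \<comment> \<open>Since \<open>e\<close> has mean zero, subtracting a constant can only enlarge
    its norm.\<close>
  moreover have "l2_inner (\<lambda>x. e x - c) (\<lambda>x. e x - c) = l2_inner e e + c\<^sup>2"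
  proof -
    have "integral {0..1} (\<lambda>x. e x - c) = - c"
      using e(2) pwc_integrable_on(1)[OF p(1)] by (simp add: integral_diff_const)
    moreover have "l2_inner (\<lambda>x. e x - c) e = l2_inner e (\<lambda>x. e x - c)"
      using weak_deriv_pwc(1)[OF d] p(1) by (intro l2.sym) auto
    ultimately show ?thesis
      using l2_diff_const[OF weak_deriv_pwc(1)[OF d] p(1), of c] l2_diff_const[OF p(1) p(1), of c] e(2)
      by (simp add: power2_eq_square)
  qed
  ultimately show ?thesis by (smt (verit) zero_le_power2)
next
  case (Suc q)
  note p = weak_deriv_pwc[OF e(1)]
  have "l2_inner e y = 0" if y: "y \<in> bspl n q True" for y
  proof -
    define \<mu> where "\<mu> = integral {0..1} y"
    note Y = prim_bspl_False[OF n y \<mu>_def]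
    have "l2_inner e (\<lambda>x. y x - \<mu>) = 0"
      using integration_by_parts[OF e(1) Y(2)] Y(3) orth[of "prim (\<lambda>x. y x - \<mu>)"] Y(1) Suc by simp
    then show ?thesis using l2_diff_const[OF p(1) bspl_pwc[OF n y]] e(2) by simp
  qed
  then show ?thesis by (intro bspl_poincare[OF n e(1), of True q]) auto
qed

section \<open>Spline spaces with prescribed vanishing derivatives\<close>

text \<open>A set of prescribed orders allows one induction for both spaces: the empty set yields
  the full spline space, the odd orders yield \<open>S\<^sub>0\<close>, and differentiation shifts
  the set by one.\<close>

fun spl :: "nat \<Rightarrow> nat \<Rightarrow> nat set \<Rightarrow> (real \<Rightarrow> real) set" where
  "spl n 0 B = {v. \<forall>j<n. \<exists>c. \<forall>x\<in>elem n j. v x = c}"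
| "spl n (Suc p) B = {u. \<exists>v\<in>spl n p {k. Suc k \<in> B}. weak_deriv u v \<and> (0 \<in> B \<longrightarrow> u 0 = 0 \<and> u 1 = 0)}"

lemma bspl_eq_spl: "bspl n p b = spl n p {k. odd k = b}"
proof (induction p arbitrary: b)
  case (Suc p)
  have "{k. Suc k \<in> {k. odd k = b}} = {k. odd k = (\<not> b)}" by auto
  then show ?case using Suc[of "\<not> b"] by auto
qed simp

lemma spl_pwc: "0 < n \<Longrightarrow> u \<in> spl n p B \<Longrightarrow> pwc u"
proof (cases p)
  case 0
  assume "0 < n" "u \<in> spl n p B"
  then show ?thesis using 0 bspl_pwc[of n u 0 True] by simp
qed (auto dest: weak_deriv_pwc)

lemma spl_refine:
  assumes n: "0 < n" and r: "0 < r"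
  shows "spl n p B \<subseteq> spl (r * n) p B"
proof (induction p arbitrary: B)
  case 0
  show ?case
  proof (clarsimp, goal_cases)
    case (1 v j)
    \<comment> \<open>The coarse element that contains the fine element \<open>j\<close>.\<close>
    define i where "i = j div r"
    have i: "i < n" using 1(2) by (simp add: i_def less_mult_imp_div_less mult.commute)
    obtain c where c: "\<And>x. x \<in> elem n i \<Longrightarrow> v x = c"
      using 1(1) i by auto
    have "r * i \<le> j" "Suc j \<le> r * Suc i"
      using r by (auto simp: i_def dividend_less_times_div Suc_le_eq)
    then have rij: "real r * real i \<le> real j" "real (Suc j) \<le> real r * real (Suc i)"
      by (simp_all flip: of_nat_mult del: of_nat_Suc)
    have e: "real r * real k / (real r * real n) = real k / real n" for k using r by simp
    have "real i / real n \<le> real j / (real r * real n)"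
      "real (Suc j) / (real r * real n) \<le> real (Suc i) / real n"
      using rij[THEN divide_right_mono, of "real r * real n"] unfolding e by simp_all
    then have "v x = c" if "x \<in> {real j / (real r * real n)<..<(1 + real j) / (real r * real n)}" for x
      using that by (intro c) auto
    then show ?case by blast
  qed
next
  case (Suc p)
  then show ?case unfolding spl.simps by blast
qed

lemma spl_subspace: "subspace (spl n p B)"
proof (induction p arbitrary: B)
  case 0
  show ?case unfolding subspace_def
  proof (intro conjI ballI allI)
    fix u v assume uv: "u \<in> spl n 0 B" "v \<in> spl n 0 B"
    show "u + v \<in> spl n 0 B" unfolding spl.simps mem_Collect_eq
    proof (intro allI impI)
      fix j assume "j < n"
      then obtain c d where "\<forall>x\<in>elem n j. u x = c"
        "\<forall>x\<in>elem n j. v x = d" using uv by fastforce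
      then show "\<exists>c. \<forall>x\<in>elem n j. (u + v) x = c"
        by (intro exI[of _ "c + d"]) simp
    qed
  next
    fix u a assume u: "u \<in> spl n 0 B"
    show "a *\<^sub>R u \<in> spl n 0 B" unfolding spl.simps mem_Collect_eq
    proof (intro allI impI)
      fix j assume "j < n"
      then obtain c where "\<forall>x\<in>elem n j. u x = c"
        using u by fastforce
      then show "\<exists>c. \<forall>x\<in>elem n j. (a *\<^sub>R u) x = c"
        by (intro exI[of _ "a * c"]) simp
    qed
  qed auto
next
  case (Suc p)
  let ?B = "{k. Suc k \<in> B}"
  note s = Suc[of ?B]
  show ?case unfolding subspace_def
  proof (intro conjI ballI allI)
    show "0 \<in> spl n (Suc p) B"
      using subspace_0[OF s] weak_deriv_const[of 0] by (auto simp: zero_fun_def)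
  next
    fix u v assume "u \<in> spl n (Suc p) B" "v \<in> spl n (Suc p) B"
    then obtain g k where "g \<in> spl n p ?B" "k \<in> spl n p ?B" "weak_deriv u g" "weak_deriv v k"
      "0 \<in> B \<longrightarrow> u 0 = 0 \<and> u 1 = 0" "0 \<in> B \<longrightarrow> v 0 = 0 \<and> v 1 = 0" by auto
    moreover from this have "g + k \<in> spl n p ?B" by (intro subspace_add[OF s])
    ultimately show "u + v \<in> spl n (Suc p) B"
      using weak_deriv_add[of u g v k] by (auto simp: plus_fun_def)
  next
    fix u a assume "u \<in> spl n (Suc p) B"
    then obtain g where "g \<in> spl n p ?B" "weak_deriv u g" "0 \<in> B \<longrightarrow> u 0 = 0 \<and> u 1 = 0" by auto
    moreover from this have "a *\<^sub>R g \<in> spl n p ?B" by (intro subspace_scale[OF s])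
    ultimately show "a *\<^sub>R u \<in> spl n (Suc p) B"
      using weak_deriv_scale[of u g a] by (auto simp: scaleR_fun_def)
  qed
qed

section \<open>Passage between \<open>spl\<close> and the spaces of zero-extended splines with
  classical derivatives\<close>

definition restr :: "(real \<Rightarrow> real) \<Rightarrow> real \<Rightarrow> real" where
  "restr f x = (if x \<in> {0<..<1} then f x else 0)"

definition ppoly :: "nat \<Rightarrow> nat \<Rightarrow> (real \<Rightarrow> real) \<Rightarrow> bool" where
  "ppoly p m u \<longleftrightarrow> (\<forall>j<m. \<exists>g :: real poly. degree g \<le> p \<and>
     (\<forall>x\<in>elem m j. u x = poly g x))"

text \<open>Common form of \<open>spline_space\<close> and \<open>spline_space0\<close>, with
  boundary conditions as one-sided limits. It is to be matched with \<open>spl\<close>, where they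
  are values of a continuous extension.\<close>

definition spline_bc :: "nat \<Rightarrow> nat \<Rightarrow> nat set \<Rightarrow> (real \<Rightarrow> real) set" where
  "spline_bc p m B = {u. (\<forall>x. x \<notin> {0<..<1} \<longrightarrow> u x = 0) \<and> Ck_on (p - 1) {0<..<1} u \<and> ppoly p m u \<and>
     (\<forall>k\<in>B. k < p \<longrightarrow> ((deriv ^^ k) u \<longlongrightarrow> 0) (at_right 0) \<and> ((deriv ^^ k) u \<longlongrightarrow> 0) (at_left 1))}"

lemma ppoly_iff:
  "ppoly p m u \<longleftrightarrow> (\<forall>j\<in>{1..m}. \<exists>g :: real poly. degree g \<le> p \<and>
     (\<forall>x\<in>{(real j - 1) / real m <..< real j / real m}. u x = poly g x))"
proof -
  have "{1..m} = Suc ` {..<m}" by (simp add: lessThan_atLeast0 atLeastLessThanSuc_atLeastAtMost)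
  then show ?thesis by (auto simp: ppoly_def)
qed

lemma spline_space_eq: "spline_space p m = spline_bc p m {}"
  by (auto simp: spline_space_def spline_bc_def ppoly_iff)

lemma spline_space0_eq: "spline_space0 p m = spline_bc p m {k. odd k = True}"
proof -
  have "(\<forall>l. 2 * l + 1 < p \<longrightarrow> P (2 * l + 1)) \<longleftrightarrow> (\<forall>k\<in>{k. odd k = True}. k < p \<longrightarrow> P k)" for P
    by (auto elim!: oddE)
  from this[of "\<lambda>k. ((deriv ^^ k) u \<longlongrightarrow> 0) (at_right 0) \<and> ((deriv ^^ k) u \<longlongrightarrow> 0) (at_left 1)" for u]
  show ?thesis unfolding spline_space0_def spline_space_def spline_bc_def ppoly_iff by blast
qed

lemma deriv_funpow_cong:
  assumes X: "open X" and eq: "\<And>x. x \<in> X \<Longrightarrow> f x = (g x :: real)"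
  shows "x \<in> X \<Longrightarrow> (deriv ^^ k) f x = (deriv ^^ k) g x"
proof (induction k arbitrary: x)
  case (Suc k)
  then show ?case
    using X by (auto intro!: deriv_cong_ev exI[of _ X] simp: eventually_nhds)
qed (use eq in auto)

lemma differentiable_cong_open:
  fixes f g :: "real \<Rightarrow> real"
  assumes X: "open X" and eq: "\<And>x. x \<in> X \<Longrightarrow> f x = g x" and x: "x \<in> X" and f: "f differentiable (at x)"
  shows "g differentiable (at x)"
proof -
  obtain D where "(f has_real_derivative D) (at x)" using f by (auto simp: real_differentiable_def)
  then have "(g has_real_derivative D) (at x)"
    by (rule has_field_derivative_transform_within_open[OF _ X x]) (use eq in auto)
  then show ?thesis by (auto simp: real_differentiable_def)
qed

lemma Ck_on_cong:
  fixes f g :: "real \<Rightarrow> real"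
  assumes X: "open X" and eq: "\<And>x. x \<in> X \<Longrightarrow> f x = g x"
  shows "Ck_on k X f \<longleftrightarrow> Ck_on k X g"
proof -
  note * = deriv_funpow_cong[OF X eq]
  have "(deriv ^^ i) f differentiable (at x) \<longleftrightarrow> (deriv ^^ i) g differentiable (at x)" if "x \<in> X" for i x
    using differentiable_cong_open[OF X _ that, of "(deriv ^^ i) f" "(deriv ^^ i) g"]
      differentiable_cong_open[OF X _ that, of "(deriv ^^ i) g" "(deriv ^^ i) f"] deriv_funpow_cong[where f=f and g=g and k=i, OF X eq] by auto
  moreover have "continuous_on X ((deriv ^^ k) f) \<longleftrightarrow> continuous_on X ((deriv ^^ k) g)"
    by (rule continuous_on_cong) (auto simp: *)
  ultimately show ?thesis by (simp add: Ck_on_def)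
qed

lemma deriv_funpow_Suc: "(deriv ^^ Suc k) u = (deriv ^^ k) (deriv u)"
  by (simp add: funpow_Suc_right del: funpow.simps)

lemma Ck_on_Suc:
  "Ck_on (Suc k) X u \<longleftrightarrow> (\<forall>x\<in>X. u differentiable (at x)) \<and> Ck_on k X (deriv u)"
  unfolding Ck_on_def All_less_Suc2 deriv_funpow_Suc by auto

lemma Ck_on_continuous: "Ck_on k X u \<Longrightarrow> continuous_on X u"
proof (cases k)
  case (Suc j)
  assume "Ck_on k X u"
  then have "\<forall>x\<in>X. u differentiable (at x)" using Suc by (simp add: Ck_on_Suc)
  then show ?thesis
    by (auto intro!: continuous_at_imp_continuous_on differentiable_imp_continuous_within)
qed (simp add: Ck_on_def)

lemma tendsto_boundary_cong:
  fixes f g :: "real \<Rightarrow> real"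
  assumes "\<And>x. x \<in> {0<..<1} \<Longrightarrow> f x = g x"
  shows "(f \<longlongrightarrow> l) (at_right 0) \<longleftrightarrow> (g \<longlongrightarrow> l) (at_right 0)"
    "(f \<longlongrightarrow> l) (at_left 1) \<longleftrightarrow> (g \<longlongrightarrow> l) (at_left 1)"
proof -
  have "eventually (\<lambda>x. f x = g x) (at_right 0)"
    unfolding eventually_at_right_field using assms by (intro exI[of _ 1]) auto
  moreover have "eventually (\<lambda>x. f x = g x) (at_left 1)"
    unfolding eventually_at_left_field using assms by (intro exI[of _ 0]) auto
  ultimately show "(f \<longlongrightarrow> l) (at_right 0) \<longleftrightarrow> (g \<longlongrightarrow> l) (at_right 0)"
    "(f \<longlongrightarrow> l) (at_left 1) \<longleftrightarrow> (g \<longlongrightarrow> l) (at_left 1)"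
    by (simp_all add: tendsto_cong)
qed

lemma boundary_limits:
  fixes U :: "real \<Rightarrow> real"
  assumes "continuous_on {0..1} U"
  shows "(U \<longlongrightarrow> U 0) (at_right 0)" "(U \<longlongrightarrow> U 1) (at_left 1)"
proof -
  have "(U \<longlongrightarrow> U 0) (at 0 within {0..1})" "(U \<longlongrightarrow> U 1) (at 1 within {0..1})"
    using assms by (auto simp: continuous_on_def)
  then show "(U \<longlongrightarrow> U 0) (at_right 0)" "(U \<longlongrightarrow> U 1) (at_left 1)"
    using at_within_Icc_at_right[of "0::real" 1] at_within_Icc_at_left[of "0::real" 1] by simp_all
qed

text \<open>A function known only on the open interval agrees there with an antiderivative of
  \<open>v\<close> anchored at 1/2, and that antiderivative is continuous up to the
  boundary.\<close>

lemma extend_weak_deriv: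
  assumes u: "continuous_on {0<..<1} u" and v: "pwc v" and E: "finite E"
    and d: "\<And>x. x \<in> {0<..<1} - E \<Longrightarrow> (u has_real_derivative v x) (at x)"
  shows "\<exists>U. weak_deriv U v \<and> (\<forall>x\<in>{0<..<1}. U x = u x)"
proof -
  define U where "U = (\<lambda>x. (u (1/2) - prim v (1/2)) + prim v x)"
  have w: "weak_deriv U v"
    using weak_deriv_add[OF weak_deriv_const weak_deriv_prim[OF v]] by (simp add: U_def)
  have ftc: "(v has_integral (u b - u a)) {a..b}" if "0 < a" "a \<le> b" "b < 1" for a b
  proof (rule fundamental_theorem_of_calculus_interior_strong[OF E that(2)])
    show "continuous_on {a..b} u" by (rule continuous_on_subset[OF u]) (use that in auto)
    fix x assume "x \<in> {a<..<b} - E"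
    then show "(u has_vector_derivative v x) (at x)"
      using d[of x] that by (simp add: has_real_derivative_iff_has_vector_derivative)
  qed
  have eq: "u b - u a = prim v b - prim v a" if "0 < a" "a \<le> b" "b < 1" for a b
    using has_integral_unique[OF ftc[OF that] weak_deriv_ftc[OF weak_deriv_prim[OF v]]] that by simp
  have "U x = u x" if "x \<in> {0<..<1}" for x
    using eq[of x "1/2"] eq[of "1/2" x] that by (cases "x \<le> 1/2") (auto simp: U_def)
  then show ?thesis using w by auto
qed

lemma ppoly_deriv:
  assumes "ppoly p m u"
  shows "ppoly (p - 1) m (deriv u)"
  unfolding ppoly_def
proof (intro allI impI)
  fix j assume "j < m"
  then obtain g :: "real poly" where g: "degree g \<le> p"
    "\<And>x. x \<in> elem m j \<Longrightarrow> u x = poly g x"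
    using assms unfolding ppoly_def by blast
  have "deriv u x = poly (pderiv g) x" if x: "x \<in> elem m j" for x
  proof (rule DERIV_imp_deriv, rule has_field_derivative_transform_within_open[OF poly_DERIV _ x])
  qed (use g in auto)
  then show "\<exists>g :: real poly. degree g \<le> p - 1 \<and>
      (\<forall>x\<in>elem m j. deriv u x = poly g x)"
    using g(1) by (intro exI[of _ "pderiv g"]) (auto simp: degree_pderiv)
qed

lemma ppoly_differentiable:
  assumes m: "0 < m" and u: "ppoly p m u" and x: "x \<in> {0<..<1} - grid m"
  shows "(u has_real_derivative deriv u x) (at x)"
proof -
  obtain j where j: "j < m" "x \<in> elem m j"
    using element_cover[OF m x] by auto
  obtain g :: "real poly" where g: "\<And>x. x \<in> elem m j \<Longrightarrow> u x = poly g x"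
    using u j(1) unfolding ppoly_def by blast
  have "(u has_real_derivative poly (pderiv g) x) (at x)"
    by (rule has_field_derivative_transform_within_open[OF poly_DERIV _ j(2)]) (use g in auto)
  then show ?thesis using DERIV_imp_deriv by metis
qed

lemma ppoly_pwc:
  assumes m: "0 < m" and u: "ppoly p m u"
  shows "pwc u"
proof (rule pwc_piecewise[OF m])
  fix j assume "j < m"
  then obtain g :: "real poly" where "\<And>x. x \<in> elem m j \<Longrightarrow> u x = poly g x"
    using u unfolding ppoly_def by blast
  then show "\<exists>g. continuous_on UNIV g \<and> (\<forall>x\<in>elem m j. u x = g x)"
    by (intro exI[of _ "poly g"]) (auto intro: continuous_intros)
qed

lemma element_subset:
  assumes "j < m" "x \<in> elem m j"
  shows "x \<in> {0<..<1}"
  using grid_bounds(1,3)[OF assms(1)] assms(2) unfolding greaterThanLessThan_iff by linarith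

lemma ppoly_cong:
  assumes m: "0 < m" and u: "ppoly p m u" and eq: "\<And>x. x \<in> {0<..<1} \<Longrightarrow> u x = v x"
  shows "ppoly p m v"
  unfolding ppoly_def
proof (intro allI impI)
  fix j assume j: "j < m"
  then obtain g :: "real poly" where g: "degree g \<le> p"
    "\<And>x. x \<in> elem m j \<Longrightarrow> u x = poly g x"
    using u unfolding ppoly_def by blast
  have "v x = poly g x" if "x \<in> elem m j" for x
    using g(2)[OF that] eq[OF element_subset[OF j that]] by simp
  then show "\<exists>g :: real poly. degree g \<le> p \<and>
      (\<forall>x\<in>elem m j. v x = poly g x)"
    using g(1) by blast
qed

lemma poly_antiderivative: "\<exists>G :: real poly. degree G \<le> Suc (degree g) \<and> pderiv G = g"
proof -
  define G where "G = (\<Sum>i\<le>degree g. monom (coeff g i / real (Suc i)) (Suc i))"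
  have "degree G \<le> Suc (degree g)"
    unfolding G_def by (intro degree_sum_le) (auto intro: order_trans[OF degree_monom_le])
  moreover have "pderiv G = (\<Sum>i\<le>degree g. monom (coeff g i) i)"
    by (simp add: G_def pderiv_monom higher_pderiv_sum[of 1, simplified] del: of_nat_Suc)
  then have "pderiv G = g" by (simp add: poly_as_sum_of_monoms)
  ultimately show ?thesis by blast
qed

lemma ppoly_antiderivative:
  assumes m: "0 < m" and v: "ppoly p m v" and d: "\<And>x. x \<in> {0<..<1} \<Longrightarrow> (u has_real_derivative v x) (at x)"
  shows "ppoly (Suc p) m u"
  unfolding ppoly_def
proof (intro allI impI)
  fix j assume j: "j < m"
  let ?X = "(elem m j)"
  obtain g :: "real poly" where g: "degree g \<le> p" "\<And>x. x \<in> ?X \<Longrightarrow> v x = poly g x"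
    using v j unfolding ppoly_def by blast
  obtain G where G: "degree G \<le> Suc (degree g)" "pderiv G = g" using poly_antiderivative by blast
  have "\<exists>c. \<forall>x\<in>?X. u x - poly G x = c"
  proof (rule has_field_derivative_zero_constant)
    fix x assume x: "x \<in> ?X"
    then have "x \<in> {0<..<1}" using element_subset[OF j] by blast
    then have "((\<lambda>x. u x - poly G x) has_real_derivative v x - poly g x) (at x)"
      using d G(2) by (auto intro!: derivative_eq_intros)
    then show "((\<lambda>x. u x - poly G x) has_real_derivative 0) (at x within ?X)"
      using g(2)[OF x] by (auto intro: has_field_derivative_at_within)
  qed auto
  then obtain c where "\<forall>x\<in>?X. u x - poly G x = c" ..
  then have "\<forall>x\<in>?X. u x = poly (G + [:c:]) x" by (auto simp: algebra_simps)
  moreover have "degree (G + [:c:]) \<le> Suc p" using G(1) g(1) by (intro degree_add_le) auto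
  ultimately show "\<exists>g :: real poly. degree g \<le> Suc p \<and> (\<forall>x\<in>?X. u x = poly g x)" by blast
qed

lemma weak_deriv_continuous_deriv:
  assumes U: "weak_deriv U V" and V: "continuous_on {0..1} V" and x: "x \<in> {0<..<1}"
  shows "(U has_real_derivative V x) (at x)"
proof -
  have "((\<lambda>u. integral {0..u} V) has_vector_derivative V x) (at x within {0..1})"
    using x by (intro integral_has_vector_derivative V) auto
  moreover have "at x within {0..1} = at x" using x by (intro at_within_interior) auto
  ultimately have "(prim V has_real_derivative V x) (at x)"
    by (simp add: prim_def[abs_def] has_real_derivative_iff_has_vector_derivative)
  then have "((\<lambda>x. U 0 + prim V x) has_real_derivative V x) (at x)" by (auto intro!: derivative_eq_intros)
  then show ?thesis
    by (rule has_field_derivative_transform_within_open[of _ _ _ "{0<..<1}"])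
      (use x weak_deriv_eq[OF U, symmetric] in auto)
qed

text \<open>Induction through the derivative: it belongs to the class of one degree less with
  \<open>B\<close> shifted, is extended first, and \<open>u\<close> is then extended as its
  antiderivative. Uniqueness of limits turns the one-sided limits into boundary values.\<close>

lemma spline_bc_extend:
  assumes m: "0 < m"
  shows "u \<in> spline_bc (Suc q) m B \<Longrightarrow> \<exists>U\<in>spl m (Suc q) B. \<forall>x\<in>{0<..<1}. U x = u x"
proof (induction q arbitrary: u B)
  case 0
  let ?B = "{k. Suc k \<in> B}"
  have u: "continuous_on {0<..<1} u" "ppoly 1 m u"
    and bc: "0 \<in> B \<Longrightarrow> (u \<longlongrightarrow> 0) (at_right 0) \<and> (u \<longlongrightarrow> 0) (at_left 1)"
    using 0 by (auto simp: spline_bc_def Ck_on_def)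
  have v: "ppoly 0 m (deriv u)" using ppoly_deriv[OF u(2)] by simp
  have vs: "deriv u \<in> spl m 0 ?B"
    unfolding spl.simps mem_Collect_eq
  proof (intro allI impI)
    fix j assume "j < m"
    then obtain g :: "real poly" where g: "degree g \<le> 0"
      "\<forall>x\<in>elem m j. deriv u x = poly g x"
      using v unfolding ppoly_def by blast
    obtain c where "g = [:c:]" using degree_eq_zeroE[of g] g(1) by auto
    then show "\<exists>c. \<forall>x\<in>elem m j. deriv u x = c"
      using g(2) by auto
  qed
  obtain U where U: "weak_deriv U (deriv u)" "\<forall>x\<in>{0<..<1}. U x = u x"
    using extend_weak_deriv[OF u(1) ppoly_pwc[OF m v] finite_grid ppoly_differentiable[OF m u(2)]] by blast
  have "U 0 = 0 \<and> U 1 = 0" if "0 \<in> B"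
    using boundary_limits[of U] bc[OF that] U tendsto_boundary_cong[of U u]
    by (auto simp: weak_deriv_def intro: tendsto_unique[OF trivial_limit_at_right_real]
        tendsto_unique[OF trivial_limit_at_left_real])
  then show ?case using U vs by (intro bexI[of _ U]) auto
next
  case (Suc q)
  let ?B = "{k. Suc k \<in> B}"
  have ck: "Ck_on (Suc q) {0<..<1} u" using Suc.prems by (simp add: spline_bc_def)
  then have u: "\<And>x. x \<in> {0<..<1} \<Longrightarrow> u differentiable (at x)" "Ck_on q {0<..<1} (deriv u)"
      "ppoly (Suc (Suc q)) m u" "continuous_on {0<..<1} u"
    using Suc.prems Ck_on_continuous[OF ck] by (auto simp: spline_bc_def Ck_on_Suc)
  have bc: "\<And>k. k \<in> B \<Longrightarrow> k < Suc (Suc q) \<Longrightarrow>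
        ((deriv ^^ k) u \<longlongrightarrow> 0) (at_right 0) \<and> ((deriv ^^ k) u \<longlongrightarrow> 0) (at_left 1)"
    using Suc.prems unfolding spline_bc_def by blast
  \<comment> \<open>Membership in \<open>spline_bc\<close> requires the value zero outside the open
    interval, where \<open>deriv u\<close> need not vanish.\<close>
  define v where "v = restr (deriv u)"
  have v: "\<And>x. x \<in> {0<..<1} \<Longrightarrow> deriv u x = v x" by (simp add: v_def restr_def)
  have "Ck_on q {0<..<1} v" using u(2) Ck_on_cong[of "{0<..<1}" "deriv u" v q] v by auto
  moreover have "ppoly (Suc q) m v" using ppoly_cong[OF m ppoly_deriv[OF u(3)] v] by simp
  moreover have "((deriv ^^ k) v \<longlongrightarrow> 0) (at_right 0) \<and> ((deriv ^^ k) v \<longlongrightarrow> 0) (at_left 1)"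
    if "k \<in> ?B" "k < Suc q" for k
  proof -
    have "(deriv ^^ k) (deriv u) x = (deriv ^^ k) v x" if "x \<in> {0<..<1}" for x
      by (rule deriv_funpow_cong[OF _ v that]) auto
    from tendsto_boundary_cong[of "(deriv ^^ k) (deriv u)" "(deriv ^^ k) v", OF this]
    show ?thesis using bc[of "Suc k", unfolded deriv_funpow_Suc] that by simp
  qed
  moreover have "\<forall>x. x \<notin> {0<..<1} \<longrightarrow> v x = 0" by (simp add: v_def restr_def)
  ultimately have "v \<in> spline_bc (Suc q) m ?B" by (simp add: spline_bc_def del: greaterThanLessThan_iff)
  from Suc.IH[OF this] obtain V where V: "V \<in> spl m (Suc q) ?B" "\<forall>x\<in>{0<..<1}. V x = v x" by auto
  have "(u has_real_derivative V x) (at x)" if "x \<in> {0<..<1} - {}" for x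
  proof -
    have "(u has_real_derivative deriv u x) (at x)"
      using u(1)[of x] that by (simp add: DERIV_deriv_iff_real_differentiable)
    then show ?thesis using V(2) v that by auto
  qed
  then obtain U where U: "weak_deriv U V" "\<forall>x\<in>{0<..<1}. U x = u x"
    using extend_weak_deriv[OF u(4) spl_pwc[OF m V(1)]] by blast
  have "U 0 = 0 \<and> U 1 = 0" if "0 \<in> B"
    using boundary_limits[of U] bc[OF that] U tendsto_boundary_cong[of U u]
    by (auto simp: weak_deriv_def intro: tendsto_unique[OF trivial_limit_at_right_real]
        tendsto_unique[OF trivial_limit_at_left_real])
  then show ?case using U V by (intro bexI[of _ U]) auto
qed

text \<open>From degree two on the weak derivative is continuous and hence a classical derivative at
  every interior point, grid points included; this recovers the smoothness order
  \<open>p - 1\<close>.\<close>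

lemma restr_spl:
  assumes m: "0 < m"
  shows "U \<in> spl m (Suc q) B \<Longrightarrow> restr U \<in> spline_bc (Suc q) m B"
proof (induction q arbitrary: U B)
  case 0
  then obtain V where V: "V \<in> spl m 0 {k. Suc k \<in> B}" "weak_deriv U V" "0 \<in> B \<longrightarrow> U 0 = 0 \<and> U 1 = 0"
    by auto
  have U: "continuous_on {0..1} U" using V(2) by (simp add: weak_deriv_def)
  have r: "\<And>x. x \<in> {0<..<1} \<Longrightarrow> U x = restr U x" by (simp add: restr_def)
  have "continuous_on {0<..<1} U" by (rule continuous_on_subset[OF U]) auto
  then have "continuous_on {0<..<1} (restr U)" using r continuous_on_cong by metis
  moreover have "ppoly 1 m U" unfolding ppoly_def
  proof (intro allI impI)
    fix j assume j: "j < m"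
    let ?a = "real j / real m" and ?b = "real (Suc j) / real m"
    obtain c where c: "\<And>x. x \<in> {?a<..<?b} \<Longrightarrow> V x = c" using V(1) j by auto
    have "U x = poly [:U ?a - c * ?a, c:] x" if "x \<in> {?a<..<?b}" for x
      using affine_on_element[OF grid_bounds(1-3)[OF j] V(2) c, of x] that by (simp add: mult.commute)
    then show "\<exists>g :: real poly. degree g \<le> 1 \<and> (\<forall>x\<in>{?a<..<?b}. U x = poly g x)"
      by (intro exI[of _ "[:U ?a - c * ?a, c:]"]) auto
  qed
  then have "ppoly 1 m (restr U)" using ppoly_cong[of m 1 U "restr U", OF m _ r] by simp
  moreover have "(restr U \<longlongrightarrow> 0) (at_right 0) \<and> (restr U \<longlongrightarrow> 0) (at_left 1)" if "0 \<in> B"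
    using boundary_limits[OF U] V(3) that tendsto_boundary_cong[of U "restr U"] r by simp
  moreover have "\<forall>x. x \<notin> {0<..<1} \<longrightarrow> restr U x = 0" by (simp add: restr_def)
  ultimately show ?case by (auto simp: spline_bc_def Ck_on_def simp del: greaterThanLessThan_iff)
next
  case (Suc q)
  let ?B = "{k. Suc k \<in> B}"
  obtain V where V: "V \<in> spl m (Suc q) ?B" "weak_deriv U V" "0 \<in> B \<longrightarrow> U 0 = 0 \<and> U 1 = 0"
    using Suc.prems by auto
  have U: "continuous_on {0..1} U" using V(2) by (simp add: weak_deriv_def)
  have cV: "continuous_on {0..1} V" using V(1) by (auto simp: weak_deriv_def)
  have r: "\<And>x. x \<in> {0<..<1} \<Longrightarrow> U x = restr U x" by (simp add: restr_def)
  have v: "restr V \<in> spline_bc (Suc q) m ?B" by (rule Suc.IH[OF V(1)])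
  have d: "(restr U has_real_derivative restr V x) (at x)" if x: "x \<in> {0<..<1}" for x
  proof (rule has_field_derivative_transform_within_open[of U _ _ "{0<..<1}"])
    show "(U has_real_derivative restr V x) (at x)"
      using weak_deriv_continuous_deriv[OF V(2) cV x] x by (simp add: restr_def)
  qed (use x r in auto)
  then have dU: "deriv (restr U) x = restr V x" if "x \<in> {0<..<1}" for x
    using DERIV_imp_deriv that by blast
  have "restr U differentiable (at x)" if "x \<in> {0<..<1}" for x
    using d[OF that] by (auto simp: real_differentiable_def)
  moreover have "Ck_on q {0<..<1} (deriv (restr U))"
    using v Ck_on_cong[of "{0<..<1}" "deriv (restr U)" "restr V" q, OF _ dU]
    by (simp add: spline_bc_def)
  ultimately have "Ck_on (Suc q) {0<..<1} (restr U)" by (simp add: Ck_on_Suc)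
  moreover have "ppoly (Suc (Suc q)) m (restr U)"
    using v by (intro ppoly_antiderivative[OF m _ d]) (simp_all add: spline_bc_def)
  moreover have "((deriv ^^ k) (restr U) \<longlongrightarrow> 0) (at_right 0) \<and> ((deriv ^^ k) (restr U) \<longlongrightarrow> 0) (at_left 1)"
    if k: "k \<in> B" "k < Suc (Suc q)" for k
  proof (cases k)
    case 0
    then show ?thesis using boundary_limits[OF U] V(3) k tendsto_boundary_cong[of U "restr U"] r by simp
  next
    case (Suc i)
    then have "((deriv ^^ i) (restr V) \<longlongrightarrow> 0) (at_right 0) \<and> ((deriv ^^ i) (restr V) \<longlongrightarrow> 0) (at_left 1)"
      using v k by (auto simp: spline_bc_def)
    moreover have "(deriv ^^ i) (deriv (restr U)) x = (deriv ^^ i) (restr V) x" if "x \<in> {0<..<1}" for x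
      by (rule deriv_funpow_cong[OF _ dU that]) auto
    note tendsto_boundary_cong[of "(deriv ^^ i) (deriv (restr U))" "(deriv ^^ i) (restr V)", OF this]
    ultimately show ?thesis unfolding Suc deriv_funpow_Suc by simp
  qed
  moreover have "\<forall>x. x \<notin> {0<..<1} \<longrightarrow> restr U x = 0" by (simp add: restr_def)
  ultimately show ?case by (simp add: spline_bc_def del: greaterThanLessThan_iff)
qed

lemma spline_bc_eq:
  assumes "0 < m" "0 < p"
  shows "spline_bc p m B = restr ` spl m p B"
proof -
  obtain q where q: "p = Suc q" using assms(2) gr0_conv_Suc by auto
  have "u \<in> restr ` spl m p B" if u: "u \<in> spline_bc p m B" for u
  proof -
    obtain U where U: "U \<in> spl m p B" "\<forall>x\<in>{0<..<1}. U x = u x" using spline_bc_extend assms u q by blast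
    moreover have "u = restr U" using U u by (auto simp: fun_eq_iff restr_def spline_bc_def)
    ultimately show ?thesis by blast
  qed
  then show ?thesis using restr_spl[OF assms(1), of _ q B] q by (auto simp del: spl.simps)
qed

section \<open>Mass and stiffness forms on spline spaces\<close>

text \<open>The zero extension of a spline may jump at 0 and 1 and then satisfies no
  \<open>weak_deriv\<close>; its continuous extension \<open>U\<close> does.\<close>

definition has_wd :: "(real \<Rightarrow> real) \<Rightarrow> (real \<Rightarrow> real) \<Rightarrow> bool" where
  "has_wd u g \<longleftrightarrow> (\<exists>U. weak_deriv U g \<and> (\<forall>x\<in>{0<..<1}. U x = u x))"

lemma pwc_spike:
  assumes f: "pwc f" and E: "finite E" and eq: "\<And>x. x \<in> {0<..<1} - E \<Longrightarrow> g x = f x"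
  shows "pwc g"
proof -
  obtain F where F: "finite F" "continuous_on ({0<..<1} - F) f" using f by (auto simp: pwc_def)
  have "continuous_on ({0<..<1} - (E \<union> F)) f" using F(2) by (rule continuous_on_subset) auto
  then have "continuous_on ({0<..<1} - (E \<union> F)) g" by (rule continuous_on_eq) (auto simp: eq)
  moreover have "bounded (f ` {0<..<1} \<union> g ` E)" using f E by (auto simp: pwc_def finite_imp_bounded)
  then have "bounded (g ` {0<..<1})" by (rule bounded_subset) (use eq in \<open>blast\<close>)
  ultimately show ?thesis using E F unfolding pwc_def by blast
qed

lemma l2_spike:
  assumes E: "finite E" and eq: "\<And>x. x \<in> {0<..<1} - E \<Longrightarrow> f x * h x = g x * k x"
  shows "l2_inner f h = l2_inner g k"
  unfolding l2_inner_def set_lebesgue_integral_def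
  by (rule integral_discrete_difference[of E])
    (use E eq in \<open>auto simp: indicator_def intro: countable_finite\<close>)

lemma has_wd_deriv:
  assumes "has_wd u g"
  shows "\<exists>E. finite E \<and> (\<forall>x\<in>{0<..<1} - E. deriv u x = g x)"
proof -
  obtain U where U: "weak_deriv U g" "\<And>x. x \<in> {0<..<1} \<Longrightarrow> U x = u x" using assms by (auto simp: has_wd_def)
  obtain E where E: "finite E" "\<And>x. x \<in> {0<..<1} - E \<Longrightarrow> (U has_real_derivative g x) (at x)"
    using U(1) by (auto simp: weak_deriv_def)
  have "deriv u x = g x" if x: "x \<in> {0<..<1} - E" for x
    by (rule DERIV_imp_deriv, rule has_field_derivative_transform_within_open[OF E(2)[OF x], of "{0<..<1}"])
      (use x U(2) in auto)
  then show ?thesis using E(1) by blast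
qed

lemma stiff_eq:
  assumes "has_wd u g" "has_wd v k"
  shows "stiff_op u v = l2_inner g k"
proof -
  obtain E F where "finite E" "\<And>x. x \<in> {0<..<1} - E \<Longrightarrow> deriv u x = g x"
    "finite F" "\<And>x. x \<in> {0<..<1} - F \<Longrightarrow> deriv v x = k x" using assms[THEN has_wd_deriv] by blast
  then show ?thesis unfolding stiff_op_def l2_inner_def[symmetric] by (intro l2_spike[of "E \<union> F"]) auto
qed

lemma has_wd_add: "has_wd u g \<Longrightarrow> has_wd v k \<Longrightarrow> has_wd (u + v) (g + k)"
  unfolding has_wd_def plus_fun_def by (elim exE conjE, intro exI conjI, erule (1) weak_deriv_add) simp

lemma has_wd_scale: "has_wd u g \<Longrightarrow> has_wd (c *\<^sub>R u) (c *\<^sub>R g)"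
  unfolding has_wd_def scaleR_fun_def real_scaleR_def
  by (elim exE conjE, intro exI conjI, erule weak_deriv_scale) simp

lemma has_wd_pwc:
  assumes "has_wd u g" shows "pwc u" "pwc g"
proof -
  obtain U where U: "weak_deriv U g" "\<And>x. x \<in> {0<..<1} \<Longrightarrow> U x = u x" using assms by (auto simp: has_wd_def)
  show "pwc g" "pwc u" using weak_deriv_pwc[OF U(1)] pwc_spike[of U "{}" u] U(2) by auto
qed

lemma restr_has_wd: "weak_deriv U g \<Longrightarrow> has_wd (restr U) g"
  unfolding has_wd_def by (intro exI[of _ U]) (simp add: restr_def)

lemma stiff_psform: "psform {u. \<exists>g. has_wd u g} stiff_op"
proof unfold_locales
  show "subspace {u. \<exists>g. has_wd u g}"
    unfolding subspace_def mem_Collect_eq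
  proof (intro conjI ballI allI)
    show "\<exists>g. has_wd 0 g" using weak_deriv_const[of 0] unfolding has_wd_def zero_fun_def by blast
  qed (auto intro: has_wd_add has_wd_scale)
next
  fix u v w assume "u \<in> {u. \<exists>g. has_wd u g}" "v \<in> {u. \<exists>g. has_wd u g}" "w \<in> {u. \<exists>g. has_wd u g}"
  then obtain g k l where d: "has_wd u g" "has_wd v k" "has_wd w l" by auto
  have "l2_inner (g + k) l = l2_inner g l + l2_inner k l"
    using has_wd_pwc d by (intro l2.add_left) auto
  then show "stiff_op (u + v) w = stiff_op u w + stiff_op v w"
    using stiff_eq[OF has_wd_add[OF d(1,2)] d(3)] stiff_eq[OF d(1,3)] stiff_eq[OF d(2,3)] by simp
next
  fix u v c assume "u \<in> {u. \<exists>g. has_wd u g}" "v \<in> {u. \<exists>g. has_wd u g}"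
  then obtain g k where d: "has_wd u g" "has_wd v k" by auto
  have "l2_inner (c *\<^sub>R g) k = c * l2_inner g k"
    using has_wd_pwc d by (intro l2.scale_left) auto
  then show "stiff_op (c *\<^sub>R u) v = c * stiff_op u v"
    using stiff_eq[OF has_wd_scale[OF d(1)] d(2)] stiff_eq[OF d] by simp
next
  fix u v
  show "stiff_op u v = stiff_op v u" by (simp add: stiff_op_def mult.commute)
next
  fix u assume "u \<in> {u. \<exists>g. has_wd u g}"
  then obtain g where d: "has_wd u g" by auto
  show "0 \<le> stiff_op u u" using stiff_eq[OF d d] l2.nonneg[of g] has_wd_pwc(2)[OF d] by simp
qed

lemma restr_add: "restr u + restr v = restr (u + v)"
  and restr_scale: "c *\<^sub>R restr u = restr (c *\<^sub>R u)"
  and restr_zero: "restr 0 = 0"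
  by (auto simp: restr_def fun_eq_iff)

lemma restr_subspace: "subspace V \<Longrightarrow> subspace (restr ` V)"
  unfolding subspace_def
  by (intro conjI) (metis restr_zero image_eqI, auto simp: restr_add restr_scale)

lemma l2_restr: "l2_inner (restr u) (restr v) = l2_inner u v"
  by (rule l2_cong) (auto simp: restr_def)

context
  fixes p m :: nat
  assumes p: "0 < p" and m: "0 < m"
begin

lemma spline_space_restr: "spline_space p m = restr ` spl m p {}"
  using spline_bc_eq[OF m p] by (simp add: spline_space_eq)

lemma spline_space0_restr: "spline_space0 p m = restr ` bspl m p True"
  using spline_bc_eq[OF m p] by (simp add: spline_space0_eq bspl_eq_spl)

lemma spline_subspace: "subspace (spline_space p m)" and spline_subspace0: "subspace (spline_space0 p m)"
  unfolding spline_space_restr spline_space0_restr bspl_eq_spl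
  by (intro restr_subspace spl_subspace)+

lemma spline_has_wd:
  assumes "u \<in> spline_space p m"
  shows "\<exists>g. has_wd u g"
proof -
  obtain U where U: "U \<in> spl m p {}" "u = restr U" using assms spline_space_restr by auto
  then obtain V where "weak_deriv U V" using p by (cases p) auto
  then show ?thesis using restr_has_wd U by auto
qed

lemma spline_stiff_psform: "psform (spline_space p m) stiff_op"
  using spline_has_wd by (intro psform.restrict_psd[OF stiff_psform] spline_subspace) auto

lemma spline_pwc: "u \<in> spline_space p m \<Longrightarrow> pwc u"
  using spline_has_wd has_wd_pwc by blast

lemma has_wd_definite:
  assumes "has_wd u g" "l2_inner u u = 0" "x \<in> {0<..<1}"
  shows "u x = 0"
proof -
  obtain U where U: "weak_deriv U g" "\<And>x. x \<in> {0<..<1} \<Longrightarrow> U x = u x" using assms by (auto simp: has_wd_def)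
  have c: "continuous_on {0..1} U" using U(1) by (simp add: weak_deriv_def)
  have "l2_inner U U = 0" using l2_cong[of U u U u] U(2) assms(2) by simp
  then have "integral {0..1} (\<lambda>x. U x * U x) = 0" using weak_deriv_pwc[OF U(1)] by (simp add: l2_eq)
  then have "\<forall>x\<in>{0..1}. U x * U x = 0"
    using c by (subst (asm) integral_eq_0_iff) (auto intro: continuous_on_mult)
  then show ?thesis using U(2)[OF assms(3)] assms(3) by force
qed

lemma spline_outside: "u \<in> spline_space p m \<Longrightarrow> x \<notin> {0<..<1} \<Longrightarrow> u x = 0"
  by (auto simp: spline_space_def)

lemma spline_mass_pdform: "pdform (spline_space p m) l2_inner"
proof (intro pdform.intro psform.restrict_psd[OF l2_psform] spline_subspace)
  show "spline_space p m \<subseteq> {f. pwc f}" using spline_pwc by auto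
  show "pdform_axioms (spline_space p m) l2_inner"
  proof
    fix u assume u: "u \<in> spline_space p m" "l2_inner u u = 0"
    obtain g where g: "has_wd u g" using spline_has_wd[OF u(1)] by auto
    show "u = 0"
    proof
      fix x show "u x = 0 x"
        using has_wd_definite[OF g u(2), of x] spline_outside[OF u(1), of x] by (cases "x \<in> {0<..<1}") auto
    qed
  qed
qed

lemma spline_fin_det: "fin_det (spline_space p m)"
proof -
  \<comment> \<open>A polynomial of degree at most \<open>p\<close> is determined by these
    \<open>p + 1\<close> interior points of its element; the grid points in \<open>X\<close> settle
    the element boundaries.\<close>
  define pt where "pt j k = (real j + (real k + 1) / (real p + 2)) / real m" for j k :: nat
  define X where "X = grid m \<union> (\<lambda>(j, k). pt j k) ` ({..<m} \<times> {..p})"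
  have "u = 0" if u: "u \<in> spline_space p m" and z: "\<And>x. x \<in> X \<Longrightarrow> u x = 0" for u
  proof
    fix x
    show "u x = 0 x"
    proof (cases "x \<in> {0<..<1} - grid m")
      case False
      then show ?thesis using z[of x] spline_outside[OF u, of x] by (auto simp: X_def)
    next
      case True
      obtain j where j: "j < m" "x \<in> elem m j"
        using element_cover[OF m True] by auto
      have "ppoly p m u" using u by (auto simp: spline_space_eq spline_bc_def)
      then obtain g :: "real poly" where g: "degree g \<le> p"
        "\<And>x. x \<in> elem m j \<Longrightarrow> u x = poly g x"
        using j(1) unfolding ppoly_def by blast
      have "g = 0"
      proof (rule poly_eqI_degree[of "pt j ` {..p}"])
        have "inj_on (pt j) {..p}" using m by (auto simp: inj_on_def pt_def)
        then have "card (pt j ` {..p}) = Suc p" by (simp add: card_image)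
        then show "degree g < card (pt j ` {..p})" "degree 0 < card (pt j ` {..p})" using g(1) by auto
        fix y assume "y \<in> pt j ` {..p}"
        then obtain k where k: "k \<le> p" "y = pt j k" by auto
        have f: "0 < (real k + 1) / (real p + 2)" "(real k + 1) / (real p + 2) < 1" using k(1) by auto
        have "y \<in> elem m j"
          using m f by (simp add: k(2) pt_def divide_strict_right_mono)
        moreover have "y \<in> X" using k j(1) by (auto simp: X_def)
        ultimately show "poly g y = poly 0 y" using g(2)[of y] z[of y] by simp
      qed
      then show ?thesis using g(2)[OF j(2)] by simp
    qed
  qed
  then show ?thesis unfolding fin_det_def
    by (intro exI[of _ "(\<lambda>x u. u x) ` X"]) (auto simp: X_def lin_on_def)
qed

lemma spline0_inverse_inequality:
  assumes u: "u \<in> spline_space0 p m"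
  shows "stiff_op u u \<le> 12 * (real m)\<^sup>2 * l2_inner u u"
proof -
  obtain q where q: "p = Suc q" using p gr0_conv_Suc by auto
  obtain U where U: "U \<in> bspl m (Suc q) True" "u = restr U" using u spline_space0_restr q by auto
  then obtain V where V: "V \<in> bspl m q (\<not> True)" "weak_deriv U V" by auto
  have w: "has_wd u V" using restr_has_wd[OF V(2)] U by simp
  show ?thesis
    using bspl_inverse_inequality[OF m U(1) V] stiff_eq[OF w w] by (simp add: U l2_restr)
qed

lemma one_spline0: "restr (\<lambda>_. c) \<in> spline_space0 p m"
  unfolding spline_space0_restr by (intro imageI bspl_const)

text \<open>The stiffness form annihilates constants. The squared mean restores definiteness, by
  Poincare's inequality with the whole interval as a single element.\<close>

lemma mean_form_pdform:
  "pdform (spline_space p m) (\<lambda>u v. stiff_op u v + l2_inner u (\<lambda>_. 1) * l2_inner v (\<lambda>_. 1))"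
proof -
  let ?S = "spline_space p m"
  interpret K: psform ?S stiff_op by (rule spline_stiff_psform)
  interpret M: pdform ?S l2_inner by (rule spline_mass_pdform)
  note lin = l2.add_left[of _ _ "\<lambda>_. 1"] l2.scale_left[of _ "\<lambda>_. 1"]
  show ?thesis
  proof unfold_locales
    fix u v w assume "u \<in> ?S" "v \<in> ?S" "w \<in> ?S"
    then show "stiff_op (u + v) w + l2_inner (u + v) (\<lambda>_. 1) * l2_inner w (\<lambda>_. 1) =
      stiff_op u w + l2_inner u (\<lambda>_. 1) * l2_inner w (\<lambda>_. 1) +
      (stiff_op v w + l2_inner v (\<lambda>_. 1) * l2_inner w (\<lambda>_. 1))"
      using spline_pwc by (simp add: lin K.add_left algebra_simps)
  next
    fix u w c assume "u \<in> ?S" "w \<in> ?S"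
    then show "stiff_op (c *\<^sub>R u) w + l2_inner (c *\<^sub>R u) (\<lambda>_. 1) * l2_inner w (\<lambda>_. 1) =
      c * (stiff_op u w + l2_inner u (\<lambda>_. 1) * l2_inner w (\<lambda>_. 1))"
      using spline_pwc by (simp add: lin K.scale_left algebra_simps)
  next
    fix u v assume "u \<in> ?S" "v \<in> ?S"
    then show "stiff_op u v + l2_inner u (\<lambda>_. 1) * l2_inner v (\<lambda>_. 1) =
      stiff_op v u + l2_inner v (\<lambda>_. 1) * l2_inner u (\<lambda>_. 1)" using K.sym by simp
  next
    fix u assume u: "u \<in> ?S"
    then show "0 \<le> stiff_op u u + l2_inner u (\<lambda>_. 1) * l2_inner u (\<lambda>_. 1)" using K.nonneg by simp
    assume 0: "stiff_op u u + l2_inner u (\<lambda>_. 1) * l2_inner u (\<lambda>_. 1) = 0"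
    then have k: "stiff_op u u = 0" and i: "l2_inner u (\<lambda>_. 1) = 0"
      using K.nonneg[OF u] zero_le_square[of "l2_inner u (\<lambda>_. 1)"] by (smt (verit) mult_eq_0_iff)+
    obtain g where g: "has_wd u g" using spline_has_wd[OF u] by auto
    obtain U where U: "weak_deriv U g" "\<And>x. x \<in> {0<..<1} \<Longrightarrow> U x = u x" using g by (auto simp: has_wd_def)
    have "l2_inner U (\<lambda>_. 1) = l2_inner u (\<lambda>_. 1)" by (rule l2_cong) (use U in auto)
    then have "integral {0..1} U = 0" using i l2_one[of U] weak_deriv_pwc[OF U(1)] by simp
    then have "l2_inner U U \<le> l2_inner g g"
      using poincare_mean_zero[of 1, OF _ U(1)] by simp
    then have "l2_inner u u \<le> 0" using k stiff_eq[OF g g] l2_cong[of U u U u] U(2) by simp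
    then show "u = 0" using M.definite[OF u] M.nonneg[OF u] by simp
  qed (rule spline_subspace)
qed

end

lemma spline_space_refine:
  assumes "0 < p" "0 < n" "0 < m" "n dvd m"
  shows "spline_space p n \<subseteq> spline_space p m" "spline_space0 p n \<subseteq> spline_space p n"
proof -
  obtain r where r: "m = r * n" "0 < r" using assms by (auto elim!: dvdE simp: mult.commute)
  show "spline_space p n \<subseteq> spline_space p m"
    using spl_refine[OF \<open>0 < n\<close> r(2)] assms r by (auto simp: spline_space_restr)
  show "spline_space0 p n \<subseteq> spline_space p n" by (auto simp: spline_space0_def)
qed

text \<open>The Ritz projection with respect to \<open>K + mean * mean\<close>: constants belong to the space, so the error
  has mean zero and is \<open>K\<close>-orthogonal.\<close>

lemma spline_ritz:
  assumes p: "0 < p" and n: "0 < n" and m: "0 < m" and dvd: "n dvd m" and u: "u \<in> spline_space p m"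
  shows "\<exists>z\<in>spline_space0 p n. (\<forall>v\<in>spline_space0 p n. stiff_op (u - z) v = 0) \<and>
    l2_inner (u - z) (u - z) \<le> (1 / real n)\<^sup>2 * stiff_op (u - z) (u - z)"
proof -
  let ?S = "spline_space p m" and ?N = "spline_space0 p n"
  let ?k = "\<lambda>u v. stiff_op u v + l2_inner u (\<lambda>_. 1) * l2_inner v (\<lambda>_. 1)"
  have NS: "?N \<subseteq> ?S" using spline_space_refine[OF p n m dvd] by auto
  interpret k: pdform ?S ?k by (rule mean_form_pdform[OF p m])
  interpret o: oprojection ?S ?k ?N
    by unfold_locales (use NS spline_subspace0[OF p n] spline_fin_det[OF p m] in auto)
  define z where "z = oproj ?k ?N u"
  have zN: "z \<in> ?N" unfolding z_def by (rule o.oproj_in[OF u])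
  have zS: "z \<in> ?S" using zN NS by auto
  have orth: "?k (u - z) v = 0" if "v \<in> ?N" for v
    unfolding z_def by (rule o.oproj_orth[OF u that])
  have eS: "u - z \<in> ?S" using u zS by simp
  obtain g where g: "has_wd (u - z) g" using spline_has_wd[OF p m eS] by auto
  obtain e where e: "weak_deriv e g" "\<And>x. x \<in> {0<..<1} \<Longrightarrow> e x = (u - z) x" using g by (auto simp: has_wd_def)
  have wd1: "has_wd (restr (\<lambda>_. 1)) (\<lambda>_. 0)" by (intro restr_has_wd weak_deriv_const)
  have "stiff_op (u - z) (restr (\<lambda>_. 1)) = 0"
    using stiff_eq[OF g wd1] by (simp add: l2_inner_def)
  moreover have "l2_inner (restr (\<lambda>_. 1)) (\<lambda>_. 1) = 1"
    using l2_cong[of "restr (\<lambda>_. 1)" "\<lambda>_. 1" "\<lambda>_. 1" "\<lambda>_. 1"] by (simp add: l2_one restr_def)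
  ultimately have mean: "l2_inner (u - z) (\<lambda>_. 1) = 0" using orth[OF one_spline0[OF p n, of 1]] by simp
  have "l2_inner e (\<lambda>_. 1) = l2_inner (u - z) (\<lambda>_. 1)" by (rule l2_cong) (use e in auto)
  then have ie: "integral {0..1} e = 0" using mean l2_one weak_deriv_pwc[OF e(1)] by simp
  have K: "stiff_op (u - z) v = 0" if "v \<in> ?N" for v using orth[OF that] mean by simp
  obtain q where q: "p = Suc q" using p gr0_conv_Suc by auto
  \<comment> \<open>Every such \<open>y\<close> is the derivative of a function in
    \<open>?N\<close>, so stiffness-orthogonality of the error is mass-orthogonality of its
    derivative \<open>g\<close> to this space.\<close>
  have "l2_inner g y = 0" if y: "y \<in> bspl n q False" for y
  proof -
    have "restr (prim y) \<in> ?N"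
      using prim_bspl_True[OF n y] spline_space0_restr[OF p n] q by blast
    moreover have "has_wd (restr (prim y)) y"
      by (intro restr_has_wd weak_deriv_prim bspl_pwc[OF n y])
    ultimately show ?thesis using K stiff_eq[OF g] by metis
  qed
  from ritz_error[OF n e(1) ie this]
  have "l2_inner (u - z) (u - z) \<le> (1 / real n)\<^sup>2 * stiff_op (u - z) (u - z)"
    using stiff_eq[OF g g] l2_cong[of e "u - z" e "u - z"] e(2) by simp
  then show ?thesis using zN K by blast
qed

section \<open>The mass projection onto boundary-adapted splines\<close>

text \<open>\<open>n\<close> is the number of elements. The locale is instantiated for the fine
  mesh, where it controls the smoother, and for the mesh of twice the size, where it controls the
  coarse approximant.\<close>

locale ritz_space = oprojection S M N + K: psform S K
  for S :: "'v::real_vector set" and M N K +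
  fixes n :: real
  assumes n: "0 < n"
    and inverse: "u \<in> N \<Longrightarrow> K u u \<le> 12 * n\<^sup>2 * M u u"
    and ritz: "u \<in> S \<Longrightarrow> \<exists>z\<in>N. (\<forall>v\<in>N. K (u - z) v = 0) \<and> M (u - z) (u - z) \<le> (1 / n)\<^sup>2 * K (u - z) (u - z)"
begin

abbreviation "Q \<equiv> oproj M N"

text \<open>The projection is compared with the Ritz approximant \<open>z\<close>, which
  \<open>Q\<close> reproduces, so that \<open>Q u = z + Q e\<close>. The inverse inequality is
  applied only to \<open>Q e\<close>, where the powers of \<open>n\<close> cancel and leave 12;
  hence 26 = 2 + 2 * 12. In the last bound \<open>d\<close> is the discrete Laplacian of
  \<open>u\<close>, and one more order comes from \<open>K e e = M d e\<close>.\<close>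

lemma proj_bounds:
  assumes u: "u \<in> S"
  shows "M (u - Q u) (u - Q u) \<le> (1 / n)\<^sup>2 * K u u"
    and "K (Q u) (Q u) \<le> 26 * K u u"
    and "K (u - Q u) (u - Q u) \<le> 26 * K u u"
    and "d \<in> S \<Longrightarrow> (\<And>v. v \<in> S \<Longrightarrow> M d v = K u v) \<Longrightarrow> K (u - Q u) (u - Q u) \<le> 26 * (1 / n)\<^sup>2 * M d d"
proof -
  obtain z where z: "z \<in> N" "\<And>v. v \<in> N \<Longrightarrow> K (u - z) v = 0"
    and err: "M (u - z) (u - z) \<le> (1 / n)\<^sup>2 * K (u - z) (u - z)" using ritz[OF u] by blast
  define e where "e = u - z"
  have zS: "z \<in> S" using z WV by auto
  have eS: "e \<in> S" using u zS by (simp add: e_def)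
  have ez: "K e z = 0" using z by (simp add: e_def)
  have u_eq: "u = z + e" by (simp add: e_def)
  have Kuu: "K u u = K z z + K e e"
    unfolding u_eq using zS eS ez by (simp add: K.square_add K.sym[of z e])
  have Kz: "K z z \<le> K u u" and Ke: "K e e \<le> K u u" using Kuu K.nonneg[OF zS] K.nonneg[OF eS] by auto
  have Qe: "Q e = Q u - z"
    unfolding e_def using lin_on_diff[OF oproj_lin sub u zS] oproj_id[OF z(1)] by simp
  have err': "M e e \<le> (1 / n)\<^sup>2 * K e e" using err by (simp add: e_def)
  have QeS: "Q e \<in> S" using eS by simp
  have "K (Q e) (Q e) \<le> 12 * n\<^sup>2 * M (Q e) (Q e)" by (rule inverse[OF oproj_in[OF eS]])
  also have "\<dots> \<le> 12 * n\<^sup>2 * ((1 / n)\<^sup>2 * K e e)"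
    using oproj_le[OF eS] err' by (intro mult_left_mono) auto
  also have "\<dots> = 12 * K e e" using n by (simp add: power_divide)
  finally have KQe: "K (Q e) (Q e) \<le> 12 * K e e" .
  have "M (u - Q u) (u - Q u) \<le> M e e" using oproj_best[OF u z(1)] by (simp add: e_def)
  also have "\<dots> \<le> (1 / n)\<^sup>2 * K e e" by (rule err')
  also have "\<dots> \<le> (1 / n)\<^sup>2 * K u u" using Ke by (intro mult_left_mono) auto
  finally show "M (u - Q u) (u - Q u) \<le> (1 / n)\<^sup>2 * K u u" .
  have "Q u = z + Q e" using Qe by simp
  then have "K (Q u) (Q u) \<le> 2 * K z z + 2 * K (Q e) (Q e)" using K.square_add_le[OF zS QeS] by simp
  then show "K (Q u) (Q u) \<le> 26 * K u u" using KQe Kz Ke by linarith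
  have "u - Q u = e + - 1 *\<^sub>R Q e" using Qe by (simp add: e_def)
  then have "K (u - Q u) (u - Q u) \<le> 2 * K e e + 2 * K (Q e) (Q e)"
    using K.square_add_le[OF eS K.closed(3)[OF QeS, of "-1"]] QeS
      K.scale_left[OF QeS, of "- Q e" "-1"] K.scale_right[OF QeS QeS, of "-1"] by simp
  then have *: "K (u - Q u) (u - Q u) \<le> 26 * K e e" using KQe by linarith
  then show "K (u - Q u) (u - Q u) \<le> 26 * K u u" using Ke by linarith
  assume d: "d \<in> S" "\<And>v. v \<in> S \<Longrightarrow> M d v = K u v"
  have "K e e = K u e" using ez zS eS by (subst (1) e_def) (simp add: K.diff_left K.sym[of z e] u)
  also have "\<dots> = M d e" using d eS by simp
  also have "\<dots> \<le> sqrt (M d d) * sqrt (M e e)" using cauchy_schwarz_sqrt[OF d(1) eS] by simp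
  also have "\<dots> \<le> sqrt (M d d) * sqrt ((1 / n)\<^sup>2 * K e e)"
    using err' nonneg[OF d(1)] by (intro mult_left_mono) auto
  finally have "K e e \<le> 1 / n * sqrt (K e e) * sqrt (M d d)"
    using n by (simp add: real_sqrt_mult real_sqrt_divide mult_ac)
  then have "K e e \<le> (1 / n)\<^sup>2 * M d d"
    using n K.nonneg[OF eS] nonneg[OF d(1)] by (intro sqrt_absorb) auto
  then show "K (u - Q u) (u - Q u) \<le> 26 * (1 / n)\<^sup>2 * M d d" using * by linarith
qed

end

lemma spline_ritz_space:
  assumes p: "0 < p" and n: "0 < n" and m: "0 < m" and dvd: "n dvd m"
  shows "ritz_space (spline_space p m) l2_inner (spline_space0 p n) stiff_op (real n)"
proof -
  interpret M: pdform "spline_space p m" l2_inner by (rule spline_mass_pdform[OF p m])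
  interpret K: psform "spline_space p m" stiff_op by (rule spline_stiff_psform[OF p m])
  show ?thesis
    by unfold_locales
      (use spline_subspace0[OF p n] spline_space_refine[OF p n m dvd] spline_fin_det[OF p m] n
        spline0_inverse_inequality[OF p n] spline_ritz[OF p n m dvd] in auto)
qed

section \<open>Tensor products of univariate splines\<close>

text \<open>Fubini's theorem: \<open>lborel\<close> is the image of a product measure indexed by
  \<open>Basis\<close>, and \<open>ix\<close> translates basis vectors into coordinates.\<close>

lemma integral_pure_tensor:
  fixes g :: "'n::finite \<Rightarrow> real \<Rightarrow> real"
  assumes g: "\<And>i. integrable lborel (g i)"
  shows "integrable lborel (pure_tensor g)" "(\<integral>x. pure_tensor g x \<partial>lborel) = (\<Prod>i\<in>UNIV. \<integral>t. g i t \<partial>lborel)"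
proof -
  interpret product_sigma_finite "\<lambda>_::real ^ 'n. lborel :: real measure"
    by standard
  define ix where "ix b = (SOME i. b = axis i (1::real))" for b :: "real ^ 'n"
  have inj: "inj (\<lambda>i::'n. axis i (1::real))" by (auto simp: inj_on_def axis_eq_axis)
  have ix: "ix (axis i 1) = i" for i :: 'n
    unfolding ix_def by (rule some_equality) (auto simp: axis_eq_axis)
  have B: "(Basis :: (real ^ 'n) set) = (\<lambda>i. axis i 1) ` UNIV" by (auto simp: Basis_vec_def)
  have re: "(\<Prod>b\<in>(Basis :: (real ^ 'n) set). h b) = (\<Prod>i\<in>UNIV. h (axis i 1))" for h :: "real ^ 'n \<Rightarrow> real"
    unfolding B by (subst prod.reindex[OF inj]) simp
  have pt: "pure_tensor g x = (\<Prod>b\<in>Basis. g (ix b) (x \<bullet> b))" for x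
    by (simp add: re ix pure_tensor_def inner_axis)
  have e: "pure_tensor g (\<Sum>b\<in>Basis. f b *\<^sub>R b) = (\<Prod>b\<in>Basis. g (ix b) (f b))" for f :: "real ^ 'n \<Rightarrow> real"
    unfolding pt by (intro prod.cong refl arg_cong2[where f=g] ) (simp add: inner_sum_left_Basis)
  have [measurable]: "g i \<in> borel_measurable borel" for i
    using borel_measurable_integrable[OF g[of i]] by simp
  have m: "pure_tensor g \<in> borel_measurable (borel :: (real ^ 'n) measure)"
    unfolding pure_tensor_def[abs_def] by measurable
  have "integrable (\<Pi>\<^sub>M b\<in>(Basis :: (real ^ 'n) set). lborel) (\<lambda>f. \<Prod>b\<in>Basis. g (ix b) (f b))"
    by (rule product_integrable_prod) (auto intro: g)
  then show "integrable lborel (pure_tensor g)"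
    unfolding lborel_eq[where 'a="real ^ 'n"]
    by (subst integrable_distr_eq) (auto simp: e m)
  have "(\<integral>x. pure_tensor g x \<partial>lborel) = (\<integral>f. (\<Prod>b\<in>Basis. g (ix b) (f b)) \<partial>(\<Pi>\<^sub>M b\<in>(Basis :: (real ^ 'n) set). lborel))"
    unfolding lborel_eq[where 'a="real ^ 'n"]
    by (subst integral_distr) (auto simp: e m)
  also have "\<dots> = (\<Prod>b\<in>(Basis :: (real ^ 'n) set). \<integral>t. g (ix b) t \<partial>lborel)"
    by (rule product_integral_prod) (auto intro: g)
  also have "\<dots> = (\<Prod>i\<in>UNIV. \<integral>t. g i t \<partial>lborel)" by (simp add: re ix)
  finally show "(\<integral>x. pure_tensor g x \<partial>lborel) = (\<Prod>i\<in>UNIV. \<integral>t. g i t \<partial>lborel)" .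
qed

lemma box_integral_pure_tensor:
  fixes f :: "'n::finite \<Rightarrow> real \<Rightarrow> real"
  assumes f: "\<And>i. pwc (f i)"
  shows "set_integrable lborel (box 0 1) (pure_tensor f)"
    "(LINT x:box 0 1|lborel. pure_tensor f x) = (\<Prod>i\<in>UNIV. LINT t:{0<..<1}|lborel. f i t)"
proof -
  define g where "g i t = indicator {0<..<1} t *\<^sub>R f i t" for i t
  have g: "integrable lborel (g i)" for i
    using pwc_integrable[OF f[of i]] by (simp add: g_def[abs_def] set_integrable_def)
  have "indicator (box 0 1) x *\<^sub>R pure_tensor f x = pure_tensor g x" for x :: "real ^ 'n"
  proof -
    have "indicator (box 0 1) x = (\<Prod>i\<in>UNIV. indicator {0<..<1} (x $ i) :: real)"
      by (auto simp: indicator_def mem_box_cart prod_eq_1_iff)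
    then show ?thesis by (simp add: pure_tensor_def g_def prod.distrib)
  qed
  then have "(\<lambda>x. indicator (box 0 1) x *\<^sub>R pure_tensor f x) = pure_tensor g" by auto
  then show "set_integrable lborel (box 0 1) (pure_tensor f)"
    "(LINT x:box 0 1|lborel. pure_tensor f x) = (\<Prod>i\<in>UNIV. LINT t:{0<..<1}|lborel. f i t)"
    using integral_pure_tensor[OF g] unfolding set_integrable_def set_lebesgue_integral_def
    by (simp_all add: g_def)
qed

text \<open>When the factors of \<open>I\<close> run through an orthonormal basis, this is a
  coordinate of \<open>w\<close> in the product basis. Being an integral, it does not depend on a
  tensor representation of \<open>w\<close>.\<close>

definition coef :: "(real ^ 'n::finite \<Rightarrow> real) \<Rightarrow> ('n \<Rightarrow> real \<Rightarrow> real) \<Rightarrow> real" where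
  "coef w I = (LINT x:box 0 1|lborel. w x * pure_tensor I x)"

lemma sum_list_nth: "(\<Sum>u\<leftarrow>us. f u) = (\<Sum>k<length us. f (us ! k))" for f :: "'a \<Rightarrow> real"
  by (simp add: sum_list_sum_nth atLeast0LessThan)

lemma pure_tensor_mult: "pure_tensor u x * pure_tensor v x = pure_tensor (\<lambda>i t. u i t * v i t) x"
  by (simp add: pure_tensor_def prod.distrib)

lemma tensor_rep_mem:
  assumes "tensor_rep W us w"
  shows "u \<in> set us \<Longrightarrow> u i \<in> W i" "k < length us \<Longrightarrow> (us ! k) i \<in> W i"
  using assms nth_mem[of k us] unfolding tensor_rep_def by blast+

lemma coef_rep:
  assumes us: "tensor_rep W us w" and W: "\<And>i u. u \<in> W i \<Longrightarrow> pwc u" and I: "\<And>i. pwc (I i)"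
  shows "coef w I = (\<Sum>u\<leftarrow>us. \<Prod>i\<in>UNIV. l2_inner (u i) (I i))"
proof -
  have w: "w = (\<lambda>x. \<Sum>k<length us. pure_tensor (us ! k) x)"
    using us by (simp add: tensor_rep_def sum_list_nth)
  have p: "pwc (\<lambda>t. (us ! k) i t * I i t)" if "k < length us" for k i
    using tensor_rep_mem(2)[OF us that] W I by (intro pwc_mult) auto
  have "coef w I = (LINT x:box 0 1|lborel. \<Sum>k<length us. pure_tensor (\<lambda>i t. (us ! k) i t * I i t) x)"
    by (simp add: coef_def w sum_distrib_right pure_tensor_mult)
  also have "\<dots> = (\<Sum>k<length us. LINT x:box 0 1|lborel. pure_tensor (\<lambda>i t. (us ! k) i t * I i t) x)"
    unfolding set_lebesgue_integral_def scaleR_sum_right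
  proof (rule Bochner_Integration.integral_sum)
    fix k assume "k \<in> {..<length us}"
    then have "set_integrable lborel (box 0 1) (pure_tensor (\<lambda>i t. (us ! k) i t * I i t))"
      using p by (intro box_integral_pure_tensor(1)) auto
    then show "integrable lborel (\<lambda>x. indicat_real (box 0 1) x *\<^sub>R pure_tensor (\<lambda>i t. (us ! k) i t * I i t) x)"
      unfolding set_integrable_def .
  qed
  also have "\<dots> = (\<Sum>k<length us. \<Prod>i\<in>UNIV. l2_inner ((us ! k) i) (I i))"
    by (intro sum.cong refl, subst box_integral_pure_tensor(2)) (auto simp: p l2_inner_def)
  finally show ?thesis by (simp add: sum_list_nth)
qed

lemma tensor_rep_zero: "tensor_rep W [] 0"
  by (auto simp: tensor_rep_def zero_fun_def)

lemma tensor_rep_append: "tensor_rep W us w \<Longrightarrow> tensor_rep W vs z \<Longrightarrow> tensor_rep W (us @ vs) (w + z)"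
  by (auto simp: tensor_rep_def plus_fun_def)

lemma tensor_rep_scale:
  fixes W :: "'n::finite \<Rightarrow> (real \<Rightarrow> real) set"
  assumes us: "tensor_rep W us w" and W: "\<And>i. subspace (W i)"
  shows "\<exists>us'. tensor_rep W us' (c *\<^sub>R w)"
proof -
  define i0 :: 'n where "i0 = (SOME i. True)"
  let ?h = "\<lambda>u :: 'n \<Rightarrow> real \<Rightarrow> real. u(i0 := c *\<^sub>R u i0)"
  have h: "pure_tensor (?h u) x = c * pure_tensor u x" for u x
    unfolding pure_tensor_def
    by (subst (1 2) prod.remove[of UNIV i0]) (auto intro!: prod.cong)
  have "(c *\<^sub>R w) x = (\<Sum>u\<leftarrow>map ?h us. pure_tensor u x)" for x
  proof -
    have "(\<Sum>u\<leftarrow>map ?h us. pure_tensor u x) = (\<Sum>u\<leftarrow>us. c * pure_tensor u x)"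
      by (simp only: map_map o_def h)
    also have "\<dots> = c * w x" using us by (simp add: tensor_rep_def sum_list_const_mult)
    finally show ?thesis by simp
  qed
  moreover have "\<forall>u\<in>set (map ?h us). \<forall>i. u i \<in> W i"
    using us subspace_scale[OF W] by (auto simp: tensor_rep_def)
  ultimately show ?thesis unfolding tensor_rep_def by (intro exI[of _ "map ?h us"]) auto
qed

lemma tensor_space_subspace:
  assumes "\<And>i. subspace (W i)"
  shows "subspace (tensor_space W)"
  unfolding subspace_def tensor_space_def mem_Collect_eq
proof (intro conjI ballI allI; (elim CollectE exE)?)
  show "\<exists>us. tensor_rep W us 0" using tensor_rep_zero by blast
next
  fix w z us vs assume "tensor_rep W us w" "tensor_rep W vs z"
  then show "\<exists>us. tensor_rep W us (w + z)" using tensor_rep_append by blast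
next
  fix c w us assume "tensor_rep W us w"
  then show "\<exists>us. tensor_rep W us (c *\<^sub>R w)" using tensor_rep_scale[of W us w c] assms by blast
qed

lemma tensor_space_mono: "(\<And>i. W i \<subseteq> W' i) \<Longrightarrow> tensor_space W \<subseteq> tensor_space W'"
  unfolding tensor_space_def tensor_rep_def by blast

definition bilin_on :: "'v::real_vector set \<Rightarrow> ('v \<Rightarrow> 'v \<Rightarrow> real) \<Rightarrow> bool" where
  "bilin_on S B \<longleftrightarrow> (\<forall>v\<in>S. lin_on S (\<lambda>u. B u v)) \<and> (\<forall>u\<in>S. lin_on S (B u))"

lemma (in sform) bilin: "bilin_on V B"
  by (simp add: bilin_on_def lin_left lin_right)

lemma bilin_on_comp:
  assumes "bilin_on S B" "lin_on S T" "lin_on S U" "\<And>u. u \<in> S \<Longrightarrow> T u \<in> S" "\<And>u. u \<in> S \<Longrightarrow> U u \<in> S"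
  shows "bilin_on S (\<lambda>u v. B (T u) (U v))"
  using assms by (auto simp: bilin_on_def lin_on_def)

locale tensor_basis = pdform S l2_inner for S +
  fixes E
  assumes onb: "onb S l2_inner E" and pwc: "u \<in> S \<Longrightarrow> pwc u"
begin

lemma basis: "finite E" "E \<subseteq> S" "a \<in> E \<Longrightarrow> b \<in> E \<Longrightarrow> l2_inner a b = (if a = b then 1 else 0)"
  "u \<in> S \<Longrightarrow> (\<Sum>b\<in>E. l2_inner u b *\<^sub>R b) = u"
  using onb by (auto simp: onb_def)

abbreviation "\<V> \<equiv> tensor_space (\<lambda>_. S)"

abbreviation "Idx \<equiv> UNIV \<rightarrow> E"

abbreviation "F B w z \<equiv> kron E B (coef w) (coef z)"

lemma Idx_S: "I \<in> Idx \<Longrightarrow> I i \<in> S"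
  using basis(2) by auto

lemma coef_rep_S:
  assumes "tensor_rep W us w" "\<And>i. W i \<subseteq> S" "I \<in> Idx"
  shows "coef w I = (\<Sum>u\<leftarrow>us. \<Prod>i\<in>UNIV. l2_inner (u i) (I i))"
  using assms by (intro coef_rep) (auto intro: pwc Idx_S)

text \<open>The right-hand side depends on \<open>w\<close> only, so the representations selected by \<open>SOME\<close> in
  \<^const>\<open>tensor_map\<close> and \<^const>\<open>tensor_op\<close> are irrelevant.\<close>

lemma extension:
  fixes l :: "'n::finite \<Rightarrow> (real \<Rightarrow> real) \<Rightarrow> real"
  assumes us: "tensor_rep W us w" and W: "\<And>i. W i \<subseteq> S" and l: "\<And>i. lin_on S (l i)"
  shows "(\<Sum>u\<leftarrow>us. \<Prod>i\<in>UNIV. l i (u i)) = (\<Sum>I\<in>Idx. coef w I * (\<Prod>i\<in>UNIV. l i (I i)))"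
proof -
  have "(\<Prod>i\<in>UNIV. l i ((us ! k) i)) =
      (\<Sum>I\<in>Idx. (\<Prod>i\<in>UNIV. l2_inner ((us ! k) i) (I i)) * (\<Prod>i\<in>UNIV. l i (I i)))" if "k < length us" for k
  proof -
    have "l i ((us ! k) i) = (\<Sum>b\<in>E. l2_inner ((us ! k) i) b * l i b)" for i
    proof -
      have "(us ! k) i \<in> S" using tensor_rep_mem(2)[OF us that] W by blast
      then have "l i ((us ! k) i) = l i (\<Sum>b\<in>E. l2_inner ((us ! k) i) b *\<^sub>R b)" by (simp add: basis(4))
      also have "\<dots> = (\<Sum>b\<in>E. l i (l2_inner ((us ! k) i) b *\<^sub>R b))"
        by (rule lin_on_sum[OF l sub]) (use basis(2) in auto)
      also have "\<dots> = (\<Sum>b\<in>E. l2_inner ((us ! k) i) b * l i b)"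
        by (intro sum.cong refl) (use lin_on_scale[OF l] basis(2) in auto)
      finally show ?thesis .
    qed
    then show ?thesis by (simp add: prod_sum_index[OF basis(1)] prod.distrib)
  qed
  then have "(\<Sum>u\<leftarrow>us. \<Prod>i\<in>UNIV. l i (u i)) =
      (\<Sum>k<length us. \<Sum>I\<in>Idx. (\<Prod>i\<in>UNIV. l2_inner ((us ! k) i) (I i)) * (\<Prod>i\<in>UNIV. l i (I i)))"
    by (simp add: sum_list_nth)
  also have "\<dots> = (\<Sum>I\<in>Idx. \<Sum>k<length us. (\<Prod>i\<in>UNIV. l2_inner ((us ! k) i) (I i)) * (\<Prod>i\<in>UNIV. l i (I i)))"
    by (rule sum.swap)
  also have "\<dots> = (\<Sum>I\<in>Idx. coef w I * (\<Prod>i\<in>UNIV. l i (I i)))"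
    by (intro sum.cong refl) (simp add: coef_rep_S[OF us W] sum_list_nth sum_distrib_right)
  finally show ?thesis .
qed

lemma tensor_expand:
  assumes w: "w \<in> \<V>"
  shows "w x = (\<Sum>I\<in>Idx. coef w I * pure_tensor I x)"
proof -
  obtain us where us: "tensor_rep (\<lambda>_. S) us w" using w by (auto simp: tensor_space_def)
  then have "w x = (\<Sum>u\<leftarrow>us. \<Prod>i\<in>UNIV. u i (x $ i))" by (simp add: tensor_rep_def pure_tensor_def)
  also have "\<dots> = (\<Sum>I\<in>Idx. coef w I * (\<Prod>i\<in>UNIV. I i (x $ i)))"
    by (rule extension[OF us]) (auto simp: lin_on_def)
  finally show ?thesis by (simp add: pure_tensor_def)
qed

lemma form_rep:
  fixes B :: "'n::finite \<Rightarrow> (real \<Rightarrow> real) \<Rightarrow> (real \<Rightarrow> real) \<Rightarrow> real"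
  assumes us: "tensor_rep W us w" and vs: "tensor_rep W' vs z"
    and W: "\<And>i. W i \<subseteq> S" "\<And>i. W' i \<subseteq> S" and B: "\<And>i. bilin_on S (B i)"
  shows "(\<Sum>u\<leftarrow>us. \<Sum>v\<leftarrow>vs. \<Prod>i\<in>UNIV. B i (u i) (v i)) = F B w z"
proof -
  have "(\<Sum>v\<leftarrow>vs. \<Prod>i\<in>UNIV. B i (u i) (v i)) = (\<Sum>J\<in>Idx. coef z J * (\<Prod>i\<in>UNIV. B i (u i) (J i)))"
    if "u \<in> set us" for u
  proof (rule extension[OF vs W(2)])
    have "u i \<in> S" for i using tensor_rep_mem(1)[OF us that] W(1) by blast
    then show "lin_on S (B i (u i))" for i using B[of i] unfolding bilin_on_def by blast
  qed
  then have "(\<Sum>u\<leftarrow>us. \<Sum>v\<leftarrow>vs. \<Prod>i\<in>UNIV. B i (u i) (v i)) =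
      (\<Sum>k<length us. \<Sum>J\<in>Idx. coef z J * (\<Prod>i\<in>UNIV. B i ((us ! k) i) (J i)))"
    by (subst sum_list_nth) auto
  also have "\<dots> = (\<Sum>J\<in>Idx. coef z J * (\<Sum>k<length us. (\<Prod>i\<in>UNIV. B i ((us ! k) i) (J i))))"
    by (subst sum.swap) (simp add: sum_distrib_left)
  also have "\<dots> = (\<Sum>J\<in>Idx. coef z J * (\<Sum>I\<in>Idx. coef w I * (\<Prod>i\<in>UNIV. B i (I i) (J i))))"
  proof (intro sum.cong refl arg_cong2[where f="(*)"])
    fix J :: "'n \<Rightarrow> real \<Rightarrow> real" assume J: "J \<in> Idx"
    show "(\<Sum>k<length us. (\<Prod>i\<in>UNIV. B i ((us ! k) i) (J i))) = (\<Sum>I\<in>Idx. coef w I * (\<Prod>i\<in>UNIV. B i (I i) (J i)))"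
      using extension[OF us W(1), of "\<lambda>i u. B i u (J i)"] B Idx_S[OF J]
      by (simp add: sum_list_nth bilin_on_def)
  qed
  also have "\<dots> = (\<Sum>J\<in>Idx. \<Sum>I\<in>Idx. coef w I * coef z J * (\<Prod>i\<in>UNIV. B i (I i) (J i)))"
    by (simp add: sum_distrib_left mult_ac)
  also have "\<dots> = F B w z" unfolding kron_def by (rule sum.swap)
  finally show ?thesis .
qed

lemma tensor_op_eq:
  assumes w: "w \<in> tensor_space W" and z: "z \<in> tensor_space W"
    and W: "\<And>i. W i \<subseteq> S" and B: "\<And>i. bilin_on S (B i)"
  shows "tensor_op W B w z = F B w z"
proof -
  have "tensor_rep W (SOME us. tensor_rep W us w) w" "tensor_rep W (SOME vs. tensor_rep W vs z) z"
    using w z unfolding tensor_space_def by (auto intro: someI)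
  from form_rep[OF this W W B] show ?thesis by (simp add: tensor_op_def)
qed

lemma tensor_map_rep:
  assumes w: "w \<in> \<V>" and T: "\<And>i. lin_on S (T i)" "\<And>i u. u \<in> S \<Longrightarrow> T i u \<in> W i" and W: "\<And>i. W i \<subseteq> S"
  shows "\<exists>us. tensor_rep (\<lambda>_. S) us w \<and> tensor_rep W (map (\<lambda>u i. T i (u i)) us) (tensor_map (\<lambda>_. S) T w)"
proof -
  let ?us = "SOME us. tensor_rep (\<lambda>_. S) us w"
  have us: "tensor_rep (\<lambda>_. S) ?us w" using w unfolding tensor_space_def by (auto intro: someI)
  moreover have "tensor_rep W (map (\<lambda>u i. T i (u i)) ?us) (tensor_map (\<lambda>_. S) T w)"
    using us T by (auto simp: tensor_rep_def tensor_map_def o_def)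
  ultimately show ?thesis by blast
qed

lemma tensor_map_in:
  assumes "w \<in> \<V>" "\<And>i. lin_on S (T i)" "\<And>i u. u \<in> S \<Longrightarrow> T i u \<in> W i" "\<And>i. W i \<subseteq> S"
  shows "tensor_map (\<lambda>_. S) T w \<in> tensor_space W"
  using tensor_map_rep[where T=T and W=W, OF assms] unfolding tensor_space_def by blast

lemma tensor_map_eval:
  fixes T :: "'n::finite \<Rightarrow> (real \<Rightarrow> real) \<Rightarrow> real \<Rightarrow> real"
  assumes w: "w \<in> \<V>" and T: "\<And>i. lin_on S (T i)" "\<And>i u. u \<in> S \<Longrightarrow> T i u \<in> S"
  shows "tensor_map (\<lambda>_. S) T w x = (\<Sum>I\<in>Idx. coef w I * pure_tensor (\<lambda>i. T i (I i)) x)"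
proof -
  obtain us where us: "tensor_rep (\<lambda>_. S) us w"
    "tensor_rep (\<lambda>_. S) (map (\<lambda>u i. T i (u i)) us) (tensor_map (\<lambda>_. S) T w)"
    using tensor_map_rep[where T=T and W="\<lambda>_. S", OF w T subset_refl] by blast
  have "tensor_map (\<lambda>_. S) T w x = (\<Sum>u\<leftarrow>us. \<Prod>i\<in>UNIV. (T i (u i)) (x $ i))"
    using us(2) by (simp add: tensor_rep_def pure_tensor_def o_def)
  also have "\<dots> = (\<Sum>I\<in>Idx. coef w I * (\<Prod>i\<in>UNIV. (T i (I i)) (x $ i)))"
    using T(1) by (intro extension[OF us(1)]) (auto simp: lin_on_def)
  finally show ?thesis by (simp add: pure_tensor_def)
qed

text \<open>Both sides are evaluated on one representation of each argument, to which
  \<open>tensor_map\<close> applies its maps factor by factor.\<close>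

lemma form_map:
  fixes T :: "'n::finite \<Rightarrow> (real \<Rightarrow> real) \<Rightarrow> real \<Rightarrow> real"
  assumes w: "w \<in> \<V>" and T: "\<And>i. lin_on S (T i)" "\<And>i u. u \<in> S \<Longrightarrow> T i u \<in> S"
    and z: "z \<in> \<V>" and T': "\<And>i. lin_on S (T' i)" "\<And>i u. u \<in> S \<Longrightarrow> T' i u \<in> S"
    and B: "\<And>i. bilin_on S (B i)"
  shows "F B (tensor_map (\<lambda>_. S) T w) (tensor_map (\<lambda>_. S) T' z) = F (\<lambda>i u v. B i (T i u) (T' i v)) w z"
proof -
  obtain us where us: "tensor_rep (\<lambda>_. S) us w"
    "tensor_rep (\<lambda>_. S) (map (\<lambda>u i. T i (u i)) us) (tensor_map (\<lambda>_. S) T w)"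
    using tensor_map_rep[where T=T and W="\<lambda>_. S", OF w T subset_refl] by blast
  obtain vs where vs: "tensor_rep (\<lambda>_. S) vs z"
    "tensor_rep (\<lambda>_. S) (map (\<lambda>u i. T' i (u i)) vs) (tensor_map (\<lambda>_. S) T' z)"
    using tensor_map_rep[where T=T' and W="\<lambda>_. S", OF z T' subset_refl] by blast
  have "F B (tensor_map (\<lambda>_. S) T w) (tensor_map (\<lambda>_. S) T' z) =
      (\<Sum>u\<leftarrow>us. \<Sum>v\<leftarrow>vs. \<Prod>i\<in>UNIV. B i (T i (u i)) (T' i (v i)))"
    using form_rep[OF us(2) vs(2) _ _ B] by (simp add: o_def)
  also have "\<dots> = F (\<lambda>i u v. B i (T i u) (T' i v)) w z"
  proof (rule form_rep[where B="\<lambda>i u v. B i (T i u) (T' i v)", OF us(1) vs(1) subset_refl subset_refl])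
    fix i
    show "bilin_on S (\<lambda>u v. B i (T i u) (T' i v))"
      by (rule bilin_on_comp[OF B T(1) T'(1)]) (use T(2) T'(2) in auto)
  qed
  finally show ?thesis .
qed

lemma coef_lin:
  fixes I :: "'n::finite \<Rightarrow> real \<Rightarrow> real"
  shows "I \<in> Idx \<Longrightarrow> lin_on \<V> (\<lambda>w. coef w I)"
proof (rule lin_onI)
  fix w z :: "real ^ 'n \<Rightarrow> real" assume I: "I \<in> Idx" and "w \<in> \<V>" "z \<in> \<V>"
  then obtain us vs where r: "tensor_rep (\<lambda>_. S) us w" "tensor_rep (\<lambda>_. S) vs z"
    by (auto simp: tensor_space_def)
  show "coef (w + z) I = coef w I + coef z I"
    using coef_rep_S[OF tensor_rep_append[OF r] _ I] coef_rep_S[OF r(1) _ I] coef_rep_S[OF r(2) _ I] by simp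
qed (simp add: coef_def mult.assoc)

lemma \<V>_subspace: "subspace \<V>"
  by (rule tensor_space_subspace) (rule sub)

lemma coef_zero_imp:
  assumes "w \<in> \<V>" "\<And>I. I \<in> Idx \<Longrightarrow> coef w I = 0"
  shows "w = 0"
  using tensor_expand[OF assms(1)] assms(2) by (auto simp: fun_eq_iff)

lemma \<V>_fin_det: "fin_det (\<V> :: (real ^ 'n::finite \<Rightarrow> real) set)"
  unfolding fin_det_def
  using finite_index[OF basis(1)] coef_lin coef_zero_imp
  by (intro exI[of _ "(\<lambda>I w. coef w I) ` Idx"]) auto

lemma form_lin:
  fixes B :: "'n::finite \<Rightarrow> (real \<Rightarrow> real) \<Rightarrow> (real \<Rightarrow> real) \<Rightarrow> real"
  shows "lin_on \<V> (\<lambda>w. F B w z)" "lin_on \<V> (F B w)"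
proof -
  have a: "coef (u + v) I = coef u I + coef v I" "coef (c *\<^sub>R u) I = c * coef u I"
    if "u \<in> \<V>" "v \<in> \<V>" "I \<in> Idx" for u v :: "real ^ 'n \<Rightarrow> real" and c I
    using lin_on_add[where f="\<lambda>w. coef w I", OF coef_lin] lin_on_scale[where f="\<lambda>w. coef w I", OF coef_lin] that
    by simp_all
  show "lin_on \<V> (\<lambda>w. F B w z)" "lin_on \<V> (F B w)"
    unfolding kron_def
    by (rule lin_onI; simp add: a sum.distrib[symmetric] sum_distrib_left algebra_simps)+
qed

lemma form_sym:
  fixes B :: "'n::finite \<Rightarrow> (real \<Rightarrow> real) \<Rightarrow> (real \<Rightarrow> real) \<Rightarrow> real"
  assumes "\<And>i u v. u \<in> S \<Longrightarrow> v \<in> S \<Longrightarrow> B i u v = B i v u"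
  shows "F B w z = F B z w"
  unfolding kron_def
proof (subst sum.swap, intro sum.cong refl)
  fix I J :: "'n \<Rightarrow> real \<Rightarrow> real" assume "I \<in> Idx" "J \<in> Idx"
  then have "(\<Prod>i\<in>UNIV. B i (J i) (I i)) = (\<Prod>i\<in>UNIV. B i (I i) (J i))"
    by (intro prod.cong refl assms Idx_S)
  then show "coef w J * coef z I * (\<Prod>i\<in>UNIV. B i (J i) (I i)) = coef z I * coef w J * (\<Prod>i\<in>UNIV. B i (I i) (J i))"
    by simp
qed

section \<open>Order relations between Kronecker forms\<close>

lemma psd_on_form:
  assumes "psform S B"
  shows "psd_on E B"
proof -
  interpret B: psform S B by fact
  have S: "(\<Sum>a\<in>E. c a *\<^sub>R a) \<in> S" for c
    by (intro subspace_sum[OF sub]) (use basis(2) in auto)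
  have "0 \<le> (\<Sum>a\<in>E. \<Sum>b\<in>E. c a * c b * B a b)" for c
  proof -
    have "0 \<le> B (\<Sum>a\<in>E. c a *\<^sub>R a) (\<Sum>b\<in>E. c b *\<^sub>R b)" by (rule B.nonneg[OF S])
    also have "\<dots> = (\<Sum>a\<in>E. B (c a *\<^sub>R a) (\<Sum>b\<in>E. c b *\<^sub>R b))"
      by (rule B.sum_left) (use basis(2) S in auto)
    also have "\<dots> = (\<Sum>a\<in>E. \<Sum>b\<in>E. B (c a *\<^sub>R a) (c b *\<^sub>R b))"
      by (intro sum.cong refl B.sum_right) (use basis(2) in auto)
    also have "\<dots> = (\<Sum>a\<in>E. \<Sum>b\<in>E. c a * c b * B a b)"
      by (intro sum.cong refl) (use basis(2) in \<open>auto simp: B.scale_left B.scale_right subset_iff\<close>)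
    finally show ?thesis .
  qed
  then show ?thesis using B.sym basis(2) by (auto simp: psd_on_def subset_iff)
qed

definition form_le :: "((real \<Rightarrow> real) \<Rightarrow> (real \<Rightarrow> real) \<Rightarrow> real) \<Rightarrow> ((real \<Rightarrow> real) \<Rightarrow> (real \<Rightarrow> real) \<Rightarrow> real) \<Rightarrow> bool" where
  "form_le X Y \<longleftrightarrow> psform S X \<and> psform S Y \<and> (\<forall>u\<in>S. X u u \<le> Y u u)"

lemma form_le_refl: "psform S X \<Longrightarrow> form_le X X"
  by (simp add: form_le_def)

lemma form_le_psd_le:
  assumes "form_le X Y"
  shows "psd_le E X Y"
proof -
  interpret X: psform S X using assms by (simp add: form_le_def)
  interpret Y: psform S Y using assms by (simp add: form_le_def)
  have "psform S (\<lambda>a b. Y a b - X a b)"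
  proof unfold_locales
    fix u v assume "u \<in> S" "v \<in> S"
    then show "Y u v - X u v = Y v u - X v u" using X.sym[of u v] Y.sym[of u v] by simp
  qed (use assms in \<open>simp_all add: form_le_def sub X.add_left Y.add_left X.scale_left Y.scale_left
      right_diff_distrib\<close>)
  then show ?thesis
    using psd_on_form X.psform_axioms Y.psform_axioms by (auto simp: psd_le_def)
qed

lemma form_mono:
  fixes X Y :: "'n::finite \<Rightarrow> (real \<Rightarrow> real) \<Rightarrow> (real \<Rightarrow> real) \<Rightarrow> real"
  shows "(\<And>i. form_le (X i) (Y i)) \<Longrightarrow> F X w w \<le> F Y w w"
  using form_le_psd_le by (intro kron_mono basis(1)) blast

lemma form_nonneg:
  fixes X :: "'n::finite \<Rightarrow> (real \<Rightarrow> real) \<Rightarrow> (real \<Rightarrow> real) \<Rightarrow> real"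
  shows "(\<And>i. psform S (X i)) \<Longrightarrow> 0 \<le> F X w w"
  using psd_on_form by (intro kron_nonneg basis(1)) blast

lemma form_psform:
  fixes X :: "'n::finite \<Rightarrow> (real \<Rightarrow> real) \<Rightarrow> (real \<Rightarrow> real) \<Rightarrow> real"
  assumes X: "\<And>i. psform S (X i)"
  shows "psform \<V> (F X)"
proof unfold_locales
  show "subspace \<V>" by (rule \<V>_subspace)
  fix w z v :: "real ^ 'n \<Rightarrow> real"
  show "F X w z = F X z w"
    by (rule form_sym) (use X in \<open>auto simp: psform_def sform_def\<close>)
  show "0 \<le> F X w w" by (rule form_nonneg[OF X])
qed (use lin_on_add[OF form_lin(1)] lin_on_scale[OF form_lin(1)] in auto)

text \<open>Orthonormality reduces the product of inner products to a Kronecker delta: Parseval's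
  identity.\<close>

lemma mass_kron:
  fixes w z :: "real ^ 'n::finite \<Rightarrow> real"
  shows "F (\<lambda>_. l2_inner) w z = (\<Sum>I\<in>Idx. coef w I * coef z I)"
proof -
  have "(\<Prod>i\<in>UNIV. l2_inner (I i) (J i)) = (if I = J then 1 else 0)" if "I \<in> Idx" "J \<in> Idx" for I J :: "'n \<Rightarrow> _"
  proof (cases "I = J")
    case False
    then obtain i where "I i \<noteq> J i" by auto
    then have "l2_inner (I i) (J i) = 0" using that basis(3)[of "I i" "J i"] by (auto simp: Pi_iff)
    then show ?thesis using False by (auto intro!: prod_zero)
  qed (use that basis(3) in \<open>auto simp: Pi_iff intro!: prod.neutral\<close>)
  then have "F (\<lambda>_. l2_inner) w z = (\<Sum>I\<in>Idx. \<Sum>J\<in>Idx. if J = I then coef w I * coef z I else 0)"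
    unfolding kron_def by (intro sum.cong refl) simp
  then show ?thesis by (simp add: finite_index[OF basis(1)])
qed

lemma mass_pdform: "pdform \<V> (F (\<lambda>_ :: 'n::finite. l2_inner))"
proof (intro pdform.intro form_psform psform_axioms)
  show "pdform_axioms \<V> (F (\<lambda>_ :: 'n. l2_inner))"
  proof
    fix w :: "real ^ 'n \<Rightarrow> real" assume w: "w \<in> \<V>" "F (\<lambda>_. l2_inner) w w = 0"
    then have "\<forall>I\<in>Idx. coef w I * coef w I = 0"
      unfolding mass_kron by (subst (asm) sum_nonneg_eq_0_iff) (auto simp: finite_index[OF basis(1)])
    then show "w = 0" by (intro coef_zero_imp[OF w(1)]) auto
  qed
qed

end

section \<open>Measurability of the gradient\<close>

lemma one_sided_deriv_poly:
  fixes u :: "real \<Rightarrow> real"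
  assumes c: "isCont u x" and ev: "eventually (\<lambda>y. u y = poly g y) (at x within T)" and nt: "at x within T \<noteq> bot"
  shows "(u has_real_derivative poly (pderiv g) x) (at x within T)"
proof -
  have "(u \<longlongrightarrow> u x) (at x within T)" using c by (meson isContD tendsto_within_subset subset_UNIV)
  moreover have "(poly g \<longlongrightarrow> poly g x) (at x within T)"
    using tendsto_within_subset[OF isContD[OF poly_isCont]] by blast
  then have "(u \<longlongrightarrow> poly g x) (at x within T)"
    using tendsto_cong[OF ev] by blast
  ultimately have eq: "u x = poly g x" using nt tendsto_unique by blast
  have "(poly g has_real_derivative poly (pderiv g) x) (at x within T)"
    by (rule has_field_derivative_at_within[OF poly_DERIV])
  then have "((\<lambda>y. (poly g y - poly g x) / (y - x)) \<longlongrightarrow> poly (pderiv g) x) (at x within T)"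
    by (simp add: has_field_derivative_iff)
  moreover have "eventually (\<lambda>y. (poly g y - poly g x) / (y - x) = (u y - u x) / (y - x)) (at x within T)"
    using ev by eventually_elim (simp add: eq)
  ultimately have "((\<lambda>y. (u y - u x) / (y - x)) \<longlongrightarrow> poly (pderiv g) x) (at x within T)"
    by (simp add: tendsto_cong)
  then show ?thesis by (simp add: has_field_derivative_iff)
qed

text \<open>At a grid point the two sides belong to different elements and polynomials, hence the
  separate search for an element on each side.\<close>

lemma one_sided_deriv_ppoly:
  assumes m: "0 < m" and u: "ppoly p m u" and c: "isCont u x" and x: "x \<in> {0<..<1}"
  shows "\<exists>D. (u has_real_derivative D) (at_right x)" "\<exists>D. (u has_real_derivative D) (at_left x)"
proof -
  have "\<exists>j<m. real j / real m \<le> x \<and> x < real (Suc j) / real m"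
  proof (cases "x \<in> grid m")
    case True
    then obtain k where k: "k \<le> m" "x = real k / real m" by (auto simp: grid_def)
    then have "k < m" using x m by (cases "k = m") auto
    then show ?thesis using k m by (intro exI[of _ k]) (auto simp: divide_strict_right_mono)
  next
    case False
    then show ?thesis using element_cover[OF m, of x] x by fastforce
  qed
  then obtain j where j: "j < m" "real j / real m \<le> x" "x < real (Suc j) / real m" by auto
  obtain g :: "real poly" where g: "\<And>x. x \<in> elem m j \<Longrightarrow> u x = poly g x"
    using u j(1) unfolding ppoly_def by blast
  have "eventually (\<lambda>y. u y = poly g y) (at_right x)"
    unfolding eventually_at_right_field using g j by (intro exI[of _ "real (Suc j) / real m"]) auto
  then show "\<exists>D. (u has_real_derivative D) (at_right x)"
    using one_sided_deriv_poly[OF c] by (metis trivial_limit_at_right_real)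
next
  have "\<exists>j<m. real j / real m < x \<and> x \<le> real (Suc j) / real m"
  proof (cases "x \<in> grid m")
    case True
    then obtain k where k: "k \<le> m" "x = real k / real m" by (auto simp: grid_def)
    then obtain j where "k = Suc j" using x by (cases k) auto
    then show ?thesis using k m by (intro exI[of _ j]) (auto simp: divide_strict_right_mono)
  next
    case False
    then show ?thesis using element_cover[OF m, of x] x by fastforce
  qed
  then obtain j where j: "j < m" "real j / real m < x" "x \<le> real (Suc j) / real m" by auto
  obtain g :: "real poly" where g: "\<And>x. x \<in> elem m j \<Longrightarrow> u x = poly g x"
    using u j(1) unfolding ppoly_def by blast
  have "eventually (\<lambda>y. u y = poly g y) (at_left x)"
    unfolding eventually_at_left_field using g j by (intro exI[of _ "real j / real m"]) auto
  then show "\<exists>D. (u has_real_derivative D) (at_left x)"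
    using one_sided_deriv_poly[OF c] by (metis trivial_limit_at_left_real)
qed

text \<open>Where the one-sided derivatives disagree, \<^const>\<open>deriv\<close> is the fixed junk value
  \<open>SOME D. False\<close>, so the gradient remains measurable on the grid planes.\<close>

lemma deriv_one_sided:
  fixes h :: "real \<Rightarrow> real"
  assumes R: "(h has_real_derivative R) (at_right 0)" and L: "(h has_real_derivative L) (at_left 0)"
  defines "dr \<equiv> lim (\<lambda>n. (h (1 / real (Suc n)) - h 0) / (1 / real (Suc n)))"
    and "dl \<equiv> lim (\<lambda>n. (h (- 1 / real (Suc n)) - h 0) / (- 1 / real (Suc n)))"
  shows "deriv h 0 = (if dr = dl then dr else (SOME D. False))"
proof -
  let ?q = "\<lambda>y. (h y - h 0) / (y - 0)"
  have r: "(?q \<longlongrightarrow> R) (at_right 0)" and l: "(?q \<longlongrightarrow> L) (at_left 0)"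
    using R L by (simp_all add: has_field_derivative_iff)
  have z: "(\<lambda>n. 1 / real (Suc n)) \<longlonglongrightarrow> 0" using LIMSEQ_inverse_real_of_nat by (simp add: inverse_eq_divide)
  have fr: "filterlim (\<lambda>n. 1 / real (Suc n)) (at_right 0) sequentially"
    by (intro tendsto_imp_filterlim_at_right z always_eventually) auto
  have fl: "filterlim (\<lambda>n. - 1 / real (Suc n)) (at_left 0) sequentially"
    using tendsto_minus[OF z] by (intro tendsto_imp_filterlim_at_left always_eventually) auto
  have dr: "dr = R" unfolding dr_def using filterlim_compose[OF r fr] by (intro limI) simp
  have dl: "dl = L" unfolding dl_def using filterlim_compose[OF l fl] by (intro limI) simp
  show ?thesis
  proof (cases "R = L")
    case True
    then have "(?q \<longlongrightarrow> R) (at 0)" using r l by (intro filterlim_split_at) auto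
    then have "(h has_real_derivative R) (at 0)" by (simp add: has_field_derivative_iff)
    then show ?thesis using True dr dl by (simp add: DERIV_imp_deriv)
  next
    case False
    have "\<not> (h has_real_derivative D) (at 0)" for D
    proof
      assume "(h has_real_derivative D) (at 0)"
      then have q: "(?q \<longlongrightarrow> D) (at 0)" by (simp add: has_field_derivative_iff)
      have "D = R" using tendsto_unique[OF trivial_limit_at_right_real tendsto_within_subset[OF q subset_UNIV] r] .
      moreover have "D = L" using tendsto_unique[OF trivial_limit_at_left_real tendsto_within_subset[OF q subset_UNIV] l] .
      ultimately show False using False by simp
    qed
    then show ?thesis using False dr dl by (simp add: deriv_def)
  qed
qed

lemma shift_one_sided:
  fixes u :: "real \<Rightarrow> real"
  shows "(u has_real_derivative D) (at_right x) \<Longrightarrow> ((\<lambda>t. u (x + t)) has_real_derivative D) (at_right 0)"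
    "(u has_real_derivative D) (at_left x) \<Longrightarrow> ((\<lambda>t. u (x + t)) has_real_derivative D) (at_left 0)"
proof -
  have *: "((\<lambda>t. u (x + t)) has_real_derivative D) (at 0 within T)"
    if "(u has_real_derivative D) (at x within (+) x ` T)" for T
    using DERIV_at_within_shift[of u D x 0 T] that by simp
  have "(+) x ` {0<..} = {x<..}" by (auto simp: image_iff intro!: bexI[of _ "_ - x"])
  moreover have "(+) x ` {..<0} = {..<x}" by (auto simp: image_iff intro!: bexI[of _ "_ - x"])
  ultimately show "(u has_real_derivative D) (at_right x) \<Longrightarrow> ((\<lambda>t. u (x + t)) has_real_derivative D) (at_right 0)"
    "(u has_real_derivative D) (at_left x) \<Longrightarrow> ((\<lambda>t. u (x + t)) has_real_derivative D) (at_left 0)"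
    using *[of "{0<..}"] *[of "{..<0}"] by simp_all
qed

locale spline_basis =
  fixes p m :: nat and E
  assumes p: "0 < p" and m: "0 < m" and onbE: "onb (spline_space p m) l2_inner E"
begin

abbreviation "S \<equiv> spline_space p m"

sublocale tensor_basis S E
proof (intro tensor_basis.intro tensor_basis_axioms.intro)
  show "pdform S l2_inner" by (rule spline_mass_pdform[OF p m])
  show "onb S l2_inner E" by (rule onbE)
  show "pwc u" if "u \<in> S" for u by (rule spline_pwc[OF p m that])
qed

sublocale K: psform S stiff_op
  by (rule spline_stiff_psform[OF p m])

lemma spline_borel: "u \<in> S \<Longrightarrow> u \<in> borel_measurable borel"
proof -
  assume u: "u \<in> S"
  have "(\<lambda>x. indicator {0<..<1} x *\<^sub>R u x) = u"
    using spline_outside[OF p m u] by (auto simp: fun_eq_iff indicator_def)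
  then show ?thesis using pwc_integrable[OF pwc[OF u]] borel_measurable_integrable
    unfolding set_integrable_def by fastforce
qed

lemma pure_tensor_borel:
  fixes I :: "'n::finite \<Rightarrow> real \<Rightarrow> real"
  assumes "\<And>i. I i \<in> S"
  shows "pure_tensor I \<in> borel_measurable borel"
proof -
  have [measurable]: "I i \<in> borel_measurable borel" for i by (rule spline_borel[OF assms])
  show ?thesis unfolding pure_tensor_def[abs_def] by measurable
qed

lemma tensor_borel:
  fixes w :: "real ^ 'n::finite \<Rightarrow> real"
  assumes w: "w \<in> \<V>"
  shows "w \<in> borel_measurable borel"
proof -
  have [measurable]: "pure_tensor I \<in> borel_measurable borel" if "I \<in> Idx" for I :: "'n \<Rightarrow> _"
    by (rule pure_tensor_borel) (rule Idx_S[OF that])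
  have "(\<lambda>x. \<Sum>I\<in>Idx. coef w I * pure_tensor I x) \<in> borel_measurable borel" by measurable
  then show ?thesis unfolding tensor_expand[OF w, symmetric] .
qed

lemma pure_tensor_line:
  fixes I :: "'n::finite \<Rightarrow> real \<Rightarrow> real"
  shows "pure_tensor I (x + t *\<^sub>R axis j 1) = I j (x $ j + t) * (\<Prod>i\<in>UNIV - {j}. I i (x $ i))"
  unfolding pure_tensor_def by (subst prod.remove[of _ j]) (auto simp: axis_def intro!: prod.cong)

lemma spline_one_sided:
  assumes u: "u \<in> S" and x: "x \<in> {0<..<1}"
  shows "\<exists>D. (u has_real_derivative D) (at_right x)" "\<exists>D. (u has_real_derivative D) (at_left x)"
proof -
  have "Ck_on (p - 1) {0<..<1} u" "ppoly p m u" using u by (auto simp: spline_space_eq spline_bc_def)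
  moreover from this have "isCont u x"
    using Ck_on_continuous[of "p - 1" "{0<..<1}" u] x by (simp add: continuous_on_eq_continuous_at)
  ultimately show "\<exists>D. (u has_real_derivative D) (at_right x)" "\<exists>D. (u has_real_derivative D) (at_left x)"
    using one_sided_deriv_ppoly[OF m _ _ x] by auto
qed

text \<open>Changing the integrand of \<open>system_op\<close> on a null set requires measurability
  of the original integrand, including the grid planes where \<open>grad\<close> may hold default
  values.\<close>

lemma grad_borel:
  fixes w :: "real ^ 'n::finite \<Rightarrow> real"
  assumes w: "w \<in> \<V>"
  shows "(\<lambda>x. indicator (box 0 1) x * grad w x $ j) \<in> borel_measurable borel"
proof -
  have [measurable]: "w \<in> borel_measurable borel" by (rule tensor_borel[OF w])
  \<comment> \<open>Limits of difference quotients along a fixed sequence are Borel functions; they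
    agree with the one-sided derivatives, which exist at every point of the box.\<close>
  define dr where "dr x = lim (\<lambda>n. (w (x + (1 / real (Suc n)) *\<^sub>R axis j 1) - w x) / (1 / real (Suc n)))" for x
  define dl where "dl x = lim (\<lambda>n. (w (x + (- 1 / real (Suc n)) *\<^sub>R axis j 1) - w x) / (- 1 / real (Suc n)))" for x
  have m': "(\<lambda>x. w (x + c)) \<in> borel_measurable borel" for c
    by measurable
  have [measurable]: "dr \<in> borel_measurable borel"
    unfolding dr_def[abs_def] by (intro borel_measurable_lim_metric borel_measurable_divide borel_measurable_diff m') simp_all
  have [measurable]: "dl \<in> borel_measurable borel"
    unfolding dl_def[abs_def] by (intro borel_measurable_lim_metric borel_measurable_divide borel_measurable_diff m') simp_all
  have g: "grad w x $ j = (if dr x = dl x then dr x else (SOME D. False))" if x: "x \<in> box 0 1" for x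
  proof -
    have xj: "x $ j \<in> {0<..<1}" using x by (auto simp: mem_box_cart)
    let ?P = "\<lambda>I. \<Prod>i\<in>UNIV - {j}. I i (x $ i)"
    have h: "w (x + t *\<^sub>R axis j 1) = (\<Sum>I\<in>Idx. coef w I * (I j (x $ j + t) * ?P I))" for t
      using tensor_expand[OF w, of "x + t *\<^sub>R axis j 1"] by (simp only: pure_tensor_line)
    have "\<exists>D. ((\<lambda>t. I j (x $ j + t)) has_real_derivative D) (at_right 0)" if "I \<in> Idx" for I
      by (rule exE[OF spline_one_sided(1)[OF Idx_S[OF that, of j] xj]], rule exI, rule shift_one_sided(1))
    then obtain R where R: "\<And>I. I \<in> Idx \<Longrightarrow> ((\<lambda>t. I j (x $ j + t)) has_real_derivative R I) (at_right 0)"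
      by metis
    have "\<exists>D. ((\<lambda>t. I j (x $ j + t)) has_real_derivative D) (at_left 0)" if "I \<in> Idx" for I
      by (rule exE[OF spline_one_sided(2)[OF Idx_S[OF that, of j] xj]], rule exI, rule shift_one_sided(2))
    then obtain L where L: "\<And>I. I \<in> Idx \<Longrightarrow> ((\<lambda>t. I j (x $ j + t)) has_real_derivative L I) (at_left 0)"
      by metis
    have "((\<lambda>t. w (x + t *\<^sub>R axis j 1)) has_real_derivative (\<Sum>I\<in>Idx. coef w I * (R I * ?P I))) (at_right 0)"
      unfolding h by (intro DERIV_sum DERIV_cmult DERIV_cmult_right R)
    moreover have "((\<lambda>t. w (x + t *\<^sub>R axis j 1)) has_real_derivative (\<Sum>I\<in>Idx. coef w I * (L I * ?P I))) (at_left 0)"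
      unfolding h by (intro DERIV_sum DERIV_cmult DERIV_cmult_right L)
    ultimately show ?thesis
      unfolding dr_def dl_def grad_def by (simp add: deriv_one_sided)
  qed
  have "(\<lambda>x. indicator (box 0 1) x * (if dr x = dl x then dr x else (SOME D. False))) \<in> borel_measurable borel"
    by measurable
  also have "(\<lambda>x. indicator (box 0 1) x * (if dr x = dl x then dr x else (SOME D. False))) =
      (\<lambda>x. indicator (box 0 1) x * grad w x $ j)"
    by (auto simp: fun_eq_iff g indicator_def)
  finally show ?thesis .
qed

section \<open>The system form and the smoother as Kronecker forms\<close>

lemma spline_deriv_pwc: "u \<in> S \<Longrightarrow> pwc (deriv u)"
  using spline_has_wd[OF p m] has_wd_deriv has_wd_pwc(2) pwc_spike by metis

lemma spline_has_deriv:
  assumes "u \<in> S" "x \<in> {0<..<1} - grid m"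
  shows "(u has_real_derivative deriv u x) (at x)"
  using assms by (intro ppoly_differentiable[OF m]) (auto simp: spline_space_eq spline_bc_def)

lemma grad_expand:
  fixes w :: "real ^ 'n::finite \<Rightarrow> real"
  assumes w: "w \<in> \<V>" and x: "\<And>i. x $ i \<in> {0<..<1} - grid m"
  shows "grad w x $ j = (\<Sum>I\<in>Idx. coef w I * pure_tensor (I(j := deriv (I j))) x)"
proof -
  have "((\<lambda>t. pure_tensor I (x + t *\<^sub>R axis j 1)) has_real_derivative pure_tensor (I(j := deriv (I j))) x) (at 0)"
    if I: "I \<in> Idx" for I
  proof -
    have d: "((\<lambda>t. I j (x $ j + t)) has_real_derivative deriv (I j) (x $ j)) (at 0)"
      using spline_has_deriv[OF Idx_S[OF I, of j] x[of j]] DERIV_at_within_shift[of "I j" _ "x $ j" 0 UNIV] by simp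
    have "pure_tensor (I(j := deriv (I j))) x = deriv (I j) (x $ j) * (\<Prod>i\<in>UNIV - {j}. I i (x $ i))"
      unfolding pure_tensor_def by (subst prod.remove[of _ j]) auto
    then show ?thesis unfolding pure_tensor_line by (auto intro!: derivative_eq_intros d)
  qed
  then have "((\<lambda>t. \<Sum>I\<in>Idx. coef w I * pure_tensor I (x + t *\<^sub>R axis j 1)) has_real_derivative
      (\<Sum>I\<in>Idx. coef w I * pure_tensor (I(j := deriv (I j))) x)) (at 0)"
    by (intro DERIV_sum DERIV_cmult)
  then show ?thesis unfolding grad_def tensor_expand[OF w, symmetric] by (simp add: DERIV_imp_deriv)
qed

lemma AE_off_grid: "AE x in lborel. \<forall>i::'n::finite. (x :: real ^ 'n) $ i \<notin> grid m"
proof -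
  have "AE x in lborel. (x :: real ^ 'n) $ i \<noteq> c" for i c
  proof -
    have "negligible {x :: real ^ 'n. x \<bullet> axis i 1 = c}"
      by (rule negligible_standard_hyperplane) (auto simp: Basis_vec_def)
    moreover have "{x :: real ^ 'n. x \<bullet> axis i 1 = c} \<in> sets lborel"
      by (simp add: closed_hyperplane borel_closed inner_commute)
    ultimately have "{x :: real ^ 'n. x \<bullet> axis i 1 = c} \<in> null_sets lborel"
      by (simp add: negligible_iff_null_sets null_sets_completion_iff)
    then show ?thesis by (rule AE_I') (auto simp: inner_axis)
  qed
  then have "AE x in lborel. \<forall>ic\<in>UNIV \<times> grid m. (x :: real ^ 'n) $ fst ic \<noteq> snd ic"
    by (intro AE_finite_allI) auto
  then show ?thesis by (rule AE_mp) (auto intro!: AE_I2)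
qed

abbreviation "Mn \<equiv> (\<lambda>_. l2_inner)"

definition aform :: "(real ^ 'n::finite \<Rightarrow> real) \<Rightarrow> (real ^ 'n \<Rightarrow> real) \<Rightarrow> real" where
  "aform w z = F Mn w z + (\<Sum>j\<in>UNIV. F (Mn(j := stiff_op)) w z)"

text \<open>Off the grid planes the integrand is a finite combination of pure tensors, whose
  integrals factor into univariate mass and stiffness terms.\<close>

lemma system_op_eq:
  fixes w z :: "real ^ 'n::finite \<Rightarrow> real"
  assumes w: "w \<in> \<V>" and z: "z \<in> \<V>"
  shows "system_op w z = aform w z"
proof -
  define g where "g I J j = (\<lambda>i t. if i = j then deriv (I i) t * deriv (J i) t else I i t * J i t)"
    for I J :: "'n \<Rightarrow> real \<Rightarrow> real" and j
  define f where "f I J = (\<lambda>i t. I i t * J i t)" for I J :: "'n \<Rightarrow> real \<Rightarrow> real"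
  let ?h = "\<lambda>x. \<Sum>I\<in>Idx. \<Sum>J\<in>Idx. coef w I * coef z J * (pure_tensor (f I J) x + (\<Sum>j\<in>UNIV. pure_tensor (g I J j) x))"
  have pg: "pwc (g I J j i)" if "I \<in> Idx" "J \<in> Idx" for I J j i
    using that by (cases "i = j") (simp_all add: g_def pwc_mult spline_deriv_pwc pwc Idx_S)
  have pf: "pwc (f I J i)" if "I \<in> Idx" "J \<in> Idx" for I J i
    using that by (simp add: f_def pwc_mult pwc Idx_S)
  have pt_g: "pure_tensor (I(j := deriv (I j))) x * pure_tensor (J(j := deriv (J j))) x = pure_tensor (g I J j) x" for I J j x
    unfolding pure_tensor_mult g_def by (rule arg_cong[where f="\<lambda>h. pure_tensor h x"]) (auto simp: fun_eq_iff)
  have pt_f: "pure_tensor I x * pure_tensor J x = pure_tensor (f I J) x" for I J x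
    by (simp add: pure_tensor_mult f_def)
  have pointwise: "grad w x \<bullet> grad z x + w x * z x = ?h x" if x: "x \<in> box 0 1" "\<forall>i. x $ i \<notin> grid m" for x
  proof -
    have x': "\<And>i. x $ i \<in> {0<..<1} - grid m" using x by (auto simp: mem_box_cart)
    have "grad w x \<bullet> grad z x = (\<Sum>j\<in>UNIV. (\<Sum>I\<in>Idx. \<Sum>J\<in>Idx. coef w I * coef z J * pure_tensor (g I J j) x))"
      unfolding inner_vec_def
      by (intro sum.cong refl)
        (simp add: grad_expand[OF w x'] grad_expand[OF z x'] sum_product pt_g[symmetric] mult_ac)
    also have "\<dots> = (\<Sum>I\<in>Idx. \<Sum>j\<in>UNIV. \<Sum>J\<in>Idx. coef w I * coef z J * pure_tensor (g I J j) x)"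
      by (rule sum.swap)
    also have "\<dots> = (\<Sum>I\<in>Idx. \<Sum>J\<in>Idx. \<Sum>j\<in>UNIV. coef w I * coef z J * pure_tensor (g I J j) x)"
      by (intro sum.cong refl sum.swap)
    finally have 1: "grad w x \<bullet> grad z x = (\<Sum>I\<in>Idx. \<Sum>J\<in>Idx. coef w I * coef z J * (\<Sum>j\<in>UNIV. pure_tensor (g I J j) x))"
      by (simp add: sum_distrib_left)
    have 2: "w x * z x = (\<Sum>I\<in>Idx. \<Sum>J\<in>Idx. coef w I * coef z J * pure_tensor (f I J) x)"
      by (simp add: tensor_expand[OF w, of x] tensor_expand[OF z, of x] sum_product pt_f[symmetric] mult_ac)
    show ?thesis unfolding 1 2 by (simp add: sum.distrib[symmetric] distrib_left add.commute)
  qed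
  have ig: "set_integrable lborel (box 0 1) (pure_tensor (g I J j))"
    and eg: "(LINT x:box 0 1|lborel. pure_tensor (g I J j) x) = (\<Prod>i\<in>UNIV. (Mn(j := stiff_op)) i (I i) (J i))"
    if "I \<in> Idx" "J \<in> Idx" for I J j
  proof -
    show "set_integrable lborel (box 0 1) (pure_tensor (g I J j))"
      by (rule box_integral_pure_tensor(1)[OF pg[OF that]])
    show "(LINT x:box 0 1|lborel. pure_tensor (g I J j) x) = (\<Prod>i\<in>UNIV. (Mn(j := stiff_op)) i (I i) (J i))"
      unfolding box_integral_pure_tensor(2)[OF pg[OF that]]
      by (intro prod.cong refl) (simp add: g_def stiff_op_def l2_inner_def)
  qed
  have if': "set_integrable lborel (box 0 1) (pure_tensor (f I J))"
    and ef: "(LINT x:box 0 1|lborel. pure_tensor (f I J) x) = (\<Prod>i\<in>UNIV. l2_inner (I i) (J i))"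
    if "I \<in> Idx" "J \<in> Idx" for I J
  proof -
    show "set_integrable lborel (box 0 1) (pure_tensor (f I J))"
      by (rule box_integral_pure_tensor(1)[OF pf[OF that]])
    show "(LINT x:box 0 1|lborel. pure_tensor (f I J) x) = (\<Prod>i\<in>UNIV. l2_inner (I i) (J i))"
      unfolding box_integral_pure_tensor(2)[OF pf[OF that]]
      by (intro prod.cong refl) (simp add: f_def l2_inner_def)
  qed
  have hb: "has_bochner_integral lborel (\<lambda>x. indicator (box 0 1) x *\<^sub>R pure_tensor h x) (LINT x:box 0 1|lborel. pure_tensor h x)"
    if "set_integrable lborel (box 0 1) (pure_tensor h)" for h :: "'n \<Rightarrow> real \<Rightarrow> real"
    using that unfolding set_integrable_def set_lebesgue_integral_def by (rule has_bochner_integral_integrable)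
  let ?v = "\<lambda>I J. (\<Prod>i\<in>UNIV. l2_inner (I i) (J i)) + (\<Sum>j\<in>UNIV. \<Prod>i\<in>UNIV. (Mn(j := stiff_op)) i (I i) (J i))"
  have "has_bochner_integral lborel (\<lambda>x. \<Sum>I\<in>Idx. \<Sum>J\<in>Idx. coef w I * coef z J *
      (indicator (box 0 1) x *\<^sub>R pure_tensor (f I J) x + (\<Sum>j\<in>UNIV. indicator (box 0 1) x *\<^sub>R pure_tensor (g I J j) x)))
      (\<Sum>I\<in>Idx. \<Sum>J\<in>Idx. coef w I * coef z J * ?v I J)"
  proof (intro has_bochner_integral_sum has_bochner_integral_mult_right has_bochner_integral_add)
    fix I J :: "'n \<Rightarrow> real \<Rightarrow> real" and j assume IJ: "I \<in> Idx" "J \<in> Idx"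
    show "has_bochner_integral lborel (\<lambda>x. indicator (box 0 1) x *\<^sub>R pure_tensor (f I J) x)
        (\<Prod>i\<in>UNIV. l2_inner (I i) (J i))"
      using hb[OF if'[OF IJ]] unfolding ef[OF IJ] .
    show "has_bochner_integral lborel (\<lambda>x. indicator (box 0 1) x *\<^sub>R pure_tensor (g I J j) x)
        (\<Prod>i\<in>UNIV. (Mn(j := stiff_op)) i (I i) (J i))"
      using hb[OF ig[OF IJ]] unfolding eg[OF IJ] .
  qed
  also have "(\<lambda>x. \<Sum>I\<in>Idx. \<Sum>J\<in>Idx. coef w I * coef z J *
      (indicator (box 0 1) x *\<^sub>R pure_tensor (f I J) x + (\<Sum>j\<in>UNIV. indicator (box 0 1) x *\<^sub>R pure_tensor (g I J j) x))) =
      (\<lambda>x. indicator (box 0 1) x *\<^sub>R ?h x)"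
    by (auto simp: fun_eq_iff indicator_def)
  finally have hbi: "has_bochner_integral lborel (\<lambda>x. indicator (box 0 1) x *\<^sub>R ?h x)
      (\<Sum>I\<in>Idx. \<Sum>J\<in>Idx. coef w I * coef z J * ?v I J)" .
  have "system_op w z = (LINT x:box 0 1|lborel. ?h x)"
    unfolding system_op_def set_lebesgue_integral_def
  proof (rule integral_cong_AE)
    have [measurable]: "w \<in> borel_measurable borel" "z \<in> borel_measurable borel"
      using tensor_borel w z by auto
    note [measurable] = grad_borel[OF w] grad_borel[OF z]
    have "(\<lambda>x. (\<Sum>j\<in>UNIV. (indicator (box 0 1) x * grad w x $ j) * (indicator (box 0 1) x * grad z x $ j)) +
        indicator (box 0 1) x * (w x * z x)) \<in> borel_measurable borel"
      by measurable
    also have "(\<lambda>x. (\<Sum>j\<in>UNIV. (indicator (box 0 1) x * grad w x $ j) * (indicator (box 0 1) x * grad z x $ j)) +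
        indicator (box 0 1) x * (w x * z x)) =
      (\<lambda>x. indicat_real (box 0 1) x *\<^sub>R (grad w x \<bullet> grad z x + w x * z x))"
      by (auto simp: fun_eq_iff indicator_def inner_vec_def)
    finally show "(\<lambda>x. indicat_real (box 0 1) x *\<^sub>R (grad w x \<bullet> grad z x + w x * z x)) \<in> borel_measurable lborel"
      by simp
    show "(\<lambda>x. indicat_real (box 0 1) x *\<^sub>R ?h x) \<in> borel_measurable lborel"
      using hbi by (rule borel_measurable_has_bochner_integral)
    show "AE x in lborel. indicat_real (box 0 1) x *\<^sub>R (grad w x \<bullet> grad z x + w x * z x) =
        indicat_real (box 0 1) x *\<^sub>R ?h x"
      by (rule AE_mp[OF AE_off_grid]) (auto intro!: AE_I2 simp: pointwise indicator_def)
  qed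
  also have "\<dots> = (\<Sum>I\<in>Idx. \<Sum>J\<in>Idx. coef w I * coef z J * ?v I J)"
    using has_bochner_integral_integral_eq[OF hbi] by (simp add: set_lebesgue_integral_def)
  also have "\<dots> = aform w z"
    unfolding aform_def kron_def
    by (simp add: distrib_left sum.distrib sum_distrib_left) (simp add: sum.swap[of _ UNIV])
  finally show ?thesis .
qed

sublocale Q: ritz_space S l2_inner "spline_space0 p m" stiff_op "real m"
  by (rule spline_ritz_space[OF p m m]) simp

lemma lin_id: "lin_on S (\<lambda>u. u)"
  by (simp add: lin_on_def)

lemma lin_compl: "lin_on S T \<Longrightarrow> lin_on S (\<lambda>u. u - T u)"
  by (auto simp: lin_on_def algebra_simps)

lemma form_cong:
  "(\<And>i u v. u \<in> S \<Longrightarrow> v \<in> S \<Longrightarrow> X i u v = Y i u v) \<Longrightarrow> F X w z = F Y w z"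
  using kron_cong[of E X Y] basis(2) by (metis subsetD)

lemma tensor_map_id:
  fixes w :: "real ^ 'n::finite \<Rightarrow> real"
  assumes w: "w \<in> \<V>"
  shows "tensor_map (\<lambda>_. S) (\<lambda>_ u. u) w = w"
  using tensor_map_eval[OF w, of "\<lambda>_ u. u"] tensor_expand[OF w] by (auto simp: lin_id fun_eq_iff)

lemma slot_psform: "psform S X \<Longrightarrow> psform S ((Mn(j := X)) i)"
  by (simp add: psform_axioms)

lemma aform_pdform: "pdform \<V> (aform :: (real ^ 'n::finite \<Rightarrow> real) \<Rightarrow> _)"
  unfolding aform_def[abs_def]
  by (intro pdform_add mass_pdform psform_sum \<V>_subspace form_psform slot_psform K.psform_axioms)

lemma system_pdform: "pdform \<V> (system_op :: (real ^ 'n::finite \<Rightarrow> real) \<Rightarrow> _)"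
  by (rule pdform_cong[OF aform_pdform system_op_eq])

lemma split_proj_eq: "split_proj p m b u = (if b then u - Q.Q u else Q.Q u)"
proof -
  have "l2_proj W u = oproj l2_inner W u" for W
    by (simp add: l2_proj_def oproj_def fun_diff_def)
  then show ?thesis by (auto simp: split_proj_def fun_diff_def)
qed

lemma split_proj_lin: "lin_on S (split_proj p m b)"
  unfolding split_proj_eq[abs_def] using Q.oproj_lin lin_compl by (cases b) auto

lemma split_space_subset: "split_space p m b \<subseteq> S"
  by (auto simp: split_space_def spline_space0_def spline_space1_def)

lemma split_proj_in:
  assumes u: "u \<in> S"
  shows "split_proj p m b u \<in> split_space p m b"
  using Q.oproj_in[OF u] Q.oproj_orth[OF u] u by (auto simp: split_proj_eq split_space_def spline_space1_def)

lemma split_proj_S: "u \<in> S \<Longrightarrow> split_proj p m b u \<in> S"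
  using split_proj_in split_space_subset by blast

lemma split_proj_idem: "u \<in> S \<Longrightarrow> split_proj p m b (split_proj p m b u) = split_proj p m b u"
  using lin_on_diff[OF Q.oproj_lin sub, of u "Q.Q u"] Q.oproj_id[OF Q.oproj_in[of u]]
  by (auto simp: split_proj_eq)

lemma tensor_op_split:
  fixes w z :: "real ^ 'n::finite \<Rightarrow> real"
  assumes w: "w \<in> \<V>" and z: "z \<in> \<V>" and B: "\<And>i. bilin_on S (B i)"
    and eq: "\<And>i u v. u \<in> S \<Longrightarrow> v \<in> S \<Longrightarrow> B i (split_proj p m (\<alpha> i) u) (split_proj p m (\<alpha> i) v) = B' i u v"
  shows "tensor_op (\<lambda>i. split_space p m (\<alpha> i)) B (tensor_split_proj p m \<alpha> w) (tensor_split_proj p m \<alpha> z) = F B' w z"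
proof -
  have in_: "tensor_split_proj p m \<alpha> w \<in> tensor_space (\<lambda>i. split_space p m (\<alpha> i))" if "w \<in> \<V>" for w
    unfolding tensor_split_proj_def
    by (rule tensor_map_in[OF that]) (rule split_proj_lin split_proj_in split_space_subset, assumption?)+
  have "tensor_op (\<lambda>i. split_space p m (\<alpha> i)) B (tensor_split_proj p m \<alpha> w) (tensor_split_proj p m \<alpha> z) =
      F B (tensor_split_proj p m \<alpha> w) (tensor_split_proj p m \<alpha> z)"
    by (rule tensor_op_eq[OF in_[OF w] in_[OF z] split_space_subset B])
  also have "\<dots> = F (\<lambda>i u v. B i (split_proj p m (\<alpha> i) u) (split_proj p m (\<alpha> i) v)) w z"
    unfolding tensor_split_proj_def
    by (rule form_map[OF w _ _ z]) (rule split_proj_lin split_proj_S B, assumption?)+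
  also have "\<dots> = F B' w z" by (rule form_cong) (rule eq)
  finally show ?thesis .
qed

text \<open>The univariate form that takes the place of the stiffness in a slot once the local
  smoothers are summed: sigma times mass on \<open>S\<^sub>0\<close>, stiffness on its complement,
  and no coupling between the two.\<close>

definition khat :: "(real \<Rightarrow> real) \<Rightarrow> (real \<Rightarrow> real) \<Rightarrow> real" where
  "khat u v = smoother_sigma m * l2_inner (Q.Q u) (Q.Q v) + stiff_op (u - Q.Q u) (v - Q.Q v)"

definition lform :: "(real ^ 'n::finite \<Rightarrow> real) \<Rightarrow> (real ^ 'n \<Rightarrow> real) \<Rightarrow> real" where
  "lform w z = F Mn w z + (\<Sum>j\<in>UNIV. F (Mn(j := khat)) w z)"

text \<open>Summing the local smoothers over all \<open>\<alpha>\<close> recombines each mass factor to the full mass form.\<close>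

lemma smoother_eq:
  fixes w z :: "real ^ 'n::finite \<Rightarrow> real"
  assumes w: "w \<in> \<V>" and z: "z \<in> \<V>"
  shows "smoother p m w z = lform w z"
proof -
  let ?\<sigma> = "smoother_sigma m"
  let ?P = "split_proj p m"
  define mm where "mm b u v = l2_inner (?P b u) (?P b v)" for b u v
  define kap where "kap b u v = (if b then stiff_op (?P b u) (?P b v) else ?\<sigma> * mm b u v)" for b u v
  define \<kappa> where "\<kappa> = (stiff_part p m)(False := \<lambda>u v. ?\<sigma> * mass_part p m False u v)"
  have bm: "bilin_on S (mass_part p m b)" for b
    unfolding mass_part_def[abs_def] mass_op_def
    by (rule bilin_on_comp[OF bilin split_proj_lin split_proj_lin split_proj_S split_proj_S])
  have bs: "bilin_on S (stiff_part p m b)" for b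
    unfolding stiff_part_def[abs_def]
    by (rule bilin_on_comp[OF K.bilin split_proj_lin split_proj_lin split_proj_S split_proj_S])
  have bk: "bilin_on S (\<kappa> b)" for b
    using bm[of False] bs by (cases b) (auto simp: \<kappa>_def bilin_on_def lin_on_def algebra_simps)
  have em: "mass_part p m b (?P b u) (?P b v) = mm b u v" if "u \<in> S" "v \<in> S" for b u v
    using that by (simp add: mass_part_def mass_op_def mm_def split_proj_idem)
  have ek: "\<kappa> b (?P b u) (?P b v) = kap b u v" if "u \<in> S" "v \<in> S" for b u v
    using that em[OF that, of False] by (cases b) (simp_all add: \<kappa>_def kap_def stiff_part_def split_proj_idem)
  have loc: "local_smoother p m \<alpha> (tensor_split_proj p m \<alpha> w) (tensor_split_proj p m \<alpha> z) =
      F (\<lambda>i. mm (\<alpha> i)) w z + (\<Sum>j\<in>UNIV. F (\<lambda>i. if i = j then kap (\<alpha> i) else mm (\<alpha> i)) w z)" for \<alpha> :: "'n \<Rightarrow> bool"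
    unfolding local_smoother_def subspace_expr_def \<kappa>_def[symmetric]
  proof (intro arg_cong2[where f="(+)"] sum.cong refl)
    show "tensor_op (\<lambda>i. split_space p m (\<alpha> i)) (\<lambda>i. mass_part p m (\<alpha> i)) (tensor_split_proj p m \<alpha> w)
        (tensor_split_proj p m \<alpha> z) = F (\<lambda>i. mm (\<alpha> i)) w z"
      by (rule tensor_op_split[OF w z]) (auto simp: bm em)
    fix j
    show "tensor_op (\<lambda>i. split_space p m (\<alpha> i)) (\<lambda>i. if i = j then \<kappa> (\<alpha> i) else mass_part p m (\<alpha> i))
        (tensor_split_proj p m \<alpha> w) (tensor_split_proj p m \<alpha> z) =
        F (\<lambda>i. if i = j then kap (\<alpha> i) else mm (\<alpha> i)) w z"
      by (rule tensor_op_split[OF w z]) (auto simp: bm bk em ek)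
  qed
  have sm: "mm False u v + mm True u v = l2_inner u v" if "u \<in> S" "v \<in> S" for u v
    using Q.oproj_split[OF that] by (simp add: mm_def split_proj_eq)
  have sk: "kap False u v + kap True u v = khat u v" for u v
    by (simp add: kap_def khat_def mm_def split_proj_eq)
  have 1: "(\<Sum>\<alpha>\<in>UNIV. F (\<lambda>i::'n. mm (\<alpha> i)) w z) = F Mn w z"
    unfolding kron_bool_sum[of E "\<lambda>_. mm"] by (rule form_cong) (rule sm)
  have 2: "(\<Sum>\<alpha>\<in>UNIV. F (\<lambda>i. if i = j then kap (\<alpha> i) else mm (\<alpha> i)) w z) = F (Mn(j := khat)) w z" for j
  proof -
    have "(\<Sum>\<alpha>\<in>UNIV. F (\<lambda>i. if i = j then kap (\<alpha> i) else mm (\<alpha> i)) w z) =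
        F (\<lambda>i a b. (if i = j then kap False else mm False) a b + (if i = j then kap True else mm True) a b) w z"
      using kron_bool_sum[of E "\<lambda>i b. if i = j then kap b else mm b" "coef w" "coef z"] by simp
    also have "\<dots> = F (Mn(j := khat)) w z" by (rule form_cong) (simp add: sm sk)
    finally show ?thesis .
  qed
  have "smoother p m w z = (\<Sum>\<alpha>\<in>UNIV. F (\<lambda>i. mm (\<alpha> i)) w z) +
      (\<Sum>\<alpha>\<in>UNIV. \<Sum>j\<in>UNIV. F (\<lambda>i. if i = j then kap (\<alpha> i) else mm (\<alpha> i)) w z)"
    unfolding smoother_def loc by (rule sum.distrib)
  also have "(\<Sum>\<alpha>\<in>UNIV. \<Sum>j\<in>UNIV. F (\<lambda>i. if i = j then kap (\<alpha> i) else mm (\<alpha> i)) w z) =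
      (\<Sum>j\<in>UNIV. \<Sum>\<alpha>\<in>UNIV. F (\<lambda>i. if i = j then kap (\<alpha> i) else mm (\<alpha> i)) w z)"
    by (rule sum.swap)
  finally show ?thesis by (simp only: 1 2 lform_def)
qed

section \<open>Comparison of the smoother with the system form\<close>

lemma sigma_eq: "smoother_sigma m = 12 * (real m)\<^sup>2"
  using m by (simp add: smoother_sigma_def Let_def power_divide)

lemma khat_psform: "psform S khat"
proof -
  have "psform S (\<lambda>u v. smoother_sigma m * l2_inner (Q.Q u) (Q.Q v))"
    using psform_scale[OF psform_comp[OF psform_axioms Q.oproj_lin Q.oproj_inV], of "smoother_sigma m"]
    by (simp add: sigma_eq)
  moreover have "psform S (\<lambda>u v. stiff_op (u - Q.Q u) (v - Q.Q v))"
    by (rule psform_comp[OF K.psform_axioms lin_compl[OF Q.oproj_lin]]) simp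
  ultimately show ?thesis unfolding khat_def[abs_def] by (rule psform_add)
qed

lemma lform_pdform: "pdform \<V> (lform :: (real ^ 'n::finite \<Rightarrow> real) \<Rightarrow> _)"
  unfolding lform_def[abs_def]
  by (intro pdform_add mass_pdform psform_sum \<V>_subspace form_psform slot_psform khat_psform)

lemma smoother_pdform: "pdform \<V> (smoother p m :: (real ^ 'n::finite \<Rightarrow> real) \<Rightarrow> _)"
  by (rule pdform_cong[OF lform_pdform smoother_eq])

lemma slot_form_le: "form_le X Y \<Longrightarrow> form_le ((Mn(j := X)) i) ((Mn(j := Y)) i)"
  using form_le_refl[OF psform_axioms] by simp

text \<open>The factor 2 pays for the cross term between the two components, and
  \<open>smoother_sigma\<close> is exactly the constant of the inverse inequality. Hence the damping
  1/2.\<close>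

lemma stiff_le_khat: "u \<in> S \<Longrightarrow> stiff_op u u \<le> 2 * khat u u"
proof -
  assume u: "u \<in> S"
  have "stiff_op u u = stiff_op (Q.Q u + (u - Q.Q u)) (Q.Q u + (u - Q.Q u))" by simp
  also have "\<dots> \<le> 2 * stiff_op (Q.Q u) (Q.Q u) + 2 * stiff_op (u - Q.Q u) (u - Q.Q u)"
    by (rule K.square_add_le) (use u in auto)
  also have "\<dots> \<le> 2 * khat u u"
    using Q.inverse[OF Q.oproj_in[OF u]] by (simp add: khat_def sigma_eq)
  finally show ?thesis .
qed

lemma aform_le_lform:
  fixes w :: "real ^ 'n::finite \<Rightarrow> real"
  shows "aform w w \<le> 2 * lform w w"
proof -
  have "F (Mn(j := stiff_op)) w w \<le> 2 * F (Mn(j := khat)) w w" for j :: 'n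
  proof -
    have "F (Mn(j := stiff_op)) w w \<le> F (Mn(j := \<lambda>u v. 2 * khat u v)) w w"
      by (intro form_mono slot_form_le)
        (use stiff_le_khat K.psform_axioms psform_scale[OF khat_psform] in \<open>auto simp: form_le_def\<close>)
    then show ?thesis by (simp only: kron_slot_scale)
  qed
  then have "(\<Sum>j\<in>UNIV. F (Mn(j := stiff_op)) w w) \<le> 2 * (\<Sum>j\<in>UNIV. F (Mn(j := khat)) w w)"
    by (simp add: sum_distrib_left sum_mono)
  moreover have "0 \<le> F Mn w w" by (rule form_nonneg[OF psform_axioms])
  ultimately show ?thesis by (simp add: aform_def lform_def)
qed

text \<open>The smoother exceeds a multiple of the system form at most by a mass term of order
  \<open>m\<^sup>2\<close>. For coarse-grid errors that term is compensated by the duality estimate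
  \<open>aubin_nitsche\<close>.\<close>

lemma lform_le:
  fixes w :: "real ^ 'n::finite \<Rightarrow> real"
  shows "lform w w \<le> 26 * aform w w + real CARD('n) * (12 * (real m)\<^sup>2) * F Mn w w"
proof -
  let ?\<sigma> = "12 * (real m)\<^sup>2"
  have le: "form_le khat (\<lambda>u v. ?\<sigma> * l2_inner u v + 26 * stiff_op u v)"
    unfolding form_le_def
  proof (intro conjI ballI khat_psform psform_add psform_scale psform_axioms K.psform_axioms)
    fix u assume u: "u \<in> S"
    have "?\<sigma> * l2_inner (Q.Q u) (Q.Q u) \<le> ?\<sigma> * l2_inner u u"
      using Q.oproj_le[OF u] by (intro mult_left_mono) auto
    then show "khat u u \<le> ?\<sigma> * l2_inner u u + 26 * stiff_op u u"
      using Q.proj_bounds(3)[OF u] by (simp add: khat_def sigma_eq)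
  qed auto
  have "F (Mn(j := khat)) w w \<le> ?\<sigma> * F Mn w w + 26 * F (Mn(j := stiff_op)) w w" for j :: 'n
  proof -
    have "F (Mn(j := khat)) w w \<le> F (Mn(j := \<lambda>u v. ?\<sigma> * l2_inner u v + 26 * stiff_op u v)) w w"
      by (intro form_mono slot_form_le le)
    also have "\<dots> = ?\<sigma> * F (Mn(j := l2_inner)) w w + 26 * F (Mn(j := stiff_op)) w w"
      by (simp only: kron_slot_add kron_slot_scale)
    also have "Mn(j := l2_inner) = Mn" by auto
    finally show ?thesis .
  qed
  then have "(\<Sum>j\<in>UNIV. F (Mn(j := khat)) w w) \<le> (\<Sum>j\<in>(UNIV :: 'n set). ?\<sigma> * F Mn w w + 26 * F (Mn(j := stiff_op)) w w)"
    by (intro sum_mono) blast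
  also have "\<dots> = real CARD('n) * ?\<sigma> * F Mn w w + 26 * (\<Sum>j\<in>(UNIV :: 'n set). F (Mn(j := stiff_op)) w w)"
    by (simp add: sum.distrib sum_distrib_left)
  finally show ?thesis
    using form_nonneg[of Mn w, OF psform_axioms] by (simp add: aform_def lform_def)
qed

end

section \<open>The coarse-grid approximation property\<close>

locale coarse_splines = spline_basis +
  assumes even: "even m"
begin

lemma coarse_pos: "0 < m div 2" and coarse_dvd: "m div 2 dvd m"
  using even m by (auto elim!: evenE)

sublocale C: ritz_space S l2_inner "spline_space0 p (m div 2)" stiff_op "real (m div 2)"
  by (rule spline_ritz_space[OF p coarse_pos m coarse_dvd])

abbreviation "H \<equiv> 1 / real (m div 2)"

abbreviation "\<V>\<^sub>c \<equiv> tensor_space (\<lambda>_. spline_space p (m div 2))"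

lemma coarse_subspace: "subspace \<V>\<^sub>c"
  by (rule tensor_space_subspace) (rule spline_subspace[OF p coarse_pos])

lemma coarse_subset: "\<V>\<^sub>c \<subseteq> \<V>"
  by (rule tensor_space_mono) (rule spline_space_refine(1)[OF p coarse_pos m coarse_dvd])

lemma coarse_proj_subset: "spline_space0 p (m div 2) \<subseteq> spline_space p (m div 2)"
  by (rule spline_space_refine(2)[OF p coarse_pos m coarse_dvd])

text \<open>
  With \<open>D\<close> the discrete Laplacian, \<open>w\<close> solves the discrete problem with right-hand side
  \<open>e\<close>, i.e. \<open>e = w + (\<Sum>j. D\<^sub>j w)\<close>.  The operators \<open>D\<^sub>j\<close> commute and are positive semidefinite, so the
  cross terms of \<open>|e|\<^sup>2\<close> are nonnegative: this is full elliptic regularity on the discrete level.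
\<close>

lemma discrete_regularity:
  fixes w e :: "real ^ 'n::finite \<Rightarrow> real"
  assumes w: "w \<in> \<V>" and e: "e \<in> \<V>" and we: "\<And>v. v \<in> \<V> \<Longrightarrow> aform w v = F Mn e v"
    and D: "lin_on S D" "\<And>u. u \<in> S \<Longrightarrow> D u \<in> S" "\<And>u v. u \<in> S \<Longrightarrow> v \<in> S \<Longrightarrow> l2_inner (D u) v = stiff_op u v"
  defines "K2 \<equiv> \<lambda>u v. l2_inner (D u) (D v)"
  shows "2 * F (Mn(j := stiff_op)) w w + (F (Mn(j := K2)) w w +
    (\<Sum>k\<in>UNIV - {j}. F (Mn(j := stiff_op, k := stiff_op)) w w)) \<le> F Mn e e"
proof -
  interpret Mf: pdform \<V> "F (Mn :: 'n \<Rightarrow> _)" by (rule mass_pdform)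
  define T where "T j = (\<lambda>_ u. u)(j := D)" for j :: 'n
  have T: "\<And>i. lin_on S (T j i)" "\<And>i u. u \<in> S \<Longrightarrow> T j i u \<in> S" for j
    using D lin_id by (auto simp: T_def)
  define G where "G j = tensor_map (\<lambda>_. S) (T j) w" for j
  have GV: "G j \<in> \<V>" for j
    unfolding G_def by (rule tensor_map_in[OF w T]) auto
  have FG: "F Mn (G j) v = F (Mn(j := stiff_op)) w v" if v: "v \<in> \<V>" for j v
  proof -
    have "F Mn (G j) v = F Mn (G j) (tensor_map (\<lambda>_. S) (\<lambda>_ u. u) v)" using tensor_map_id[OF v] by simp
    also have "\<dots> = F (\<lambda>i u v. l2_inner (T j i u) v) w v"
      unfolding G_def by (rule form_map[OF w T v lin_id _ bilin])
    also have "\<dots> = F (Mn(j := stiff_op)) w v" by (rule form_cong) (simp add: T_def D(3))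
    finally show ?thesis .
  qed
  \<comment> \<open>The mass product of \<open>D\<^sub>j w\<close> and \<open>D\<^sub>k w\<close>:
    in distinct slots each \<open>D\<close> turns mass into stiffness, in a common slot the two
    combine to \<open>K2\<close>.\<close>
  define R where "R j k = (if j = k then F (Mn(j := K2)) w w else F (Mn(j := stiff_op, k := stiff_op)) w w)" for j k :: 'n
  have FGG: "F Mn (G j) (G k) = R j k" for j k
  proof -
    have "F Mn (G j) (G k) = F (\<lambda>i u v. l2_inner (T j i u) (T k i v)) w w"
      unfolding G_def by (rule form_map[OF w T w T bilin])
    also have "\<dots> = R j k"
    proof (cases "j = k")
      case True
      then have "R j k = F (Mn(j := K2)) w w" by (simp add: R_def)
      then show ?thesis using True by (simp only:) (rule form_cong, simp add: T_def K2_def)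
    next
      case False
      have "l2_inner u (D v) = stiff_op u v" if "u \<in> S" "v \<in> S" for u v
        using D(3)[OF that(2,1)] sym[OF that(1) D(2)[OF that(2)]] K.sym[OF that] by simp
      then have "F (\<lambda>i u v. l2_inner (T j i u) (T k i v)) w w = F (Mn(j := stiff_op, k := stiff_op)) w w"
        by (intro form_cong) (use False D(3) in \<open>auto simp: T_def\<close>)
      then show ?thesis using False by (simp add: R_def)
    qed
    finally show ?thesis .
  qed
  have K2: "psform S K2" unfolding K2_def by (rule psform_comp[OF psform_axioms D(1,2)])
  have Fj: "0 \<le> F (Mn(j := stiff_op)) w w" for j
    by (rule form_nonneg, rule slot_psform[OF K.psform_axioms])
  have R0: "0 \<le> R j k" for j k
  proof -
    have "0 \<le> F (Mn(j := K2)) w w" by (rule form_nonneg, rule slot_psform[OF K2])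
    moreover have "0 \<le> F (Mn(j := stiff_op, k := stiff_op)) w w"
      by (rule form_nonneg) (simp add: psform_axioms K.psform_axioms)
    ultimately show ?thesis unfolding R_def by (split if_split) (intro conjI impI)
  qed
  define G' where "G' = (\<Sum>j\<in>UNIV. G j)"
  have G'V: "G' \<in> \<V>" unfolding G'_def by (rule subspace_sum[OF \<V>_subspace GV])
  have FG': "F Mn G' v = (\<Sum>j\<in>UNIV. F (Mn(j := stiff_op)) w v)" if "v \<in> \<V>" for v
    unfolding G'_def by (subst Mf.sum_left) (use GV that FG in auto)
  have "e = w + G'"
  proof (rule Mf.eqI[OF e])
    show "w + G' \<in> \<V>" using w G'V by (rule Mf.closed)
    fix v :: "real ^ 'n \<Rightarrow> real" assume v: "v \<in> \<V>"
    show "F Mn e v = F Mn (w + G') v"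
      using we[OF v] Mf.add_left[OF w G'V v] FG'[OF v] by (simp add: aform_def)
  qed
  then have "F Mn e e = F Mn w w + 2 * F Mn G' w + F Mn G' G'"
    using w G'V by (simp add: Mf.square_add Mf.sym[of w G'])
  also have "F Mn G' G' = (\<Sum>j\<in>UNIV. \<Sum>k\<in>UNIV. R j k)"
  proof -
    have "F Mn G' G' = (\<Sum>j\<in>UNIV. F Mn (G j) G')"
      by (subst (1) G'_def, subst Mf.sum_left) (use GV G'V in auto)
    also have "\<dots> = (\<Sum>j\<in>UNIV. \<Sum>k\<in>UNIV. F Mn (G j) (G k))"
      by (intro sum.cong refl, subst G'_def, subst Mf.sum_right) (use GV in auto)
    finally show ?thesis by (simp add: FGG)
  qed
  finally have ee: "F Mn e e = F Mn w w + 2 * (\<Sum>j\<in>UNIV. F (Mn(j := stiff_op)) w w) + (\<Sum>j\<in>UNIV. \<Sum>k\<in>UNIV. R j k)"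
    by (simp add: FG'[OF w])
  have "F (Mn(j := stiff_op)) w w \<le> (\<Sum>j\<in>UNIV. F (Mn(j := stiff_op)) w w)"
    by (rule member_le_sum) (auto simp: Fj)
  \<comment> \<open>All entries are nonnegative, so the double sum may be cut down to row
    \<open>j\<close>.\<close>
  moreover have "(\<Sum>k\<in>UNIV. R j k) \<le> (\<Sum>j\<in>UNIV. \<Sum>k\<in>UNIV. R j k)"
    by (rule member_le_sum) (auto simp: R0 sum_nonneg)
  moreover have "(\<Sum>k\<in>UNIV. R j k) = R j j + (\<Sum>k\<in>UNIV - {j}. R j k)"
    by (rule sum.remove) auto
  moreover have "(\<Sum>k\<in>UNIV - {j}. R j k) = (\<Sum>k\<in>UNIV - {j}. F (Mn(j := stiff_op, k := stiff_op)) w w)"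
    by (intro sum.cong refl) (auto simp: R_def)
  moreover have "0 \<le> F Mn w w" by (rule Mf.nonneg[OF w])
  ultimately show ?thesis using ee by (simp add: R_def)
qed

lemma slot_bound:
  assumes X: "\<And>i. form_le (X i) (Y i)"
    and Y: "Y = (Mn :: 'n::finite \<Rightarrow> _)(j := \<lambda>u v. r * Z u v)"
  shows "F X w w \<le> r * F (Mn(j := Z)) w w"
  using form_mono[of X Y w] X unfolding Y kron_slot_scale by blast

lemma two_slot_bound:
  assumes X: "\<And>i. form_le (X i) (Y i)" and jk: "j \<noteq> k"
    and Y: "Y = (Mn :: 'n::finite \<Rightarrow> _)(j := \<lambda>u v. r * Z u v, k := \<lambda>u v. s * Z' u v)"
  shows "F X w w \<le> r * s * F (Mn(j := Z, k := Z')) w w"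
proof -
  have "F X w w \<le> F Y w w" by (rule form_mono[OF X])
  also have "\<dots> = s * F (Mn(j := \<lambda>u v. r * Z u v, k := Z')) w w" unfolding Y by (rule kron_slot_scale)
  also have "Mn(j := \<lambda>u v. r * Z u v, k := Z') = Mn(k := Z', j := \<lambda>u v. r * Z u v)"
    using jk by (rule fun_upd_twist)
  also have "s * F (Mn(k := Z', j := \<lambda>u v. r * Z u v)) w w = s * (r * F (Mn(k := Z', j := Z)) w w)"
    by (simp only: kron_slot_scale)
  also have "Mn(k := Z', j := Z) = Mn(j := Z, k := Z')" using jk by (rule fun_upd_twist[OF not_sym])
  finally show ?thesis by (simp only: mult_ac)
qed

text \<open>Slot \<open>j\<close> carries a projection error and yields \<open>H\<^sup>2\<close> at
  the price of one more stiffness order in that slot (mass to stiffness, stiffness to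
  \<open>K2\<close>). The other slots contribute only stability constants. The resulting forms are
  exactly those controlled by \<open>discrete_regularity\<close>.\<close>

lemma increment_bound:
  fixes w e :: "real ^ 'n::finite \<Rightarrow> real"
  assumes w: "w \<in> \<V>" and e: "e \<in> \<V>" and we: "\<And>v. v \<in> \<V> \<Longrightarrow> aform w v = F Mn e v"
    and D: "lin_on S D" "\<And>u. u \<in> S \<Longrightarrow> D u \<in> S" "\<And>u v. u \<in> S \<Longrightarrow> v \<in> S \<Longrightarrow> l2_inner (D u) v = stiff_op u v"
    and j: "j \<notin> J"
  defines "T \<equiv> \<lambda>i. if i \<in> J then C.Q else if i = j then (\<lambda>u. u - C.Q u) else (\<lambda>u. u)"
  shows "aform (tensor_map (\<lambda>_. S) T w) (tensor_map (\<lambda>_. S) T w) \<le> 39 * H\<^sup>2 * F Mn e e"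
proof -
  define K2 where "K2 = (\<lambda>u v. l2_inner (D u) (D v))"
  define W where "W B = (\<lambda>i u v. B i (T i u) (T i v))" for B :: "'n \<Rightarrow> (real \<Rightarrow> real) \<Rightarrow> (real \<Rightarrow> real) \<Rightarrow> real"
  have T: "\<And>i. lin_on S (T i)" "\<And>i u. u \<in> S \<Longrightarrow> T i u \<in> S"
    using C.oproj_lin lin_compl[OF C.oproj_lin] lin_id by (auto simp: T_def)
  note M = psform_axioms and K = K.psform_axioms
  note cT = psform_comp[OF M T(1) T(2)] psform_comp[OF K T(1) T(2)]
  have K2: "psform S K2" unfolding K2_def by (rule psform_comp[OF M D(1,2)])
  \<comment> \<open>This covers the slots where \<open>T\<close> is the identity, so that one
    constant serves projected and untouched slots.\<close>
  have "26 * stiff_op u u \<ge> stiff_op u u" if "u \<in> S" for u using K.nonneg[OF that] by simp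
  then have le: "form_le (\<lambda>u v. l2_inner (T i u) (T i v)) (if i = j then (\<lambda>u v. H\<^sup>2 * stiff_op u v) else l2_inner)"
    "i \<noteq> j \<Longrightarrow> form_le (\<lambda>u v. stiff_op (T i u) (T i v)) (\<lambda>u v. 26 * stiff_op u v)"
    "form_le (\<lambda>u v. stiff_op (T j u) (T j v)) (\<lambda>u v. 26 * H\<^sup>2 * K2 u v)" for i
    unfolding form_le_def
    using cT(1)[of i] cT(2)[of i] cT(2)[of j] M psform_scale[OF K] psform_scale[OF K2] j
      C.oproj_le C.proj_bounds(1,2) C.proj_bounds(4)[OF _ D(2) D(3)]
    by (auto simp: T_def K2_def)
  have 1: "F (W Mn) w w \<le> H\<^sup>2 * F (Mn(j := stiff_op)) w w"
  proof (rule slot_bound)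
    show "form_le (W Mn i) (if i = j then (\<lambda>u v. H\<^sup>2 * stiff_op u v) else l2_inner)" for i
      unfolding W_def by (rule le(1))
  qed auto
  have 2: "F (W (Mn(j := stiff_op))) w w \<le> 26 * H\<^sup>2 * F (Mn(j := K2)) w w"
  proof (rule slot_bound[OF _ refl])
    fix i show "form_le (W (Mn(j := stiff_op)) i) ((Mn(j := \<lambda>u v. 26 * H\<^sup>2 * K2 u v)) i)"
      using le(1)[of i] le(3) by (cases "i = j") (simp_all add: W_def)
  qed
  have 3: "F (W (Mn(k := stiff_op))) w w \<le> H\<^sup>2 * 26 * F (Mn(j := stiff_op, k := stiff_op)) w w" if k: "k \<noteq> j" for k
  proof (rule two_slot_bound[OF _ _ refl])
    fix i show "form_le (W (Mn(k := stiff_op)) i) ((Mn(j := \<lambda>u v. H\<^sup>2 * stiff_op u v, k := \<lambda>u v. 26 * stiff_op u v)) i)"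
      using le(1)[of i] le(2)[of i] k by (cases "i = j"; cases "i = k") (simp_all add: W_def)
  qed (use k in auto)
  let ?t = "tensor_map (\<lambda>_. S) T w"
  have map: "F B ?t ?t = F (W B) w w" if "\<And>i. bilin_on S (B i)" for B
    unfolding W_def by (rule form_map[OF w T w T that])
  have "aform ?t ?t = F (W Mn) w w + (\<Sum>k\<in>UNIV. F (W (Mn(k := stiff_op))) w w)"
    unfolding aform_def by (subst (1 2) map) (auto simp: bilin K.bilin)
  also have "(\<Sum>k\<in>UNIV. F (W (Mn(k := stiff_op))) w w) = F (W (Mn(j := stiff_op))) w w + (\<Sum>k\<in>UNIV - {j}. F (W (Mn(k := stiff_op))) w w)"
    by (rule sum.remove) auto
  also have "F (W Mn) w w + \<dots> \<le> H\<^sup>2 * F (Mn(j := stiff_op)) w w + (26 * H\<^sup>2 * F (Mn(j := K2)) w w +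
      (\<Sum>k\<in>UNIV - {j}. H\<^sup>2 * 26 * F (Mn(j := stiff_op, k := stiff_op)) w w))"
    by (intro add_mono 1 2 sum_mono 3) auto
  also have "\<dots> = 26 * H\<^sup>2 * (F (Mn(j := K2)) w w + (\<Sum>k\<in>UNIV - {j}. F (Mn(j := stiff_op, k := stiff_op)) w w)) +
      H\<^sup>2 * F (Mn(j := stiff_op)) w w"
    by (simp add: sum_distrib_left algebra_simps)
  also have "\<dots> \<le> 39 * H\<^sup>2 * F Mn e e"
  proof -
    define a where "a = F (Mn(j := stiff_op)) w w"
    define b where "b = F (Mn(j := K2)) w w + (\<Sum>k\<in>UNIV - {j}. F (Mn(j := stiff_op, k := stiff_op)) w w)"
    have a: "0 \<le> a" unfolding a_def by (rule form_nonneg, rule slot_psform[OF K])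
    have "0 \<le> F (Mn(j := K2)) w w" by (rule form_nonneg, rule slot_psform[OF K2])
    moreover have "0 \<le> F (Mn(j := stiff_op, k := stiff_op)) w w" for k
      by (rule form_nonneg) (simp add: M K)
    ultimately have b: "0 \<le> b" unfolding b_def by (intro add_nonneg_nonneg sum_nonneg) auto
    have "2 * a + b \<le> F Mn e e"
      using discrete_regularity[OF w e we D, of j] by (simp add: a_def b_def K2_def)
    \<comment> \<open>The left-hand side is at most \<open>26 * (2 * a + b)\<close>, so the constant
      39 leaves room.\<close>
    then have "26 * b + a \<le> 39 * F Mn e e" using a b by linarith
    then have "H\<^sup>2 * (26 * b + a) \<le> H\<^sup>2 * (39 * F Mn e e)" by (rule mult_left_mono) simp
    then show ?thesis unfolding a_def[symmetric] b_def[symmetric] by (simp add: algebra_simps)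
  qed
  finally show ?thesis .
qed

lemma tensor_map_split:
  fixes w :: "real ^ 'n::finite \<Rightarrow> real"
  assumes w: "w \<in> \<V>" and T: "\<And>i. lin_on S (T i)" "\<And>i u. u \<in> S \<Longrightarrow> T i u \<in> S"
    and U: "lin_on S U" "\<And>u. u \<in> S \<Longrightarrow> U u \<in> S"
  shows "tensor_map (\<lambda>_. S) T w - tensor_map (\<lambda>_. S) (T(j := U)) w =
    tensor_map (\<lambda>_. S) (T(j := \<lambda>u. T j u - U u)) w"
proof
  fix x
  have pt: "pure_tensor (\<lambda>i. (T(j := V)) i (I i)) x = V (I j) (x $ j) * (\<Prod>i\<in>UNIV - {j}. T i (I i) (x $ i))" for V I
    unfolding pure_tensor_def by (subst prod.remove[of _ j]) auto
  have lin: "lin_on S (\<lambda>u. T j u - U u)" "\<And>u. u \<in> S \<Longrightarrow> T j u - U u \<in> S"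
    using T(1)[of j] T(2)[of _ j] U by (auto simp: lin_on_def algebra_simps)
  have ev: "tensor_map (\<lambda>_. S) (T(j := V)) w x =
      (\<Sum>I\<in>Idx. coef w I * (V (I j) (x $ j) * (\<Prod>i\<in>UNIV - {j}. T i (I i) (x $ i))))"
    if V: "lin_on S V" "\<And>u. u \<in> S \<Longrightarrow> V u \<in> S" for V
  proof -
    have "lin_on S ((T(j := V)) i)" "u \<in> S \<Longrightarrow> (T(j := V)) i u \<in> S" for i u
      using T V by simp_all
    from tensor_map_eval[where T="T(j := V)" and x=x, OF w this] show ?thesis unfolding pt .
  qed
  show "(tensor_map (\<lambda>_. S) T w - tensor_map (\<lambda>_. S) (T(j := U)) w) x =
      tensor_map (\<lambda>_. S) (T(j := \<lambda>u. T j u - U u)) w x"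
    using ev[OF T(1)[of j] T(2)[of _ j]] ev[OF U] ev[OF lin]
    by (simp add: sum_subtractf[symmetric] algebra_simps)
qed

text \<open>The coordinates are projected one after another, so the error is a sum of
  \<open>CARD('n)\<close> increments, each bounded by \<open>increment_bound\<close>; the triangle
  inequality produces the dimension factor.\<close>

lemma approximation:
  fixes w e :: "real ^ 'n::finite \<Rightarrow> real"
  assumes w: "w \<in> \<V>" and e: "e \<in> \<V>" and we: "\<And>v. v \<in> \<V> \<Longrightarrow> aform w v = F Mn e v"
  shows "\<exists>v\<in>\<V>\<^sub>c. sqrt (aform (w - v) (w - v)) \<le> real CARD('n) * sqrt (39 * H\<^sup>2 * F Mn e e)"
proof -
  interpret A: pdform \<V> "aform :: (real ^ 'n \<Rightarrow> real) \<Rightarrow> _" by (rule aform_pdform)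
  \<comment> \<open>The univariate discrete Laplacian, as the mass representer of the stiffness
    functional.\<close>
  have "\<exists>d. d \<in> S \<and> (\<forall>v\<in>S. l2_inner d v = stiff_op u v)" if "u \<in> S" for u
    using riesz[OF pdform_axioms spline_fin_det[OF p m] K.lin_right[OF that]] by blast
  then obtain D where D: "\<And>u. u \<in> S \<Longrightarrow> D u \<in> S" "\<And>u v. u \<in> S \<Longrightarrow> v \<in> S \<Longrightarrow> l2_inner (D u) v = stiff_op u v"
    by metis
  have Dlin: "lin_on S D"
    by (rule lin_onI; rule eqI) (simp_all add: D add_left scale_left K.add_left K.scale_left)
  define T where "T J i = (if i \<in> J then C.Q else (\<lambda>u. u))" for J and i :: 'n
  have T: "\<And>i. lin_on S (T J i)" "\<And>i u. u \<in> S \<Longrightarrow> T J i u \<in> S" for J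
    using C.oproj_lin lin_id by (auto simp: T_def)
  let ?v = "\<lambda>J. tensor_map (\<lambda>_. S) (T J) w"
  have vV: "?v J \<in> \<V>" for J by (rule tensor_map_in[OF w T]) auto
  let ?b = "sqrt (39 * H\<^sup>2 * F Mn e e)"
  have "sqrt (aform (w - ?v J) (w - ?v J)) \<le> real (card J) * ?b" if "finite J" for J
    using that
  proof (induction J)
    case empty
    have "?v {} = w" using tensor_map_id[OF w] by (simp add: T_def[abs_def])
    then have z: "w - ?v {} = 0" by simp
    have "aform (0 :: real ^ 'n \<Rightarrow> real) 0 = 0" by (rule A.zero_left) (rule A.closed(4))
    then show ?case by (simp only: z real_sqrt_zero card.empty of_nat_0 mult_zero_left order_refl)
  next
    case (insert j J)
    let ?t = "?v J - ?v (insert j J)"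
    have "T (insert j J) = (T J)(j := C.Q)" by (auto simp: T_def fun_eq_iff)
    then have "?t = tensor_map (\<lambda>_. S) ((T J)(j := \<lambda>u. T J j u - C.Q u)) w"
      using tensor_map_split[where j=j and T="T J", OF w T C.oproj_lin C.oproj_inV] by simp
    also have "(T J)(j := \<lambda>u. T J j u - C.Q u) =
        (\<lambda>i. if i \<in> J then C.Q else if i = j then (\<lambda>u. u - C.Q u) else (\<lambda>u. u))"
      using insert.hyps by (auto simp: T_def fun_eq_iff)
    finally have t: "?t = tensor_map (\<lambda>_. S)
        (\<lambda>i. if i \<in> J then C.Q else if i = j then (\<lambda>u. u - C.Q u) else (\<lambda>u. u)) w" .
    have "aform ?t ?t \<le> 39 * H\<^sup>2 * F Mn e e"
      unfolding t by (rule increment_bound[OF w e we Dlin D insert.hyps(2)])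
    then have "sqrt (aform ?t ?t) \<le> ?b" by simp
    moreover have "w - ?v (insert j J) = (w - ?v J) + ?t" by simp
    then have "sqrt (aform (w - ?v (insert j J)) (w - ?v (insert j J))) \<le> sqrt (aform (w - ?v J) (w - ?v J)) + sqrt (aform ?t ?t)"
      using A.triangle[of "w - ?v J" ?t] w vV by (metis A.closed(2))
    moreover have "real (card (insert j J)) = real (card J) + 1" using insert.hyps by simp
    ultimately show ?case using insert.IH by (simp only: distrib_right mult_1)
  qed
  from this[of UNIV] have "sqrt (aform (w - ?v UNIV) (w - ?v UNIV)) \<le> real CARD('n) * ?b" by simp
  moreover have "?v UNIV \<in> tensor_space (\<lambda>_. spline_space0 p (m div 2))"
    by (rule tensor_map_in[OF w]) (use C.oproj_lin C.oproj_in C.WV in \<open>auto simp: T_def\<close>)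
  then have "?v UNIV \<in> \<V>\<^sub>c" using tensor_space_mono[OF coarse_proj_subset] by blast
  ultimately show ?thesis by blast
qed

text \<open>\<open>w\<close> solves the dual problem with right-hand side \<open>e\<close>. By
  orthogonality \<open>F Mn e e = aform (w - v) e\<close> for coarse \<open>v\<close>, and the bound
  on \<open>w - v\<close> contains the square root of \<open>F Mn e e\<close>, which is
  absorbed.\<close>

lemma aubin_nitsche:
  fixes e :: "real ^ 'n::finite \<Rightarrow> real"
  assumes e: "e \<in> \<V>" and orth: "\<And>v. v \<in> \<V>\<^sub>c \<Longrightarrow> aform e v = 0"
  shows "F Mn e e \<le> 39 * (real CARD('n))\<^sup>2 * H\<^sup>2 * aform e e"
proof -
  interpret A: pdform \<V> "aform :: (real ^ 'n \<Rightarrow> real) \<Rightarrow> _" by (rule aform_pdform)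
  interpret Mf: pdform \<V> "F (Mn :: 'n \<Rightarrow> _)" by (rule mass_pdform)
  obtain w where w: "w \<in> \<V>" "\<And>v. v \<in> \<V> \<Longrightarrow> aform w v = F Mn e v"
    using riesz[OF A.pdform_axioms \<V>_fin_det Mf.lin_right[OF e]] by blast
  obtain v where v: "v \<in> \<V>\<^sub>c" "sqrt (aform (w - v) (w - v)) \<le> real CARD('n) * sqrt (39 * H\<^sup>2 * F Mn e e)"
    using approximation[OF w(1) e w(2)] by blast
  have vV: "v \<in> \<V>" using v coarse_subset by blast
  have "aform v e = 0" using orth[OF v(1)] A.sym[OF vV e] by simp
  then have "F Mn e e = aform (w - v) e" using w e vV by (simp add: A.diff_left)
  also have "\<dots> \<le> sqrt (aform (w - v) (w - v)) * sqrt (aform e e)"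
    using A.cauchy_schwarz_sqrt[of "w - v" e] w(1) vV e by simp
  also have "\<dots> \<le> real CARD('n) * sqrt (39 * H\<^sup>2 * F Mn e e) * sqrt (aform e e)"
    using v(2) A.nonneg[OF e] by (intro mult_right_mono) auto
  finally have "F Mn e e \<le> (real CARD('n) * sqrt 39 * H) * sqrt (F Mn e e) * sqrt (aform e e)"
    by (simp add: real_sqrt_mult real_sqrt_divide mult_ac)
  then have "F Mn e e \<le> (real CARD('n) * sqrt 39 * H)\<^sup>2 * aform e e"
    using Mf.nonneg[OF e] A.nonneg[OF e] by (intro sqrt_absorb) auto
  then show ?thesis by (simp add: power_mult_distrib power_divide mult_ac)
qed

lemma approximation_property:
  fixes u :: "real ^ 'n::finite \<Rightarrow> real"
  assumes u: "u \<in> \<V>"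
  defines "e \<equiv> u - oproj system_op \<V>\<^sub>c u"
  shows "smoother p m e e \<le> (26 + 1872 * real CARD('n) ^ 3) * system_op u u"
proof -
  interpret A: oprojection \<V> "system_op :: (real ^ 'n \<Rightarrow> real) \<Rightarrow> _" \<V>\<^sub>c
    by (intro oprojection.intro oprojection_axioms.intro system_pdform coarse_subspace coarse_subset \<V>_fin_det)
  have eV: "e \<in> \<V>" using u by (simp add: e_def)
  have "aform e v = 0" if "v \<in> \<V>\<^sub>c" for v
    using A.oproj_orth[OF u that] system_op_eq[OF eV, of v] that coarse_subset by (auto simp: e_def)
  then have an: "F Mn e e \<le> 39 * (real CARD('n))\<^sup>2 * H\<^sup>2 * aform e e" by (rule aubin_nitsche[OF eV])
  have "real m = 2 * real (m div 2)" using even by (auto elim!: evenE)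
  \<comment> \<open>Since \<open>H\<close> is \<open>2 / m\<close>, sigma times
    \<open>H\<^sup>2\<close> is 48; multiplied by 39 this gives 1872.\<close>
  then have mH: "12 * (real m)\<^sup>2 * H\<^sup>2 = 48" using coarse_pos by (simp add: power_mult_distrib power_divide)
  have "real CARD('n) * (12 * (real m)\<^sup>2) * F Mn e e \<le>
      real CARD('n) * (12 * (real m)\<^sup>2) * (39 * (real CARD('n))\<^sup>2 * H\<^sup>2 * aform e e)"
    by (rule mult_left_mono[OF an]) auto
  also have "\<dots> = (12 * (real m)\<^sup>2 * H\<^sup>2) * (39 * real CARD('n) ^ 3 * aform e e)"
    by (simp only: power3_eq_cube power2_eq_square mult_ac)
  also have "\<dots> = 1872 * real CARD('n) ^ 3 * aform e e" by (simp add: mH)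
  finally have "lform e e \<le> (26 + 1872 * real CARD('n) ^ 3) * aform e e"
    using lform_le[of e] by (simp only: distrib_right mult_1)
  also have "\<dots> \<le> (26 + 1872 * real CARD('n) ^ 3) * system_op u u"
    using A.oproj_compl_le[OF u] system_op_eq[OF eV eV] by (intro mult_left_mono) (auto simp: e_def)
  finally show ?thesis using smoother_eq[OF eV eV] by simp
qed

section \<open>Convergence of the two-grid method\<close>

lemma inv_op_props:
  fixes f :: "(real ^ 'n::finite \<Rightarrow> real) \<Rightarrow> real"
  assumes "pdform W T" "fin_det W" "lin_on W f"
  shows "inv_op W T f \<in> W" "\<And>v. v \<in> W \<Longrightarrow> T (inv_op W T f) v = f v"
  using theI'[OF riesz[OF assms]] unfolding inv_op_def by blast+

text \<open>The iteration is translated into its error propagation: with \<open>u'\<close> the exact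
  solution, the residual at \<open>w\<close> is the functional \<open>- system_op (w - u')\<close>,
  so every step acts linearly on \<open>w - u'\<close>.\<close>

lemma two_grid_rate:
  fixes f :: "(real ^ 'n::finite \<Rightarrow> real) \<Rightarrow> real" and \<nu> :: nat
  assumes f: "lin_on \<V> f" and \<nu>: "8 * (26 + 1872 * real CARD('n) ^ 3) \<le> real \<nu>"
    and T: "T \<in> {smoother p m, system_op}" and u: "u \<in> \<V>"
  defines "u' \<equiv> inv_op \<V> system_op f"
  shows "two_grid_step p m (1 / 2) \<nu> f u \<in> \<V>"
    "sqrt (T (two_grid_step p m (1 / 2) \<nu> f u - u') (two_grid_step p m (1 / 2) \<nu> f u - u')) \<le>
      1 / 2 * sqrt (T (u - u') (u - u'))"
proof -
  let ?A = "system_op :: (real ^ 'n \<Rightarrow> real) \<Rightarrow> _" and ?L = "smoother p m :: (real ^ 'n \<Rightarrow> real) \<Rightarrow> _"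
  let ?C = "26 + 1872 * real CARD('n) ^ 3"
  interpret A: oprojection \<V> ?A \<V>\<^sub>c
    by (intro oprojection.intro oprojection_axioms.intro system_pdform coarse_subspace coarse_subset \<V>_fin_det)
  interpret L: pdform \<V> ?L by (rule smoother_pdform)
  define X where "X e = inv_op \<V> ?L (\<lambda>v. 1 / 2 * ?A e v)" for e
  define S' where "S' e = e - X e" for e
  have lin: "lin_on \<V> (\<lambda>v. 1 / 2 * ?A e v)" if "e \<in> \<V>" for e
    using that by (intro lin_onI) (simp_all add: A.add_right A.scale_right distrib_left)
  note X = inv_op_props[OF L.pdform_axioms \<V>_fin_det lin, folded X_def]
  interpret G: two_grid \<V> ?A ?L \<V>\<^sub>c "1 / 2" ?C X S'
  proof
    fix w z :: "real ^ 'n \<Rightarrow> real" assume w: "w \<in> \<V>"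
    show "1 / 2 * ?A w w \<le> ?L w w"
      using aform_le_lform[of w] system_op_eq[OF w w] smoother_eq[OF w w] by simp
    show "?L (w - oproj ?A \<V>\<^sub>c w) (w - oproj ?A \<V>\<^sub>c w) \<le> ?C * ?A w w"
      by (rule approximation_property[OF w])
    show "X w \<in> \<V>" by (rule X(1)[OF w])
    show "?L (X w) z = 1 / 2 * ?A w z" if "z \<in> \<V>" by (rule X(2)[OF w that])
    show "S' w = w - X w" by (simp add: S'_def)
  qed simp
  have u': "u' \<in> \<V>" "\<And>v. v \<in> \<V> \<Longrightarrow> ?A u' v = f v"
    unfolding u'_def by (rule inv_op_props[OF A.pdform_axioms \<V>_fin_det f], assumption?)+
  have res: "f v - ?A w v = - ?A (w - u') v" if "w \<in> \<V>" "v \<in> \<V>" for w v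
    using that u' by (simp add: A.diff_left)
  have lin_res: "lin_on \<V> (\<lambda>v. f v - ?A w v)" if "w \<in> \<V>" for w
    using that f by (intro lin_onI) (simp_all add: lin_on_add lin_on_scale A.add_right A.scale_right algebra_simps)
  have step: "smoothing_step p m (1 / 2) f w \<in> \<V>" "smoothing_step p m (1 / 2) f w - u' = S' (w - u')"
    if w: "w \<in> \<V>" for w
  proof -
    define g where "g = inv_op \<V> ?L (\<lambda>v. f v - ?A w v)"
    have g: "g \<in> \<V>" "\<And>v. v \<in> \<V> \<Longrightarrow> ?L g v = f v - ?A w v"
      unfolding g_def by (rule inv_op_props[OF L.pdform_axioms \<V>_fin_det lin_res[OF w]], assumption?)+
    have s: "smoothing_step p m (1 / 2) f w = w + (1 / 2) *\<^sub>R g"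
      by (simp add: smoothing_step_def g_def tensor_splines_def plus_fun_def scaleR_fun_def)
    have wu: "w - u' \<in> \<V>" using w u' by simp
    have "(1 / 2) *\<^sub>R g = - X (w - u')"
    proof (rule L.eqI)
      show "(1 / 2) *\<^sub>R g \<in> \<V>" using g(1) by (rule L.closed)
      show "- X (w - u') \<in> \<V>" using X(1)[OF wu] by (rule L.closed)
      fix v :: "real ^ 'n \<Rightarrow> real" assume v: "v \<in> \<V>"
      have "?L (- X (w - u')) v = - ?L (X (w - u')) v"
        using L.scale_left[OF X(1)[OF wu] v, of "-1"] by simp
      then show "?L ((1 / 2) *\<^sub>R g) v = ?L (- X (w - u')) v"
        using g v res[OF w v] X(2)[OF wu v] by (simp add: L.scale_left)
    qed
    then show "smoothing_step p m (1 / 2) f w - u' = S' (w - u')" by (simp add: s S'_def)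
    show "smoothing_step p m (1 / 2) f w \<in> \<V>" unfolding s using w g by simp
  qed
  have pow: "(smoothing_step p m (1 / 2) f ^^ k) u \<in> \<V> \<and> (smoothing_step p m (1 / 2) f ^^ k) u - u' = (S' ^^ k) (u - u')" for k
  proof (induction k)
    case (Suc k)
    then show ?case using step by (simp only: funpow.simps o_apply)
  qed (use u in simp)
  define w where "w = (smoothing_step p m (1 / 2) f ^^ \<nu>) u"
  have w: "w \<in> \<V>" "w - u' = (S' ^^ \<nu>) (u - u')" using pow[of \<nu>] by (auto simp: w_def)
  have wu: "w - u' \<in> \<V>" using w(1) u'(1) by (rule A.closed)
  define c where "c = inv_op \<V>\<^sub>c ?A (\<lambda>v. f v - ?A w v)"
  have c: "c \<in> \<V>\<^sub>c" "\<And>v. v \<in> \<V>\<^sub>c \<Longrightarrow> ?A c v = f v - ?A w v"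
    unfolding c_def
    by (rule inv_op_props[OF A.restrict_pd[OF coarse_subspace coarse_subset] fin_det_subset[OF \<V>_fin_det coarse_subset]
        lin_on_subset[OF lin_res[OF w(1)] coarse_subset]], assumption?)+
  have cV: "c \<in> \<V>" using c coarse_subset by blast
  have s: "two_grid_step p m (1 / 2) \<nu> f u = w + c"
    by (simp add: two_grid_step_def coarse_correction_def w_def c_def tensor_splines_def plus_fun_def)
  \<comment> \<open>The correction \<open>c\<close> solves the coarse problem for the residual, so
    adding it subtracts the energy projection of the error.\<close>
  have "oproj ?A \<V>\<^sub>c (w - u') = - c"
  proof (rule A.oproj_eqI[OF wu])
    show "- c \<in> \<V>\<^sub>c" using c(1) coarse_subspace by (rule subspace_neg[rotated])
    fix v :: "real ^ 'n \<Rightarrow> real" assume v: "v \<in> \<V>\<^sub>c"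
    then have vV: "v \<in> \<V>" using coarse_subset by blast
    show "?A (w - u' - - c) v = 0"
      using c(2)[OF v] res[OF w(1) vV] A.add_left[OF wu cV vV] by simp
  qed
  then have e: "two_grid_step p m (1 / 2) \<nu> f u - u' = (S' ^^ \<nu>) (u - u') - oproj ?A \<V>\<^sub>c ((S' ^^ \<nu>) (u - u'))"
    using w(2) by (simp add: s)
  show "two_grid_step p m (1 / 2) \<nu> f u \<in> \<V>" unfolding s using w(1) cV by simp
  \<comment> \<open>The damping 1/2 is the reason for the 8 in the lower bound on
    \<open>\<nu>\<close>.\<close>
  have n: "4 * ?C \<le> 1 / 2 * real \<nu>" using \<nu> by simp
  have "0 < real \<nu>" using \<nu> by (smt (verit) zero_le_power of_nat_0_le_iff)
  then have "0 < \<nu>" by simp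
  note rates = G.rate_L[OF n this, of "u - u'"] G.rate_A[OF n this, of "u - u'"]
  show "sqrt (T (two_grid_step p m (1 / 2) \<nu> f u - u') (two_grid_step p m (1 / 2) \<nu> f u - u')) \<le>
      1 / 2 * sqrt (T (u - u') (u - u'))"
    using T rates u u'(1) unfolding e by auto
qed

end

theorem theorem10:
  shows "\<exists>(\<tau>::real) (\<nu>::nat) (q::real). 0 < \<tau> \<and> 0 < \<nu> \<and> 0 \<le> q \<and> q < 1 \<and>
    (\<forall>(p::nat) (m::nat). 0 < p \<and> 0 < m \<and> even m \<longrightarrow>
       (\<forall>f\<in>dual_space (tensor_splines p m :: (real ^ 'n::finite \<Rightarrow> real) set).
          \<forall>T\<in>{smoother p m, system_op}.
            converges_with_rate (tensor_splines p m) (op_norm T) (two_grid_step p m \<tau> \<nu> f)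
              (inv_op (tensor_splines p m) system_op f) q))"
proof -
  \<comment> \<open>This number depends on the dimension only.\<close>
  define \<nu> where "\<nu> = nat \<lceil>8 * (26 + 1872 * real CARD('n) ^ 3)\<rceil>"
  have \<nu>: "8 * (26 + 1872 * real CARD('n) ^ 3) \<le> real \<nu>" unfolding \<nu>_def by linarith
  have "0 < real \<nu>" using \<nu> by (smt (verit) zero_le_power of_nat_0_le_iff)
  then have pos: "0 < \<nu>" by simp
  have "converges_with_rate (tensor_splines p m) (op_norm T) (two_grid_step p m (1 / 2) \<nu> f)
      (inv_op (tensor_splines p m) system_op f) (1 / 2)"
    if pm: "0 < p" "0 < m" "even m" and f: "f \<in> dual_space (tensor_splines p m :: (real ^ 'n \<Rightarrow> real) set)"
      and T: "T \<in> {smoother p m, system_op}" for p m f T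
  proof -
    \<comment> \<open>The basis serves to enter the locale; the conclusion does not refer to
      it.\<close>
    obtain E where "onb (spline_space p m) l2_inner E"
      using onb_exists[OF spline_mass_pdform spline_fin_det] pm by blast
    then interpret coarse_splines p m E using pm by unfold_locales auto
    let ?V = "tensor_space (\<lambda>_. spline_space p m) :: (real ^ 'n \<Rightarrow> real) set"
    have f': "lin_on ?V f" using f by (simp add: dual_space_lin_on tensor_splines_def)
    note tg = two_grid_rate[OF f' \<nu> T]
    show ?thesis
      unfolding converges_with_rate_def tensor_splines_def
    proof (intro ballI allI)
      fix u0 :: "real ^ 'n \<Rightarrow> real" and k assume u0: "u0 \<in> ?V"
      have "(two_grid_step p m (1 / 2) \<nu> f ^^ k) u0 \<in> ?V" for k
        by (induction k) (use u0 tg(1) in auto)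
      from tg(2)[OF this[of k]]
      show "op_norm T (\<lambda>x. (two_grid_step p m (1 / 2) \<nu> f ^^ Suc k) u0 x - inv_op ?V system_op f x) \<le>
          1 / 2 * op_norm T (\<lambda>x. (two_grid_step p m (1 / 2) \<nu> f ^^ k) u0 x - inv_op ?V system_op f x)"
        by (simp add: op_norm_def fun_diff_def)
    qed
  qed
  then show ?thesis using pos by (intro exI[of _ "1 / 2 :: real"] exI[of _ \<nu>]) auto
qed

end
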